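(* Fix $0<\alpha,\beta,M<+\infty$. Suppose $\alpha\beta M^2=16\pi^2$, and pick a point $\xi^\star\in(\mathbb{R}\times\{0\})\cup(\{0\}\times\mathbb{R})$ on the cross which is not in $\Lambda_{\alpha,\beta}$. If $\Lambda^\star_{\alpha,\beta}:=\Lambda_{\alpha,\beta}\cup\{\xi^\star\}$, then $(\Gamma_M^+,\Lambda^\star_{\alpha,\beta})$ is a Heisenberg uniqueness pair.
   Context: For a finite complex-valued Borel measure $\mu$ on $\mathbb{R}^2$, its Fourier transform is $\hat\mu(\xi)=\int_{\mathbb{R}^2}\mathrm{e}^{\mathrm{i}\pi\langle x,\xi\rangle}\,\mathrm{d}\mu(x)$, where $\langle x,\xi\rangle=x_1\xi_1+x_2\xi_2$. For a finite disjoint union $\Gamma\subset\mathbb{R}^2$ of smooth curves, $\mathrm{AC}(\Gamma)$ is the space of finite complex-valued Borel measures on $\mathbb{R}^2$ supported on $\Gamma$ that are absolutely continuous with respect to arc length measure on $\Gamma$. The pair $(\Gamma,\Lambda)$, with $\Lambda\subset\mathbb{R}^2$, is a Heisenberg uniqueness pair if $\mu\in\mathrm{AC}(\Gamma)$ and $\hat\mu|_\Lambda=0$ imply $\mu=0$. $\Gamma_M^+=\{x\in\mathbb{R}^2:\ x_1x_2=M^2/(4\pi^2),\ x_1>0\}$ and $\Lambda_{\alpha,\beta}=(\alpha\mathbb{Z}\times\{0\})\cup(\{0\}\times\beta\mathbb{Z})$. *)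

theory Defs
  imports "HOL-Analysis.Analysis"
begin

text \<open>Complex Borel measures are countably additive set functions on the Borel sets; only the
  values on Borel sets matter, so equality with the zero measure is stated on Borel sets.\<close>

definition complex_borel_measure :: "('a::topological_space set \<Rightarrow> complex) \<Rightarrow> bool" where
  "complex_borel_measure \<mu> \<longleftrightarrow>
     \<mu> {} = 0 \<and>
     (\<forall>A :: nat \<Rightarrow> 'a set. range A \<subseteq> sets borel \<longrightarrow> disjoint_family A \<longrightarrow>
        (\<lambda>n. \<mu> (A n)) sums \<mu> (\<Union>n. A n))"

definition zero_on_borel :: "('a::topological_space set \<Rightarrow> complex) \<Rightarrow> bool" where
  "zero_on_borel \<mu> \<longleftrightarrow> (\<forall>A \<in> sets borel. \<mu> A = 0)"

text \<open>The positive part \<open>\<nu>\<^sup>+\<close> in the Jordan decomposition of a finite signed measure \<open>\<nu>\<close>;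
  the negative part is the positive part of \<open>-\<nu>\<close>.\<close>

definition upper_variation :: "('a::topological_space set \<Rightarrow> real) \<Rightarrow> 'a measure" where
  "upper_variation \<nu> =
     measure_of UNIV (sets borel) (\<lambda>A. SUP B \<in> {B \<in> sets borel. B \<subseteq> A}. ennreal (\<nu> B))"

definition complex_measure_integral ::
    "('a::topological_space set \<Rightarrow> complex) \<Rightarrow> ('a \<Rightarrow> complex) \<Rightarrow> complex" where
  "complex_measure_integral \<mu> f =
     (LINT x | upper_variation (\<lambda>A. Re (\<mu> A)). f x) - (LINT x | upper_variation (\<lambda>A. - Re (\<mu> A)). f x)
     + \<i> * ((LINT x | upper_variation (\<lambda>A. Im (\<mu> A)). f x) - (LINT x | upper_variation (\<lambda>A. - Im (\<mu> A)). f x))"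

definition fourier_transform :: "((real \<times> real) set \<Rightarrow> complex) \<Rightarrow> real \<times> real \<Rightarrow> complex" where
  "fourier_transform \<mu> \<xi> =
     complex_measure_integral \<mu> (\<lambda>x. exp (\<i> * of_real (pi * (fst x * fst \<xi> + snd x * snd \<xi>))))"

definition smooth_on_open :: "real set \<Rightarrow> (real \<Rightarrow> real \<times> real) \<Rightarrow> bool" where
  "smooth_on_open U \<gamma> \<longleftrightarrow> open U \<and>
     (\<exists>D :: nat \<Rightarrow> real \<Rightarrow> real \<times> real. D 0 = \<gamma> \<and>
        (\<forall>k. \<forall>t \<in> U. (D k has_vector_derivative D (Suc k) t) (at t)))"

text \<open>A regular, injective, smooth parametrization. The interval need not be open, so that closed
  curves are covered as well, by half-open parameter intervals.\<close>

definition smooth_curve :: "real set \<Rightarrow> (real \<Rightarrow> real \<times> real) \<Rightarrow> bool" where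
  "smooth_curve I \<gamma> \<longleftrightarrow>
     is_interval I \<and> interior I \<noteq> {} \<and> inj_on \<gamma> I \<and>
     (\<exists>U. I \<subseteq> U \<and> smooth_on_open U \<gamma>) \<and>
     (\<forall>t \<in> I. vector_derivative \<gamma> (at t) \<noteq> 0)"

definition arc_length :: "real set \<Rightarrow> (real \<Rightarrow> real \<times> real) \<Rightarrow> (real \<times> real) set \<Rightarrow> ennreal" where
  "arc_length I \<gamma> A =
     (\<integral>\<^sup>+ t \<in> {t \<in> I. \<gamma> t \<in> A}. ennreal (norm (vector_derivative \<gamma> (at t))) \<partial>lborel)"

text \<open>\<open>\<Gamma>\<close> is a finite disjoint union of smooth curves and \<open>\<sigma>\<close> is the arc length measure on \<open>\<Gamma>\<close>
  (as a set function on the Borel subsets of the plane). It does not depend on the chosen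
  parametrizations.\<close>

definition is_arc_length_measure ::
    "(real \<times> real) set \<Rightarrow> ((real \<times> real) set \<Rightarrow> ennreal) \<Rightarrow> bool" where
  "is_arc_length_measure \<Gamma> \<sigma> \<longleftrightarrow>
     (\<exists>(n::nat) I \<gamma>. (\<forall>i<n. smooth_curve (I i) (\<gamma> i)) \<and>
        disjoint_family_on (\<lambda>i. \<gamma> i ` I i) {..<n} \<and>
        \<Gamma> = (\<Union>i<n. \<gamma> i ` I i) \<and>
        \<sigma> = (\<lambda>A. \<Sum>i<n. arc_length (I i) (\<gamma> i) A))"

definition finite_union_of_smooth_curves :: "(real \<times> real) set \<Rightarrow> bool" where
  "finite_union_of_smooth_curves \<Gamma> \<longleftrightarrow> (\<exists>\<sigma>. is_arc_length_measure \<Gamma> \<sigma>)"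

definition AC :: "(real \<times> real) set \<Rightarrow> ((real \<times> real) set \<Rightarrow> complex) set" where
  "AC \<Gamma> = {\<mu>. complex_borel_measure \<mu> \<and>
              (\<forall>A \<in> sets borel. A \<inter> \<Gamma> = {} \<longrightarrow> \<mu> A = 0) \<and>
              (\<exists>\<sigma>. is_arc_length_measure \<Gamma> \<sigma> \<and> (\<forall>A \<in> sets borel. \<sigma> A = 0 \<longrightarrow> \<mu> A = 0))}"

definition heisenberg_uniqueness_pair :: "(real \<times> real) set \<Rightarrow> (real \<times> real) set \<Rightarrow> bool" where
  "heisenberg_uniqueness_pair \<Gamma> \<Lambda> \<longleftrightarrow>
     finite_union_of_smooth_curves \<Gamma> \<and>
     (\<forall>\<mu> \<in> AC \<Gamma>. (\<forall>\<xi> \<in> \<Lambda>. fourier_transform \<mu> \<xi> = 0) \<longrightarrow> zero_on_borel \<mu>)"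

definition hyperbola_branch :: "real \<Rightarrow> (real \<times> real) set" where
  "hyperbola_branch M = {x. fst x * snd x = M\<^sup>2 / (4 * pi\<^sup>2) \<and> fst x > 0}"

definition lattice_cross :: "real \<Rightarrow> real \<Rightarrow> (real \<times> real) set" where
  "lattice_cross \<alpha> \<beta> = (range (\<lambda>k::int. \<alpha> * of_int k) \<times> {0}) \<union> ({0} \<times> range (\<lambda>k::int. \<beta> * of_int k))"

text \<open>The set function in \<^const>\<open>upper_variation\<close> is a finite measure, so the integrals above are the
  genuine ones.\<close>

definition signed_borel :: "('a::topological_space set \<Rightarrow> real) \<Rightarrow> bool" where
  "signed_borel \<nu> \<longleftrightarrow>
     \<nu> {} = 0 \<and>
     (\<forall>A :: nat \<Rightarrow> 'a set. range A \<subseteq> sets borel \<longrightarrow> disjoint_family A \<longrightarrow>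
        (\<lambda>n. \<nu> (A n)) sums \<nu> (\<Union>n. A n))"

lemma signed_borel_complex:
  assumes "complex_borel_measure \<mu>"
  shows "signed_borel (\<lambda>A. Re (\<mu> A))" "signed_borel (\<lambda>A. - Re (\<mu> A))"
    "signed_borel (\<lambda>A. Im (\<mu> A))" "signed_borel (\<lambda>A. - Im (\<mu> A))"
  using assms unfolding complex_borel_measure_def signed_borel_def
  by (auto intro!: sums_Re sums_Im sums_minus[OF sums_Re] sums_minus[OF sums_Im])

lemma signed_borel_sums:
  fixes A :: "nat \<Rightarrow> 'a::topological_space set"
  assumes "signed_borel \<nu>" "range A \<subseteq> sets borel" "disjoint_family A"
  shows "(\<lambda>n. \<nu> (A n)) sums \<nu> (\<Union>n. A n)"
  using assms by (simp add: signed_borel_def)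

lemma signed_borel_Un:
  assumes "signed_borel \<nu>" "A \<in> sets borel" "B \<in> sets borel" "A \<inter> B = {}"
  shows "\<nu> (A \<union> B) = \<nu> A + \<nu> B"
proof -
  have e: "\<nu> {} = 0" using assms(1) by (simp add: signed_borel_def)
  have "range (binaryset A B) \<subseteq> sets borel"
    using assms(2,3) by (simp add: range_binaryset_eq)
  moreover have "disjoint_family (binaryset A B)"
    unfolding disjoint_family_on_def binaryset_def using assms(4) by (simp add: Int_commute)
  ultimately have s: "(\<lambda>n. \<nu> (binaryset A B n)) sums \<nu> (\<Union>n. binaryset A B n)"
    by (rule signed_borel_sums[OF assms(1)])
  from sums_unique2[OF s binaryset_sums[of \<nu> A B, OF e]] show ?thesis
    by (simp add: UN_binaryset_eq)
qed

lemma
  assumes \<nu>: "signed_borel (\<nu> :: 'a::topological_space set \<Rightarrow> real)"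
  shows emeasure_upper_variation: "A \<in> sets borel \<Longrightarrow>
      emeasure (upper_variation \<nu>) A = (SUP B \<in> {B \<in> sets borel. B \<subseteq> A}. ennreal (\<nu> B))"
    and sets_upper_variation: "sets (upper_variation \<nu>) = sets borel"
proof -
  let ?P = "\<lambda>A. SUP B \<in> {B \<in> sets borel. B \<subseteq> A}. ennreal (\<nu> B)"
  have e: "\<nu> {} = 0" using \<nu> by (simp add: signed_borel_def)
  have mono: "?P A \<le> ?P B" if "A \<subseteq> B" for A B
    by (rule SUP_subset_mono) (use that in auto)
  have pair: "?P A + ?P B \<le> ?P (A \<union> B)" if "A \<inter> B = {}" for A B
  proof -
    have *: "ennreal (\<nu> C) + ennreal (\<nu> D) \<le> ?P (A \<union> B)"
      if "C \<in> sets borel" "C \<subseteq> A" "D \<in> sets borel" "D \<subseteq> B" for C D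
    proof -
      have up: "ennreal (\<nu> E) \<le> ?P (A \<union> B)" if "E \<in> sets borel" "E \<subseteq> A \<union> B" for E
        by (rule SUP_upper) (use that in auto)
      have u: "\<nu> (C \<union> D) = \<nu> C + \<nu> D"
        using that \<open>A \<inter> B = {}\<close> by (intro signed_borel_Un[OF \<nu>]) auto
      consider "\<nu> C \<le> 0" | "\<nu> D \<le> 0" | "\<nu> C \<ge> 0" "\<nu> D \<ge> 0" by linarith
      then show ?thesis
      proof cases
        case 1 then show ?thesis using up[of D] that by (auto simp: ennreal_neg)
      next
        case 2 then show ?thesis using up[of C] that by (auto simp: ennreal_neg)
      next
        case 3
        have "ennreal (\<nu> C) + ennreal (\<nu> D) = ennreal (\<nu> (C \<union> D))"
          using 3 u by (simp add: ennreal_plus)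
        also have "\<dots> \<le> ?P (A \<union> B)" using that by (intro up) auto
        finally show ?thesis .
      qed
    qed
    have "?P A + ennreal (\<nu> D) \<le> ?P (A \<union> B)" if D: "D \<in> sets borel" "D \<subseteq> B" for D
      by (subst ennreal_SUP_add_left[symmetric]) (use * D in \<open>auto intro!: SUP_least\<close>)
    then show ?thesis
      by (subst add.commute, subst ennreal_SUP_add_left[symmetric])
         (auto intro!: SUP_least simp: add.commute)
  qed
  have pos: "positive (sets borel) ?P"
  proof -
    have "{B \<in> sets (borel :: 'a measure). B \<subseteq> {}} = {{}}" by auto
    then show ?thesis by (simp add: positive_def e)
  qed
  have ca: "countably_additive (sets borel) ?P"
  proof (rule countably_additiveI)
    fix A :: "nat \<Rightarrow> 'a set"
    assume A: "range A \<subseteq> sets borel" "disjoint_family A" "(\<Union>i. A i) \<in> sets borel"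
    show "(\<Sum>i. ?P (A i)) = ?P (\<Union>i. A i)"
    proof (rule antisym)
      have fin: "(\<Sum>i<n. ?P (A i)) \<le> ?P (\<Union>i<n. A i)" for n
      proof (induction n)
        case (Suc n)
        have "(\<Sum>i<Suc n. ?P (A i)) \<le> ?P (\<Union>i<n. A i) + ?P (A n)"
          using Suc by (simp add: add_right_mono)
        also have "\<dots> \<le> ?P ((\<Union>i<n. A i) \<union> A n)"
        proof (rule pair)
          have "A i \<inter> A n = {}" if "i < n" for i
            using disjoint_family_onD[OF A(2), of i n] that by simp
          then show "(\<Union>i<n. A i) \<inter> A n = {}" by blast
        qed
        also have "(\<Union>i<n. A i) \<union> A n = (\<Union>i<Suc n. A i)" by (auto simp: lessThan_Suc)
        finally show ?case .
      qed simp
      show "(\<Sum>i. ?P (A i)) \<le> ?P (\<Union>i. A i)"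
        unfolding suminf_eq_SUP
        by (rule SUP_least, rule order_trans[OF fin]) (auto intro!: mono)
    next
      show "?P (\<Union>i. A i) \<le> (\<Sum>i. ?P (A i))"
      proof (rule SUP_least)
        fix B assume "B \<in> {B \<in> sets borel. B \<subseteq> (\<Union>i. A i)}"
        then have B: "B \<in> sets borel" "B \<subseteq> (\<Union>i. A i)" by auto
        have "range (\<lambda>n. B \<inter> A n) \<subseteq> sets borel"
        proof
          fix x assume "x \<in> range (\<lambda>n. B \<inter> A n)"
          then obtain n where "x = B \<inter> A n" by blast
          moreover have "A n \<in> sets borel" using A(1) by blast
          ultimately show "x \<in> sets borel" using B(1) by simp
        qed
        moreover have "disjoint_family (\<lambda>n. B \<inter> A n)"
          by (rule disjoint_family_subset[OF A(2)]) simp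
        ultimately have "(\<lambda>n. \<nu> (B \<inter> A n)) sums \<nu> (\<Union>n. B \<inter> A n)"
          by (rule signed_borel_sums[OF \<nu>])
        also have "(\<Union>n. B \<inter> A n) = B" using B by auto
        finally have lim: "(\<lambda>n. ennreal (\<Sum>i<n. \<nu> (B \<inter> A i))) \<longlonglongrightarrow> ennreal (\<nu> B)"
          unfolding sums_def by (rule tendsto_ennrealI)
        show "ennreal (\<nu> B) \<le> (\<Sum>i. ?P (A i))"
        proof (rule LIMSEQ_le_const2[OF lim], intro exI allI impI)
          fix n :: nat
          have "ennreal (\<Sum>i<n. \<nu> (B \<inter> A i)) \<le> ennreal (\<Sum>i<n. max 0 (\<nu> (B \<inter> A i)))"
            by (intro ennreal_leI sum_mono) auto
          also have "\<dots> = (\<Sum>i<n. ennreal (max 0 (\<nu> (B \<inter> A i))))"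
            by (rule sum_ennreal[symmetric]) simp
          also have "\<dots> = (\<Sum>i<n. ennreal (\<nu> (B \<inter> A i)))"
            by (intro sum.cong) (auto simp: max_def ennreal_neg)
          also have "\<dots> \<le> (\<Sum>i<n. ?P (A i))"
            using A B by (intro sum_mono SUP_upper) auto
          also have "\<dots> \<le> (\<Sum>i. ?P (A i))"
            by (intro sum_le_suminf) auto
          finally show "ennreal (\<Sum>i<n. \<nu> (B \<inter> A i)) \<le> (\<Sum>i. ?P (A i))" .
        qed
      qed
    qed
  qed
  have "sigma_sets UNIV (sets (borel :: 'a measure)) = sets borel"
    using sets.sigma_sets_eq[of "borel :: 'a measure"] by simp
  then show s: "sets (upper_variation \<nu>) = sets borel"
    unfolding upper_variation_def by (subst sets_measure_of) simp_all
  assume "A \<in> sets borel"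
  show "emeasure (upper_variation \<nu>) A = ?P A"
  proof (rule emeasure_measure_of[OF upper_variation_def])
    show "sets (borel :: 'a measure) \<subseteq> Pow UNIV" by simp
  qed (simp_all only: s pos ca \<open>A \<in> sets borel\<close>)
qed

lemma finite_upper_variation:
  assumes \<nu>: "signed_borel (\<nu> :: 'a::topological_space set \<Rightarrow> real)"
  shows "finite_measure (upper_variation \<nu>)"
proof -
  define unb where "unb E \<longleftrightarrow> E \<in> sets borel \<and> (\<forall>c::real. \<exists>B \<in> sets borel. B \<subseteq> E \<and> \<bar>\<nu> B\<bar> > c)"
    for E :: "'a set"
  have split: "\<exists>F. unb F \<and> F \<subseteq> E \<and> \<bar>\<nu> (E - F)\<bar> \<ge> 1" if E: "unb E" for E
  proof -
    from E obtain B where B: "B \<in> sets borel" "B \<subseteq> E" "\<bar>\<nu> B\<bar> > 1 + \<bar>\<nu> E\<bar>"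
      unfolding unb_def by blast
    have Eb: "E \<in> sets borel" using E by (simp add: unb_def)
    have un: "B \<union> (E - B) = E" using B by auto
    have d: "\<nu> E = \<nu> B + \<nu> (E - B)"
      using signed_borel_Un[OF \<nu> B(1), of "E - B"] B Eb un by auto
    then have big: "\<bar>\<nu> (E - B)\<bar> \<ge> 1" "\<bar>\<nu> B\<bar> \<ge> 1" using B by linarith+
    have "unb B \<or> unb (E - B)"
    proof (rule ccontr)
      assume "\<not> ?thesis"
      then obtain c1 c2 where
        c1: "\<And>C. C \<in> sets borel \<Longrightarrow> C \<subseteq> B \<Longrightarrow> \<bar>\<nu> C\<bar> \<le> c1" and
        c2: "\<And>C. C \<in> sets borel \<Longrightarrow> C \<subseteq> E - B \<Longrightarrow> \<bar>\<nu> C\<bar> \<le> c2"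
        using B Eb unfolding unb_def by (metis not_less sets.Diff)
      from E obtain C where C: "C \<in> sets borel" "C \<subseteq> E" "\<bar>\<nu> C\<bar> > c1 + c2"
        unfolding unb_def by blast
      have "\<nu> ((C \<inter> B) \<union> (C - B)) = \<nu> (C \<inter> B) + \<nu> (C - B)"
        using C B by (intro signed_borel_Un[OF \<nu>]) auto
      moreover have "(C \<inter> B) \<union> (C - B) = C" by auto
      moreover have "\<bar>\<nu> (C \<inter> B)\<bar> \<le> c1" using C B by (intro c1) auto
      moreover have "\<bar>\<nu> (C - B)\<bar> \<le> c2" using C B by (intro c2) auto
      ultimately show False using C by simp
    qed
    moreover have "E - (E - B) = B" using B by auto
    ultimately show ?thesis using B big by (metis Diff_subset)
  qed
  have "\<not> unb UNIV"
  proof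
    assume u: "unb UNIV"
    obtain f where f: "\<And>E. unb E \<Longrightarrow> unb (f E) \<and> f E \<subseteq> E \<and> \<bar>\<nu> (E - f E)\<bar> \<ge> 1"
      using split by metis
    define G where "G n = (f ^^ n) UNIV" for n
    have G: "unb (G n)" for n by (induction n) (use u f in \<open>auto simp: G_def\<close>)
    have GS: "G (Suc n) \<subseteq> G n" "\<bar>\<nu> (G n - G (Suc n))\<bar> \<ge> 1" for n
      using f[OF G[of n]] by (auto simp: G_def)
    have dec: "G m \<subseteq> G n" if "n \<le> m" for m n
      using lift_Suc_antimono_le[of G, OF GS(1) that] .
    have disj: "disjoint_family (\<lambda>n. G n - G (Suc n))"
    proof (unfold disjoint_family_on_def, intro ballI impI)
      fix m n :: nat assume "m \<noteq> n"
      then consider "Suc m \<le> n" | "Suc n \<le> m" by linarith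
      then show "(G m - G (Suc m)) \<inter> (G n - G (Suc n)) = {}"
        by cases (use dec in blast)+
    qed
    have "range (\<lambda>n. G n - G (Suc n)) \<subseteq> sets borel"
      using G by (auto simp: unb_def)
    from sums_summable[OF signed_borel_sums[OF \<nu> this disj]]
    have "summable (\<lambda>n. \<nu> (G n - G (Suc n)))" .
    then have "(\<lambda>n. \<nu> (G n - G (Suc n))) \<longlonglongrightarrow> 0" by (rule summable_LIMSEQ_zero)
    then have "(\<lambda>n. \<bar>\<nu> (G n - G (Suc n))\<bar>) \<longlonglongrightarrow> 0" by (rule tendsto_rabs_zero)
    then have "1 \<le> (0::real)" by (rule LIMSEQ_le_const) (use GS in auto)
    then show False by simp
  qed
  then obtain c where c: "\<And>B. B \<in> sets borel \<Longrightarrow> \<bar>\<nu> B\<bar> \<le> c"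
    unfolding unb_def by (auto simp: not_less)
  have "(SUP B \<in> {B \<in> sets borel. B \<subseteq> UNIV}. ennreal (\<nu> B)) \<le> ennreal c"
  proof (rule SUP_least)
    fix B :: "'a set" assume "B \<in> {B \<in> sets borel. B \<subseteq> UNIV}"
    then have "\<bar>\<nu> B\<bar> \<le> c" using c by auto
    then show "ennreal (\<nu> B) \<le> ennreal c" by (intro ennreal_leI) auto
  qed
  then have "emeasure (upper_variation \<nu>) UNIV \<noteq> \<infinity>"
    unfolding emeasure_upper_variation[OF \<nu>, of UNIV, OF borel_open[OF open_UNIV]]
    by (metis ennreal_neq_top infinity_ennreal_def neq_top_trans)
  moreover have "space (upper_variation \<nu>) = UNIV"
    using sets_eq_imp_space_eq[OF sets_upper_variation[OF \<nu>]] by simp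
  ultimately show ?thesis by (intro finite_measureI) simp
qed

end

theory Submission
  imports Defs
begin

text \<open>Parametrizing the branch by \<open>t = x\<^sub>1\<close> and rescaling, a measure in \<open>AC\<close> becomes an integrable
  \<open>F\<close> on \<open>(0, \<infinity>)\<close> that annihilates \<open>exp (2 \<pi> i k t)\<close> and \<open>exp (2 \<pi> i k / t)\<close> for all integers
  \<open>k\<close>. So the push-forwards of \<open>F dt\<close> under \<open>t \<mapsto> {t}\<close> and \<open>t \<mapsto> {1/t}\<close> vanish. Splitting at
  \<open>t = 1\<close>, the part on \<open>(0, 1)\<close> is invariant under the square of the Gauss map \<open>t \<mapsto> {1/t}\<close>, hence
  equals \<open>c dt / (1 + t)\<close>, because the Gauss transfer operator contracts Lipschitz constants. The part
  on \<open>(1, \<infinity>)\<close> is then determined as well, and one extra frequency \<open>\<omega>\<close> off the lattice forces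
  \<open>c = 0\<close>: up to sign it multiplies \<open>c\<close> by \<open>1 - exp (2 \<pi> i \<omega>)\<close> times
  \<open>\<integral>\<^sub>0\<^sup>\<infinity> exp (2 \<pi> i \<omega> s) / (1 + s) ds\<close>, whose imaginary part is not zero.\<close>

section \<open>Vanishing Fourier coefficients\<close>

text \<open>The hypothesis \<open>\<alpha> * \<beta> * M\<^sup>2 = 16 * pi\<^sup>2\<close> is what
  lets a single scaling turn both axes of the cross into integer frequencies, for \<open>t\<close>
  and for \<open>1 / t\<close>. On \<open>(0, 1)\<close> the fractional part of \<open>t\<close> is
  \<open>t\<close> itself, and on \<open>(1, \<infinity>)\<close> that of \<open>1 / t\<close> is
  \<open>1 / t\<close>. This is why 1 is the splitting point: each condition expresses one part
  through the other. The obstacle is that \<open>F\<close> is merely integrable, while the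
  contraction acts on Lipschitz functions. Invariance is therefore used in weak form, with the Gauss
  map acting on test functions only: \<open>F\<close> is replaced by a Lipschitz \<open>g\<close>
  with an L1 error that iteration cannot enlarge, and the transfer operator then acts on
  \<open>g\<close>. Densities are taken relative to \<open>dt / (1 + t)\<close>, so that a small
  Lipschitz constant means closeness to an invariant density. The kernel integral over
  \<open>(0, \<infinity>)\<close> converges only conditionally, so it is handled through truncations
  and a lower bound uniform in the cut-off.\<close>

lemma borel_measurable_cis [measurable]: "cis \<in> borel_measurable borel"
  by (intro borel_measurable_continuous_onI continuous_on_cis continuous_on_id)

text \<open>Lifts a statement about sets to bounded test functions such as exponentials. Simple
  functions approximating \<open>\<phi>\<close> are finite combinations of indicators of their level
  sets, and they stay below \<open>2 * K\<close> in norm, so dominated convergence applies with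
  majorant \<open>2 * K * norm (F x)\<close>.\<close>

lemma integral_compose_bounded_zero:
  fixes F :: "'a \<Rightarrow> complex" and \<phi> :: "'b \<Rightarrow> complex"
  assumes F: "integrable M F" and X: "X \<in> measurable M N"
    and zero: "\<And>B. B \<in> sets N \<Longrightarrow> (\<integral>x. indicator B (X x) * F x \<partial>M) = 0"
    and \<phi>: "\<phi> \<in> borel_measurable N" and bound: "\<And>y. y \<in> space N \<Longrightarrow> norm (\<phi> y) \<le> K"
  shows "(\<integral>x. \<phi> (X x) * F x \<partial>M) = 0"
proof -
  note [measurable] = X \<phi> borel_measurable_integrable[OF F]
  obtain s where s: "\<And>i. simple_function N (s i)"
    "\<And>x. x \<in> space N \<Longrightarrow> (\<lambda>i. s i x) \<longlonglongrightarrow> \<phi> x"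
    "\<And>i x. x \<in> space N \<Longrightarrow> dist (s i x) 0 \<le> 2 * dist (\<phi> x) 0"
    using borel_measurable_implies_sequence_metric[OF \<phi>, of 0] by blast
  have [measurable]: "s i \<in> borel_measurable N" for i
    using s(1) by (rule borel_measurable_simple_function)
  have sp: "X x \<in> space N" if "x \<in> space M" for x
    using X that by (rule measurable_space)
  have z: "(\<integral>x. s i (X x) * F x \<partial>M) = 0" for i
  proof -
    have fin: "finite (s i ` space N)" using s(1) by (rule simple_functionD)
    have m: "s i -` {y} \<inter> space N \<in> sets N" for y using s(1) by (rule simple_functionD)
    have eq: "s i (X x) * F x =
        (\<Sum>y\<in>s i ` space N. y * (indicator (s i -` {y} \<inter> space N) (X x) * F x))"
      if x: "x \<in> space M" for x
    proof -
      have "(\<Sum>y\<in>s i ` space N. y * (indicator (s i -` {y} \<inter> space N) (X x) * F x))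
          = (\<Sum>y\<in>s i ` space N. if y = s i (X x) then s i (X x) * F x else 0)"
        using sp[OF x] by (intro sum.cong) (auto simp: indicator_def)
      also have "\<dots> = s i (X x) * F x"
        using fin sp[OF x] by simp
      finally show ?thesis by simp
    qed
    have "(\<integral>x. s i (X x) * F x \<partial>M) =
        (\<integral>x. (\<Sum>y\<in>s i ` space N. y * (indicator (s i -` {y} \<inter> space N) (X x) * F x)) \<partial>M)"
      by (rule Bochner_Integration.integral_cong) (auto simp: eq)
    also have "\<dots> = (\<Sum>y\<in>s i ` space N. (\<integral>x. y * (indicator (s i -` {y} \<inter> space N) (X x) * F x) \<partial>M))"
    proof (rule Bochner_Integration.integral_sum)
      fix y
      have [measurable]: "s i -` {y} \<inter> space N \<in> sets N" by (rule m)
      show "integrable M (\<lambda>x. y * (indicator (s i -` {y} \<inter> space N) (X x) * F x))"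
        by (intro integrable_mult_right Bochner_Integration.integrable_bound[OF F])
           (auto simp: indicator_def norm_mult)
    qed
    also have "\<dots> = 0" using zero[OF m] by simp
    finally show ?thesis .
  qed
  have "(\<lambda>i. (\<integral>x. s i (X x) * F x \<partial>M)) \<longlonglongrightarrow> (\<integral>x. \<phi> (X x) * F x \<partial>M)"
  proof (rule integral_dominated_convergence[where w="\<lambda>x. 2 * K * norm (F x)"])
    show "integrable M (\<lambda>x. 2 * K * norm (F x))" using F by simp
    show "AE x in M. (\<lambda>i. s i (X x) * F x) \<longlonglongrightarrow> \<phi> (X x) * F x"
      using s(2) sp by (intro AE_I2 tendsto_intros) auto
    show "AE x in M. norm (s i (X x) * F x) \<le> 2 * K * norm (F x)" for i
    proof (rule AE_I2)
      fix x assume "x \<in> space M"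
      then have "norm (s i (X x)) \<le> 2 * K" using s(3)[OF sp, of x i] bound[OF sp, of x] by simp
      then show "norm (s i (X x) * F x) \<le> 2 * K * norm (F x)"
        by (simp add: norm_mult mult_right_mono)
    qed
  qed auto
  with z show ?thesis by (simp add: LIMSEQ_const_iff)
qed

text \<open>These are the Fourier coefficients of the push-forward of \<open>F\<close> to the circle
  under \<open>X\<close> mod 1. \<open>X\<close> is kept general because both \<open>t\<close> and
  \<open>1 / t\<close> occur.\<close>

definition vanishing_coeffs :: "'a measure \<Rightarrow> ('a \<Rightarrow> real) \<Rightarrow> ('a \<Rightarrow> complex) \<Rightarrow> bool" where
  "vanishing_coeffs M X F \<longleftrightarrow>
     integrable M F \<and> (\<forall>k::int. (\<integral>x. cis (2 * pi * (of_int k * X x)) * F x \<partial>M) = 0)"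

lemma vanishing_coeffs_add:
  assumes "vanishing_coeffs M X F" "vanishing_coeffs M X H" and [measurable]: "X \<in> borel_measurable M"
  shows "vanishing_coeffs M X (\<lambda>x. F x + H x)"
proof -
  have i: "integrable M (\<lambda>x. cis (2 * pi * (of_int k * X x)) * F x)" if "integrable M F" for k F
    using that by (intro Bochner_Integration.integrable_bound[OF that]) (auto simp: norm_mult)
  show ?thesis using assms i by (simp add: vanishing_coeffs_def distrib_left)
qed

lemma vanishing_coeffs_cmult:
  assumes "vanishing_coeffs M X F"
  shows "vanishing_coeffs M X (\<lambda>x. c * F x)"
  using assms by (simp add: vanishing_coeffs_def mult.left_commute)

lemma vanishing_coeffs_cis:
  assumes F: "vanishing_coeffs M X F" and [measurable]: "X \<in> borel_measurable M"
  shows "vanishing_coeffs M X (\<lambda>x. cis (2 * pi * (of_int k * X x)) * F x)"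
proof -
  have "integrable M F" using F by (simp add: vanishing_coeffs_def)
  then have "integrable M (\<lambda>x. cis (2 * pi * (of_int k * X x)) * F x)"
    by (rule Bochner_Integration.integrable_bound) (use \<open>integrable M F\<close> in \<open>auto simp: norm_mult\<close>)
  moreover have "(\<integral>x. cis (2 * pi * (of_int j * X x)) * (cis (2 * pi * (of_int k * X x)) * F x) \<partial>M) = 0" for j
  proof -
    have "(\<integral>x. cis (2 * pi * (of_int (j + k) * X x)) * F x \<partial>M) = 0"
      using F unfolding vanishing_coeffs_def by blast
    moreover have "cis (2 * pi * (of_int (j + k) * X x)) * F x =
        cis (2 * pi * (of_int j * X x)) * (cis (2 * pi * (of_int k * X x)) * F x)" for x
      by (simp add: mult.assoc[symmetric] cis_mult) (simp add: distrib_left distrib_right)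
    ultimately show ?thesis by (simp only:)
  qed
  ultimately show ?thesis by (simp add: vanishing_coeffs_def)
qed

text \<open>Multiplying \<open>F\<close> by an exponential only shifts the index of its
  coefficients, so the class of functions whose coefficients all vanish is stable under it. The
  conclusion is again full vanishing, not one zero integral: a product of polynomials is then
  handled one factor after the other.\<close>

lemma vanishing_coeffs_polynomial:
  assumes "real_polynomial_function g" "vanishing_coeffs M X F" "X \<in> borel_measurable M"
  shows "vanishing_coeffs M X (\<lambda>x. of_real (g (cis (2 * pi * X x))) * F x)"
  using assms(1,2)
proof (induction arbitrary: F)
  case (linear h)
  note F = linear.prems
  interpret bounded_linear h by (rule linear.hyps)
  define a b where "a = h 1" and "b = h \<i>"
  \<comment> \<open>From \<open>Re z = (z + cnj z) / 2\<close> and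
    \<open>Im z = (z - cnj z) / (2 * \<i>)\<close>, with
    \<open>cnj (cis y) = cis (- y)\<close>.\<close>
  define u where "u = (of_real a - \<i> * of_real b) / 2"
  define v where "v = (of_real a + \<i> * of_real b) / 2"
  have "h z = Re z * a + Im z * b" for z
  proof -
    have "h z = h (Re z *\<^sub>R 1 + Im z *\<^sub>R \<i>)"
      by (rule arg_cong[of _ _ h]) (simp add: complex_eq_iff)
    then show ?thesis by (simp add: add scale a_def b_def)
  qed
  then have "of_real (h (cis y)) = u * cis y + v * cis (-y)" for y
    by (simp add: complex_eq_iff u_def v_def field_simps)
  then have eq: "of_real (h (cis (2 * pi * X x))) * F x =
      u * (cis (2 * pi * (of_int 1 * X x)) * F x) + v * (cis (2 * pi * (of_int (-1) * X x)) * F x)" for x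
    by (simp add: algebra_simps)
  show ?case unfolding eq
    by (intro vanishing_coeffs_add vanishing_coeffs_cmult vanishing_coeffs_cis F assms(3))
next
  case (const c)
  then show ?case by (intro vanishing_coeffs_cmult)
next
  case (add f g)
  then show ?case by (simp add: distrib_right vanishing_coeffs_add[OF _ _ assms(3)])
next
  case (mult f g)
  from mult.IH(1)[OF mult.IH(2)[OF mult.prems]] show ?case
    by (simp add: mult.assoc)
qed

text \<open>Stone-Weierstrass on the unit circle: replacing \<open>\<psi>\<close> by a polynomial
  changes the integral by at most \<open>e\<close> times the integral of
  \<open>norm (F x)\<close>.\<close>

lemma vanishing_coeffs_continuous:
  fixes \<psi> :: "complex \<Rightarrow> real"
  assumes F: "vanishing_coeffs M X F" and [measurable]: "X \<in> borel_measurable M"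
    and \<psi>: "continuous_on UNIV \<psi>"
  shows "(\<integral>x. of_real (\<psi> (cis (2 * pi * X x))) * F x \<partial>M) = 0"
proof -
  have int: "integrable M F" using F by (simp add: vanishing_coeffs_def)
  note [measurable] = borel_measurable_integrable[OF int] borel_measurable_continuous_onI[OF \<psi>]
  define C where "C = (\<integral>x. norm (F x) \<partial>M)"
  have C: "C \<ge> 0" by (simp add: C_def)
  have "norm (\<integral>x. of_real (\<psi> (cis (2 * pi * X x))) * F x \<partial>M) \<le> e * C" if e: "e > 0" for e
  proof -
    obtain g where g: "real_polynomial_function g" "\<And>z. z \<in> sphere 0 1 \<Longrightarrow> \<bar>\<psi> z - g z\<bar> < e"
      using Stone_Weierstrass_real_polynomial_function[of "sphere 0 1" \<psi> e] e
        continuous_on_subset[OF \<psi>] by (metis compact_sphere subset_UNIV)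
    from vanishing_coeffs_polynomial[OF g(1) F] have
      v: "vanishing_coeffs M X (\<lambda>x. of_real (g (cis (2 * pi * X x))) * F x)" by simp
    then have gi: "integrable M (\<lambda>x. of_real (g (cis (2 * pi * X x))) * F x)"
      by (simp add: vanishing_coeffs_def)
    have gz: "(\<integral>x. of_real (g (cis (2 * pi * X x))) * F x \<partial>M) = 0"
      using v unfolding vanishing_coeffs_def by (auto dest: spec[of _ 0])
    have d: "norm (of_real (\<psi> (cis (2 * pi * X x))) * F x - of_real (g (cis (2 * pi * X x))) * F x)
        \<le> e * norm (F x)" for x
    proof -
      have "\<bar>\<psi> (cis (2 * pi * X x)) - g (cis (2 * pi * X x))\<bar> \<le> e"
        using g(2)[of "cis (2 * pi * X x)"] by simp
      then have "norm (of_real (\<psi> (cis (2 * pi * X x)) - g (cis (2 * pi * X x))) * F x) \<le> e * norm (F x)"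
        unfolding norm_mult norm_of_real by (intro mult_right_mono) auto
      then show ?thesis by (simp add: left_diff_distrib)
    qed
    have [measurable]: "(\<lambda>x. of_real (g (cis (2 * pi * X x))) * F x) \<in> borel_measurable M"
      using gi by (rule borel_measurable_integrable)
    have di: "integrable M (\<lambda>x. of_real (\<psi> (cis (2 * pi * X x))) * F x - of_real (g (cis (2 * pi * X x))) * F x)"
    proof (rule Bochner_Integration.integrable_bound[where f="\<lambda>x. e * norm (F x)"])
      show "integrable M (\<lambda>x. e * norm (F x))" using int by simp
      show "AE x in M. norm (of_real (\<psi> (cis (2 * pi * X x))) * F x - of_real (g (cis (2 * pi * X x))) * F x)
          \<le> norm (e * norm (F x))"
        using order_trans[OF d abs_ge_self] by (intro AE_I2) simp
    qed measurable
    have "integrable M (\<lambda>x. of_real (\<psi> (cis (2 * pi * X x))) * F x)"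
      using Bochner_Integration.integrable_add[OF di gi] by simp
    then have "(\<integral>x. of_real (\<psi> (cis (2 * pi * X x))) * F x \<partial>M) =
      (\<integral>x. of_real (\<psi> (cis (2 * pi * X x))) * F x - of_real (g (cis (2 * pi * X x))) * F x \<partial>M)"
      using gi gz by simp
    also have "norm \<dots> \<le> (\<integral>x. norm (of_real (\<psi> (cis (2 * pi * X x))) * F x - of_real (g (cis (2 * pi * X x))) * F x) \<partial>M)"
      by (rule integral_norm_bound)
    also have "\<dots> \<le> (\<integral>x. e * norm (F x) \<partial>M)"
      by (intro integral_mono integrable_norm di integrable_mult_right int d)
    finally show ?thesis by (simp add: C_def)
  qed
  note small = this
  have "norm (\<integral>x. of_real (\<psi> (cis (2 * pi * X x))) * F x \<partial>M) \<le> 0"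
  proof (rule field_le_epsilon)
    fix e :: real assume "e > 0"
    \<comment> \<open>Dividing by \<open>C + 1\<close> also covers \<open>C = 0\<close>.\<close>
    then have "e / (C + 1) > 0" using C by simp
    from small[OF this] have "norm (\<integral>x. of_real (\<psi> (cis (2 * pi * X x))) * F x \<partial>M) \<le> e / (C + 1) * C" .
    also have "\<dots> \<le> 0 + e" using C \<open>e > 0\<close> by (simp add: field_simps)
    finally show "norm (\<integral>x. of_real (\<psi> (cis (2 * pi * X x))) * F x \<partial>M) \<le> 0 + e" .
  qed
  then show ?thesis by simp
qed

text \<open>Continuous cut-offs bring closed sets within reach of continuous test functions. The
  empty set is excluded because \<open>infdist x {} = 0\<close> would make the limit 1.\<close>

lemma closed_indicator_limit:
  fixes C :: "'a::metric_space set"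
  assumes "closed C" "C \<noteq> {}"
  shows "(\<lambda>n. max 0 (1 - real n * infdist x C)) \<longlonglongrightarrow> indicator C x"
proof (cases "x \<in> C")
  case False
  then have p: "infdist x C > 0" using infdist_pos_not_in_closed[OF assms] by simp
  obtain N :: nat where N: "1 / infdist x C < real N" using reals_Archimedean2 by blast
  have "max 0 (1 - real n * infdist x C) = 0" if "n \<ge> N" for n
  proof -
    have "1 / infdist x C < real n" using N that by linarith
    then show ?thesis using p by (simp add: field_simps)
  qed
  then have "eventually (\<lambda>n. max 0 (1 - real n * infdist x C) = 0) sequentially"
    unfolding eventually_sequentially by blast
  then show ?thesis using False by (simp add: tendsto_eventually)
qed simp

text \<open>A complex measure on the circle is determined by its Fourier coefficients: they control
  continuous test functions, these control closed sets, and Dynkin's argument reaches all Borel sets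
  of the plane. The argument map carries the result back to fractional parts.\<close>

lemma vanishing_coeffs_frac:
  assumes F: "vanishing_coeffs M X F" and [measurable]: "X \<in> borel_measurable M"
    and B: "B \<in> sets borel"
  shows "(\<integral>x. indicator B (frac (X x)) * F x \<partial>M) = 0"
proof -
  let ?e = "\<lambda>x. cis (2 * pi * X x)"
  have int: "integrable M F" using F by (simp add: vanishing_coeffs_def)
  note [measurable] = borel_measurable_integrable[OF int]
  have iint: "integrable M (\<lambda>x. indicator C (?e x) * F x)" if [measurable]: "C \<in> sets borel" for C
    by (rule Bochner_Integration.integrable_bound[OF int]) (measurable, auto simp: indicator_def norm_mult)
  have closed: "(\<integral>x. indicator C (?e x) * F x \<partial>M) = 0" if "closed C" for C
  proof (cases "C = {}")
    case False
    have [measurable]: "C \<in> sets borel" using that by simp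
    have cont: "continuous_on UNIV (\<lambda>z. max 0 (1 - real n * infdist z C))" for n
      by (intro continuous_intros)
    have m: "(\<lambda>x. of_real (max 0 (1 - real n * infdist (?e x) C)) * F x) \<in> borel_measurable M" for n
    proof -
      have "?e \<in> borel_measurable M" by measurable
      then have [measurable]: "(\<lambda>x. max 0 (1 - real n * infdist (?e x) C)) \<in> borel_measurable M"
        by (rule measurable_compose[OF _ borel_measurable_continuous_onI[OF cont[of n]]])
      show ?thesis by (rule borel_measurable_times[OF measurable_compose[OF _ borel_measurable_of_real]]) measurable
    qed
    have "(\<lambda>n. (\<integral>x. of_real (max 0 (1 - real n * infdist (?e x) C)) * F x \<partial>M))
        \<longlonglongrightarrow> (\<integral>x. indicator C (?e x) * F x \<partial>M)"
    proof (rule integral_dominated_convergence[where w="\<lambda>x. norm (F x)"])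
      show "AE x in M. (\<lambda>n. of_real (max 0 (1 - real n * infdist (?e x) C)) * F x)
          \<longlonglongrightarrow> indicator C (?e x) * F x"
      proof (rule AE_I2)
        fix x
        from tendsto_mult[OF tendsto_of_real[OF closed_indicator_limit[OF that False, of "?e x"]] tendsto_const[of "F x"]]
        show "(\<lambda>n. of_real (max 0 (1 - real n * infdist (?e x) C)) * F x)
          \<longlonglongrightarrow> indicator C (?e x) * F x" by (auto simp: indicator_def split: if_splits)
      qed
      show "AE x in M. norm (of_real (max 0 (1 - real n * infdist (?e x) C)) * F x) \<le> norm (F x)" for n
        by (rule AE_I2) (auto simp: norm_mult infdist_nonneg intro!: mult_left_le_one_le)
    qed (simp_all only: m iint[THEN borel_measurable_integrable] integrable_norm int \<open>C \<in> sets borel\<close>)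
    moreover have "(\<integral>x. of_real (max 0 (1 - real n * infdist (?e x) C)) * F x \<partial>M) = 0" for n
      by (rule vanishing_coeffs_continuous[OF F assms(2) cont])
    ultimately show ?thesis by (simp add: LIMSEQ_const_iff)
  qed simp
  have sets: "(\<integral>x. indicator A (?e x) * F x \<partial>M) = 0" if "A \<in> sets borel" for A :: "complex set"
  proof -
    have b: "sets borel = sigma_sets UNIV (Collect (closed :: complex set \<Rightarrow> bool))"
      by (subst borel_eq_closed) simp
    have "Int_stable (Collect (closed :: complex set \<Rightarrow> bool))" by (auto simp: Int_stable_def)
    moreover have "Collect (closed :: complex set \<Rightarrow> bool) \<subseteq> Pow UNIV" by simp
    moreover have "A \<in> sigma_sets UNIV (Collect closed)" using that b by simp
    ultimately show ?thesis
    proof (induction A rule: sigma_sets_induct_disjoint)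
      case (basic A)
      then show ?case using closed by simp
    next
      case empty
      show ?case by simp
    next
      case (compl A)
      then have [measurable]: "A \<in> sets borel" using b by simp
      have "(\<integral>x. indicator (UNIV - A) (?e x) * F x \<partial>M) =
          (\<integral>x. indicator UNIV (?e x) * F x - indicator A (?e x) * F x \<partial>M)"
        by (rule Bochner_Integration.integral_cong) (auto simp: indicator_def)
      also have "\<dots> = 0"
        using compl.IH closed[of UNIV] iint[of UNIV] iint[of A]
        by (subst Bochner_Integration.integral_diff) auto
      finally show ?case .
    next
      case (union A)
      then have A [measurable]: "A i \<in> sets borel" for i using b by auto
      have [measurable]: "(\<Union>i. A i) \<in> sets borel" using A by blast
      have "(\<lambda>n. (\<integral>x. (\<Sum>i<n. indicator (A i) (?e x) * F x) \<partial>M))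
          \<longlonglongrightarrow> (\<integral>x. indicator (\<Union>i. A i) (?e x) * F x \<partial>M)"
      proof (rule integral_dominated_convergence[where w="\<lambda>x. norm (F x)"])
        show "AE x in M. (\<lambda>n. \<Sum>i<n. indicator (A i) (?e x) * F x)
            \<longlonglongrightarrow> indicator (\<Union>i. A i) (?e x) * F x"
        proof (rule AE_I2)
          fix x
          have "(\<lambda>n. indicat_real (A n) (?e x)) sums indicat_real (\<Union>i. A i) (?e x)"
            using union.hyps(1) by (intro indicator_sums) (auto simp: disjoint_family_on_def)
          then have "(\<lambda>n. of_real (indicat_real (A n) (?e x)) * F x) sums
              (of_real (indicat_real (\<Union>i. A i) (?e x)) * F x)"
            by (intro sums_mult2 sums_of_real)
          then show "(\<lambda>n. \<Sum>i<n. indicator (A i) (?e x) * F x)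
            \<longlonglongrightarrow> indicator (\<Union>i. A i) (?e x) * F x"
            by (simp add: sums_def of_real_indicator)
        qed
        have "(\<Sum>i<n. indicator (A i) z) = (indicator (\<Union>i<n. A i) z :: complex)" for n z
          using disjoint_family_on_mono[OF _ union.hyps(1)]
          by (intro indicator_UN_disjoint[symmetric]) auto
        then show "AE x in M. norm (\<Sum>i<n. indicator (A i) (?e x) * F x) \<le> norm (F x)" for n
          by (intro AE_I2) (auto simp: sum_distrib_right[symmetric] norm_mult indicator_def)
      qed (simp_all add: int)
      moreover have "(\<integral>x. (\<Sum>i<n. indicator (A i) (?e x) * F x) \<partial>M) = 0" for n
        by (subst Bochner_Integration.integral_sum) (simp_all add: union.IH iint)
      ultimately show ?case by (simp add: LIMSEQ_const_iff)
    qed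
  qed
  \<comment> \<open>\<open>Arg2pi\<close> divided by \<open>2 * pi\<close> recovers
    \<open>frac y\<close> from \<open>cis (2 * pi * y)\<close>.\<close>
  define B' where "B' = {z. Arg2pi z / (2 * pi) \<in> B}"
  have "Arg2pi \<in> borel_measurable borel"
  proof -
    \<comment> \<open>\<open>Arg2pi\<close> jumps across the nonnegative real axis, where its value
      is 0. It is continuous elsewhere, so gluing along this axis gives measurability.\<close>
    have m: "(\<lambda>z. if z \<in> - \<real>\<^sub>\<ge>\<^sub>0 then Arg2pi z else 0) \<in> borel_measurable borel"
    proof (rule borel_measurable_continuous_on_if)
      show "continuous_on (- \<real>\<^sub>\<ge>\<^sub>0) Arg2pi"
        by (intro continuous_at_imp_continuous_on ballI continuous_at_Arg2pi) auto
    qed auto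
    have "Arg2pi z = (if z \<in> - \<real>\<^sub>\<ge>\<^sub>0 then Arg2pi z else 0)" for z
      using Arg2pi_eq_0[of z] by (auto simp: nonneg_Reals_def complex_nonneg_Reals_iff)
    then show ?thesis using m by presburger
  qed
  then have "B' \<in> sets borel"
    using B unfolding B'_def by measurable
  from sets[OF this] have "(\<integral>x. indicator B' (?e x) * F x \<partial>M) = 0" .
  moreover have "indicator B' (cis (2 * pi * y)) = (indicator B (frac y) :: complex)" for y
  proof -
    have "cis (2 * pi * y) = cis (2 * pi * frac y + 2 * pi * of_int \<lfloor>y\<rfloor>)"
      by (simp add: frac_def algebra_simps)
    also have "\<dots> = cis (2 * pi * frac y)"
      by (simp add: cis_mult[symmetric] cis_multiple_2pi)
    finally have "Arg2pi (cis (2 * pi * y)) = 2 * pi * frac y"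
      using frac_ge_0[of y] frac_lt_1[of y]
      by (intro Arg2pi_unique[of 1]) (auto simp: cis_conv_exp)
    then show ?thesis by (simp add: B'_def indicator_def)
  qed
  ultimately show ?thesis by simp
qed

section \<open>The Gauss map and its transfer operator\<close>

text \<open>The invariant measure of the Gauss map, without the factor that makes it a probability
  measure.\<close>

definition gauss_measure :: "real measure" where
  "gauss_measure = density lborel (\<lambda>t. ennreal (indicator {0<..<1} t / (1 + t)))"

lemma sets_gauss_measure [simp, measurable_cong]: "sets gauss_measure = sets borel"
  by (simp add: gauss_measure_def)

lemma space_gauss_measure [simp]: "space gauss_measure = UNIV"
  by (simp add: gauss_measure_def)

lemma nn_integral_gauss_measure:
  assumes [measurable]: "f \<in> borel_measurable borel"
  shows "(\<integral>\<^sup>+t. f t \<partial>gauss_measure) = (\<integral>\<^sup>+t. ennreal (indicator {0<..<1} t / (1 + t)) * f t \<partial>lborel)"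
  unfolding gauss_measure_def by (rule nn_integral_density) measurable

lemma integral_gauss_measure:
  fixes f :: "real \<Rightarrow> 'a::{banach, second_countable_topology}"
  assumes [measurable]: "f \<in> borel_measurable borel"
  shows "(\<integral>t. f t \<partial>gauss_measure) = (\<integral>t. (indicator {0<..<1} t / (1 + t)) *\<^sub>R f t \<partial>lborel)"
  unfolding gauss_measure_def
  by (rule integral_density) (auto simp: indicator_def)

lemma AE_gauss_measure: "AE t in gauss_measure. t \<in> {0<..<1}"
  unfolding gauss_measure_def by (subst AE_density) (auto simp: indicator_def)

lemma finite_gauss_measure: "finite_measure gauss_measure"
proof
  have "emeasure gauss_measure (space gauss_measure) = (\<integral>\<^sup>+t. 1 \<partial>gauss_measure)" by simp
  also have "\<dots> = (\<integral>\<^sup>+t. ennreal (indicator {0<..<1} t / (1 + t)) * 1 \<partial>lborel)"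
    by (rule nn_integral_gauss_measure) simp
  also have "\<dots> \<le> (\<integral>\<^sup>+t. indicator {0<..<1::real} t \<partial>lborel)"
    by (intro nn_integral_mono) (auto simp: indicator_def)
  also have "\<dots> = 1" by simp
  finally show "emeasure gauss_measure (space gauss_measure) \<noteq> \<infinity>"
    by (auto simp: top_unique)
qed

interpretation gauss: finite_measure gauss_measure by (rule finite_gauss_measure)

lemma integrable_gauss_measure:
  fixes f :: "real \<Rightarrow> 'a::{banach, second_countable_topology}"
  assumes "f \<in> borel_measurable borel" "\<And>t. 0 < t \<Longrightarrow> t < 1 \<Longrightarrow> norm (f t) \<le> K"
  shows "integrable gauss_measure f"
proof (rule gauss.integrable_const_bound[where B=K])
  show "AE t in gauss_measure. norm (f t) \<le> K"
    using AE_gauss_measure by eventually_elim (use assms(2) in auto)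
qed (use assms(1) in simp)

text \<open>With the inverse branch \<open>b x = 1 / (x + k + 1)\<close> of the Gauss map, this is
  \<open>(1 + x) * \<bar>b' x\<bar> / (1 + b x)\<close>: the Jacobian of the branch relative to
  \<open>gauss_measure\<close>.\<close>

definition gauss_weight :: "nat \<Rightarrow> real \<Rightarrow> real" where
  "gauss_weight k x = (1 + x) / ((x + k + 1) * (x + k + 2))"

text \<open>The transfer operator of the Gauss map for densities relative to
  \<open>gauss_measure\<close>: a weighted sum over the preimages of \<open>x\<close> in the unit
  interval.\<close>

definition gauss_op :: "(real \<Rightarrow> real) \<Rightarrow> real \<Rightarrow> real" where
  "gauss_op g x = (\<Sum>k. gauss_weight k x * g (1 / (x + k + 1)))"

text \<open>For nonnegative \<open>x\<close>, the sum of the weights from index \<open>k\<close> on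
  in closed form; it makes summation by parts explicit.\<close>

definition gauss_tail :: "nat \<Rightarrow> real \<Rightarrow> real" where
  "gauss_tail k x = (1 + x) / (x + k + 1)"

lemma gauss_weight_nonneg: "0 \<le> x \<Longrightarrow> 0 \<le> gauss_weight k x"
  by (simp add: gauss_weight_def)

lemma gauss_weight_tail: "0 \<le> x \<Longrightarrow> gauss_weight k x = gauss_tail k x - gauss_tail (Suc k) x"
  by (simp add: gauss_weight_def gauss_tail_def field_simps)

lemma gauss_tail_LIMSEQ: "(\<lambda>k. gauss_tail k x) \<longlonglongrightarrow> 0"
proof -
  have "filterlim (\<lambda>k. (x + 1) + real k) at_top sequentially"
    by (rule filterlim_tendsto_add_at_top[OF tendsto_const filterlim_real_sequentially])
  then have "filterlim (\<lambda>k. x + real k + 1) at_infinity sequentially"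
    by (intro filterlim_at_top_imp_at_infinity) (simp add: add.commute add.left_commute)
  then show ?thesis unfolding gauss_tail_def by (rule tendsto_divide_0[OF tendsto_const])
qed

text \<open>The weights telescope and \<open>gauss_tail 0 x = 1\<close>. Hence
  \<open>gauss_op\<close> fixes constants, which expresses the invariance of
  \<open>gauss_measure\<close>.\<close>

lemma gauss_weight_sums: "0 \<le> x \<Longrightarrow> (\<lambda>k. gauss_weight k x) sums 1"
  using telescope_sums'[OF gauss_tail_LIMSEQ, of x]
  by (simp add: gauss_weight_tail gauss_tail_def[of 0] add.commute[of x 1])

lemma branch_in_unit: "0 < x \<Longrightarrow> 1 / (x + real k + 1) \<in> {0<..<1}"
  by (simp add: field_simps)

lemma gauss_op_summable:
  assumes x: "0 \<le> x" and b: "\<And>k. \<bar>g (1 / (x + real k + 1))\<bar> \<le> K"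
  shows "summable (\<lambda>k. gauss_weight k x * g (1 / (x + real k + 1)))"
proof (rule summable_comparison_test', rule summable_mult[of _ K])
  show "summable (\<lambda>k. gauss_weight k x)" using gauss_weight_sums[OF x] by (rule sums_summable)
  show "norm (gauss_weight k x * g (1 / (x + real k + 1))) \<le> K * gauss_weight k x" if "k \<ge> 0" for k
    using b[of k] gauss_weight_nonneg[OF x, of k] by (simp add: abs_mult mult.commute[of K] mult_left_mono)
qed

lemma gauss_op_abs_le:
  assumes x: "0 \<le> x" and b: "\<And>k. \<bar>g (1 / (x + real k + 1))\<bar> \<le> K"
  shows "\<bar>gauss_op g x\<bar> \<le> K"
proof -
  have "norm (gauss_op g x) \<le> (\<Sum>k. K * gauss_weight k x)"
    unfolding gauss_op_def
  proof (rule norm_suminf_le)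
    show "norm (gauss_weight k x * g (1 / (x + real k + 1))) \<le> K * gauss_weight k x" for k
      using b[of k] gauss_weight_nonneg[OF x, of k] by (simp add: abs_mult mult.commute[of K] mult_left_mono)
    show "summable (\<lambda>k. K * gauss_weight k x)"
      using gauss_weight_sums[OF x] by (intro summable_mult) (rule sums_summable)
  qed
  also have "\<dots> = K" using sums_mult[OF gauss_weight_sums[OF x], of K] by (simp add: sums_iff)
  finally show ?thesis by simp
qed

lemma borel_measurable_gauss_op [measurable]:
  "g \<in> borel_measurable borel \<Longrightarrow> gauss_op g \<in> borel_measurable borel"
proof -
  assume [measurable]: "g \<in> borel_measurable borel"
  have "(\<lambda>x. g (1 / (x + real k + 1))) \<in> borel_measurable borel" for k by measurable
  then show "gauss_op g \<in> borel_measurable borel"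
    unfolding gauss_op_def gauss_weight_def by measurable
qed

section \<open>Contraction of Lipschitz constants by the transfer operator\<close>

lemma sum_inverse_cubes_le: "(\<Sum>k<N. 1 / (real k + 2) ^ 3) \<le> 1 / 4 - 1 / (2 * (real N + 1) * (real N + 2))"
proof (induction N)
  case (Suc N)
  \<comment> \<open>The cube is compared with a product of three consecutive numbers, whose
    reciprocals telescope. The total 1/4 enters the contraction constant.\<close>
  have "1 / (real N + 2) ^ 3 \<le> 1 / ((real N + 1) * (real N + 2) * (real N + 3))"
  proof (rule divide_left_mono)
    show "(real N + 1) * (real N + 2) * (real N + 3) \<le> (real N + 2) ^ 3"
      by (simp add: power3_eq_cube algebra_simps)
  qed (auto intro!: mult_pos_pos)
  also have "\<dots> = 1 / (2 * (real N + 1) * (real N + 2)) - 1 / (2 * (real (Suc N) + 1) * (real (Suc N) + 2))"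
  proof -
    have "1 / (a * (a + 1) * (a + 2)) = 1 / (2 * a * (a + 1)) - 1 / (2 * (a + 1) * (a + 2))"
      if "a > 0" for a :: real
      using that by (simp add: divide_simps) (simp add: algebra_simps)
    from this[of "real N + 1"] show ?thesis by (simp add: add.commute)
  qed
  finally show ?case using Suc by simp
qed simp

lemma lipschitz_unit_bounded:
  fixes g :: "real \<Rightarrow> real"
  assumes "L-lipschitz_on {0..1} g" "x \<in> {0..1}"
  shows "\<bar>g x\<bar> \<le> \<bar>g 0\<bar> + L"
proof -
  have "\<bar>g x - g 0\<bar> \<le> L * \<bar>x - 0\<bar>"
    using lipschitz_onD[OF assms(1), of x 0] assms(2) by (simp add: dist_real_def)
  also have "\<dots> \<le> L" using assms(2) lipschitz_on_nonneg[OF assms(1)] by (simp add: mult_left_le)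
  finally show ?thesis by linarith
qed

text \<open>The difference at \<open>x\<close> and \<open>y\<close> splits into a change of the
  arguments of \<open>g\<close> and a change of the weights. The first is small because the branches
  contract; the second because, after summation by parts, only differences of \<open>g\<close> at
  neighbouring branches occur. The bounds 5/8 and 1/4 add up to 7/8.\<close>

lemma gauss_op_lipschitz:
  assumes g: "L-lipschitz_on {0..1} g"
  shows "(7 / 8 * L)-lipschitz_on {0..1} (gauss_op g)"
proof (rule lipschitz_onI)
  have L: "0 \<le> L" using g by (rule lipschitz_on_nonneg)
  then show "0 \<le> 7 / 8 * L" by simp
  fix x y :: real assume "x \<in> {0..1}" "y \<in> {0..1}"
  then have x: "0 \<le> x" "x \<le> 1" and y: "0 \<le> y" "y \<le> 1" by auto
  have br: "1 / (z + real k + 1) \<in> {0..1}" if "0 \<le> z" for z k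
    using that by (simp add: field_simps)
  have lip: "\<bar>g u - g v\<bar> \<le> L * \<bar>u - v\<bar>" if "u \<in> {0..1}" "v \<in> {0..1}" for u v
    using lipschitz_onD[OF g that] by (simp add: dist_real_def)
  define K where "K = \<bar>g 0\<bar> + L"
  have K: "\<bar>g (1 / (z + real k + 1))\<bar> \<le> K" if "0 \<le> z" for z k
    unfolding K_def using lipschitz_unit_bounded[OF g br[OF that]] .
  define gx where "gx k = g (1 / (x + real k + 1))" for k
  define gy where "gy k = g (1 / (y + real k + 1))" for k
  define D where "D k = gauss_tail k x - gauss_tail k y" for k
  define d where "d = L * \<bar>x - y\<bar>"
  have d: "0 \<le> d" using L by (simp add: d_def)
  have Ux: "(\<lambda>k. gauss_weight k x * gx k) sums gauss_op g x"
    unfolding gauss_op_def gx_def by (rule summable_sums) (rule gauss_op_summable[of _ _ K]; use x K in simp)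
  have Uy: "(\<lambda>k. gauss_weight k y * gy k) sums gauss_op g y"
    unfolding gauss_op_def gy_def by (rule summable_sums) (rule gauss_op_summable[of _ _ K]; use y K in simp)
  have A: "\<bar>\<Sum>k<N. gauss_weight k x * (gx k - gy k)\<bar> \<le> 5 / 8 * d" for N
  proof -
    \<comment> \<open>Branch 0 is only nonexpanding, the others contract by a factor of at most 1/4.
      The factor 1 of branch 0 is written as \<open>1 / 4 + 3 / 4\<close>: the weights sum to 1 and
      \<open>gauss_weight 0 x \<le> 1 / 2\<close>, so the total is at most
      \<open>1 / 4 + 3 / 8 = 5 / 8\<close>.\<close>
    have t: "\<bar>gauss_weight k x * (gx k - gy k)\<bar>
        \<le> d * (1 / 4 * gauss_weight k x + (if k = 0 then 3 / 4 * gauss_weight 0 x else 0))" for k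
    proof -
      have "1 / (x + real k + 1) - 1 / (y + real k + 1) = (y - x) / ((x + real k + 1) * (y + real k + 1))"
        using x y by (simp add: field_simps)
      then have "\<bar>gx k - gy k\<bar> \<le> L * (\<bar>x - y\<bar> / ((x + real k + 1) * (y + real k + 1)))"
        using lip[OF br br, OF x(1) y(1), of k k] x y
        by (simp add: gx_def gy_def abs_divide abs_mult abs_minus_commute)
      also have "\<dots> = d * (1 / ((x + real k + 1) * (y + real k + 1)))" by (simp add: d_def)
      also have "\<dots> \<le> d * (if k = 0 then 1 else 1 / 4)"
      proof (rule mult_left_mono[OF _ d])
        have "1 * 1 \<le> (x + real k + 1) * (y + real k + 1)"
          using x y by (intro mult_mono) auto
        moreover have "2 * 2 \<le> (x + real k + 1) * (y + real k + 1)" if "k \<noteq> 0"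
          using x y that by (intro mult_mono) auto
        ultimately show "1 / ((x + real k + 1) * (y + real k + 1)) \<le> (if k = 0 then 1 else 1 / 4)"
          by (auto simp: divide_simps)
      qed
      finally have "\<bar>gauss_weight k x * (gx k - gy k)\<bar> \<le> gauss_weight k x * (d * (if k = 0 then 1 else 1 / 4))"
        using gauss_weight_nonneg[OF x(1), of k] by (simp add: abs_mult mult_left_mono)
      then show ?thesis by (cases "k = 0") (auto simp: algebra_simps)
    qed
    have w0: "gauss_weight 0 x \<le> 1 / 2"
    proof -
      have "gauss_weight 0 x = 1 / (x + 2)"
        using x by (simp add: gauss_weight_def add.commute[of 1 x])
      also have "\<dots> \<le> 1 / 2" using x by simp
      finally show ?thesis .
    qed
    have "\<bar>\<Sum>k<N. gauss_weight k x * (gx k - gy k)\<bar> \<le> (\<Sum>k<N. \<bar>gauss_weight k x * (gx k - gy k)\<bar>)"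
      by (rule sum_abs)
    also have "\<dots> \<le> (\<Sum>k<N. d * (1 / 4 * gauss_weight k x + (if k = 0 then 3 / 4 * gauss_weight 0 x else 0)))"
      by (rule sum_mono[OF t])
    also have "\<dots> = d * (1 / 4 * (\<Sum>k<N. gauss_weight k x) + (\<Sum>k<N. if k = 0 then 3 / 4 * gauss_weight 0 x else 0))"
      by (simp only: sum_distrib_left[symmetric] sum.distrib)
    also have "\<dots> \<le> d * (1 / 4 * 1 + 3 / 4 * (1 / 2))"
    proof (intro mult_left_mono d add_mono)
      show "(\<Sum>k<N. gauss_weight k x) \<le> 1"
        using sum_le_suminf[of "\<lambda>k. gauss_weight k x" "{..<N}"] gauss_weight_sums[OF x(1)]
          gauss_weight_nonneg[OF x(1)] by (simp add: sums_iff)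
      show "(\<Sum>k<N. if k = 0 then 3 / 4 * gauss_weight 0 x else 0) \<le> 3 / 4 * (1 / 2)"
        using w0 by (cases "N = 0") auto
    qed simp
    finally show ?thesis by simp
  qed
  \<comment> \<open>The tails of index \<open>k + 1\<close> at \<open>x\<close> and \<open>y\<close>
    differ by at most \<open>\<bar>x - y\<bar> * (k + 1) / (k + 2) ^ 2\<close>, neighbouring values
    of \<open>g\<close> by at most \<open>L / ((k + 1) * (k + 2))\<close>. The products are inverse
    cubes.\<close>
  have B: "\<bar>\<Sum>k<N. D (Suc k) * (gy (Suc k) - gy k)\<bar> \<le> 1 / 4 * d" for N
  proof -
    have t: "\<bar>D (Suc k) * (gy (Suc k) - gy k)\<bar> \<le> d * (1 / (real k + 2) ^ 3)" for k
    proof -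
      have "D (Suc k) = (x - y) * ((real k + 1) / ((x + real k + 2) * (y + real k + 2)))"
        using x y by (simp add: D_def gauss_tail_def divide_simps) (simp add: algebra_simps)
      then have "\<bar>D (Suc k)\<bar> = \<bar>x - y\<bar> * ((real k + 1) / ((x + real k + 2) * (y + real k + 2)))"
        using x y by (simp add: abs_mult)
      also have "\<dots> \<le> \<bar>x - y\<bar> * ((real k + 1) / ((real k + 2) * (real k + 2)))"
        using x y by (intro mult_left_mono divide_left_mono mult_mono) auto
      finally have D: "\<bar>D (Suc k)\<bar> \<le> \<bar>x - y\<bar> * ((real k + 1) / ((real k + 2) * (real k + 2)))" .
      have "1 / (y + real (Suc k) + 1) - 1 / (y + real k + 1) = - 1 / ((y + real k + 1) * (y + real k + 2))"
        using y by (simp add: divide_simps)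
      then have "\<bar>gy (Suc k) - gy k\<bar> \<le> L * (1 / ((y + real k + 1) * (y + real k + 2)))"
        using lip[OF br br, OF y(1) y(1), of "Suc k" k] y
        by (simp add: gy_def abs_divide abs_mult)
      also have "\<dots> \<le> L * (1 / ((real k + 1) * (real k + 2)))"
        using y L by (intro mult_left_mono divide_left_mono mult_mono) auto
      finally have "\<bar>gy (Suc k) - gy k\<bar> \<le> L * (1 / ((real k + 1) * (real k + 2)))" .
      with D have "\<bar>D (Suc k)\<bar> * \<bar>gy (Suc k) - gy k\<bar> \<le>
          (\<bar>x - y\<bar> * ((real k + 1) / ((real k + 2) * (real k + 2)))) * (L * (1 / ((real k + 1) * (real k + 2))))"
        by (intro mult_mono) auto
      also have "\<dots> = d * (1 / (real k + 2) ^ 3)"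
        by (simp add: d_def power3_eq_cube divide_simps)
      finally show ?thesis by (simp add: abs_mult)
    qed
    have "\<bar>\<Sum>k<N. D (Suc k) * (gy (Suc k) - gy k)\<bar> \<le> (\<Sum>k<N. \<bar>D (Suc k) * (gy (Suc k) - gy k)\<bar>)"
      by (rule sum_abs)
    also have "\<dots> \<le> (\<Sum>k<N. d * (1 / (real k + 2) ^ 3))" by (rule sum_mono[OF t])
    also have "\<dots> = d * (\<Sum>k<N. 1 / (real k + 2) ^ 3)" by (rule sum_distrib_left[symmetric])
    also have "\<dots> \<le> d * (1 / 4)"
    proof (rule mult_left_mono[OF _ d])
      have "0 \<le> 1 / (2 * (real N + 1) * (real N + 2))" by simp
      then show "(\<Sum>k<N. 1 / (real k + 2) ^ 3) \<le> 1 / 4" using sum_inverse_cubes_le[of N] by linarith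
    qed
    finally show ?thesis by simp
  qed
  \<comment> \<open>Summation by parts. The boundary term at 0 is absent since
    \<open>gauss_tail 0\<close> equals 1 at both points, and the one at \<open>N\<close> tends to
    0.\<close>
  have abel: "(\<Sum>k<N. (D k - D (Suc k)) * gy k) = (\<Sum>k<N. D (Suc k) * (gy (Suc k) - gy k)) - D N * gy N" for N
  proof (induction N)
    case 0
    show ?case using x y by (simp add: D_def gauss_tail_def add.commute)
  qed (simp add: algebra_simps)
  have split: "(\<Sum>k<N. gauss_weight k x * gx k) - (\<Sum>k<N. gauss_weight k y * gy k) + D N * gy N =
      (\<Sum>k<N. gauss_weight k x * (gx k - gy k)) + (\<Sum>k<N. D (Suc k) * (gy (Suc k) - gy k))" for N
  proof -
    have "(\<Sum>k<N. gauss_weight k x * gx k) - (\<Sum>k<N. gauss_weight k y * gy k) =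
        (\<Sum>k<N. gauss_weight k x * (gx k - gy k)) + (\<Sum>k<N. (D k - D (Suc k)) * gy k)"
      using x y by (simp add: sum_subtractf[symmetric] sum.distrib[symmetric] D_def gauss_weight_tail algebra_simps)
    then show ?thesis unfolding abel by simp
  qed
  have DN: "(\<lambda>N. D N * gy N) \<longlonglongrightarrow> 0"
  proof (rule Lim_null_comparison[where g="\<lambda>N. \<bar>D N\<bar> * K"])
    show "\<forall>\<^sub>F N in sequentially. norm (D N * gy N) \<le> \<bar>D N\<bar> * K"
      using K[OF y(1)] by (intro always_eventually allI) (simp add: abs_mult gy_def mult_left_mono)
    have "D \<longlonglongrightarrow> 0 - 0" unfolding D_def by (intro tendsto_diff gauss_tail_LIMSEQ)
    then show "(\<lambda>N. \<bar>D N\<bar> * K) \<longlonglongrightarrow> 0"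
      by (intro tendsto_mult_left_zero tendsto_rabs_zero) simp
  qed
  have "(\<lambda>N. (\<Sum>k<N. gauss_weight k x * gx k) - (\<Sum>k<N. gauss_weight k y * gy k) + D N * gy N)
      \<longlonglongrightarrow> gauss_op g x - gauss_op g y + 0"
    using Ux Uy unfolding sums_def by (intro tendsto_add tendsto_diff DN)
  then have "\<bar>gauss_op g x - gauss_op g y + 0\<bar> \<le> 5 / 8 * d + 1 / 4 * d"
  proof (rule LIMSEQ_le_const2[OF tendsto_rabs], intro exI allI impI)
    fix N :: nat
    show "\<bar>(\<Sum>k<N. gauss_weight k x * gx k) - (\<Sum>k<N. gauss_weight k y * gy k) + D N * gy N\<bar> \<le> 5 / 8 * d + 1 / 4 * d"
      unfolding split using A[of N] B[of N] by linarith
  qed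
  then show "dist (gauss_op g x) (gauss_op g y) \<le> 7 / 8 * L * dist x y"
    by (simp add: d_def dist_real_def)
qed

section \<open>Change of variables along the inverse branches, and duality\<close>

lemma nn_integral_branch:
  fixes h :: "real \<Rightarrow> ennreal" and k :: nat
  assumes [measurable]: "h \<in> borel_measurable borel"
  shows "(\<integral>\<^sup>+t. h t * indicator {1 / (real k + 2)..1 / (real k + 1)} t \<partial>lborel) =
    (\<integral>\<^sup>+s. h (1 / (s + k + 1)) * ennreal (1 / (s + k + 1)\<^sup>2) * indicator {0..1} s \<partial>lborel)"
proof -
  \<comment> \<open>The branch is decreasing while the substitution rule is applied to a map with
    nonnegative derivative; reflecting the outer variable supplies the sign.\<close>
  define g where "g s = - (1 / (s + real k + 1))" for s
  have "(\<integral>\<^sup>+t. h t * indicator {1 / (real k + 2)..1 / (real k + 1)} t \<partial>lborel) =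
      (\<integral>\<^sup>+t. h (- t) * indicator {1 / (real k + 2)..1 / (real k + 1)} (- t) \<partial>lborel)"
    by (subst nn_integral_real_affine[where c="-1" and t=0]) auto
  also have "\<dots> = (\<integral>\<^sup>+t. h (- t) * indicator {g 0..g 1} t \<partial>lborel)"
    by (intro nn_integral_cong) (auto simp: g_def indicator_def add.commute)
  also have "\<dots> = (\<integral>\<^sup>+s. h (- g s) * ennreal (1 / (s + k + 1)\<^sup>2) * indicator {0..1} s \<partial>lborel)"
  proof (rule nn_integral_substitution_aux[where f="\<lambda>t. h (- t)" and g=g and a=0 and b=1
        and g'="\<lambda>s. 1 / (s + real k + 1)\<^sup>2"])
    show "(g has_real_derivative 1 / (s + k + 1)\<^sup>2) (at s)" if "s \<in> {0..1}" for s :: real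
      unfolding g_def using that by (auto intro!: derivative_eq_intros simp: power2_eq_square field_simps)
    show "continuous_on {0..1} (\<lambda>s. 1 / (s + real k + 1)\<^sup>2)"
      by (intro continuous_intros) auto
  qed auto
  finally show ?thesis by (simp add: g_def)
qed

text \<open>The unit interval is cut into the images of the inverse branches, and each piece is
  pulled back. In \<open>ennreal\<close>, sum and integral exchange without any question of
  integrability.\<close>

lemma nn_integral_gauss_op:
  fixes \<psi> :: "real \<Rightarrow> ennreal"
  assumes [measurable]: "\<psi> \<in> borel_measurable borel"
  shows "(\<integral>\<^sup>+t. \<psi> t \<partial>gauss_measure) =
    (\<integral>\<^sup>+s. (\<Sum>k. ennreal (gauss_weight k s) * \<psi> (1 / (s + k + 1))) \<partial>gauss_measure)"
proof -
  define h where "h t = ennreal (1 / (1 + t)) * \<psi> t" for t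
  have [measurable]: "h \<in> borel_measurable borel" unfolding h_def by measurable
  \<comment> \<open>Half-open pieces are disjoint; the closed ones used in the substitution differ
    from them by null sets.\<close>
  define J where "J k = {1 / (real k + 2)<..1 / (real k + 1)}" for k :: nat
  have dj: "disjoint_family J"
  proof (unfold disjoint_family_on_def, intro ballI impI)
    fix m n :: nat assume "m \<noteq> n"
    then consider "Suc m \<le> n" | "Suc n \<le> m" by linarith
    then show "J m \<inter> J n = {}"
    proof cases
      case 1
      then have "real m + 2 \<le> real n + 1" by linarith
      then have "1 / (real n + 1) \<le> 1 / (real m + 2)" by (intro divide_left_mono) auto
      then show ?thesis by (auto simp: J_def)
    next
      case 2
      then have "real n + 2 \<le> real m + 1" by linarith
      then have "1 / (real m + 1) \<le> 1 / (real n + 2)" by (intro divide_left_mono) auto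
      then show ?thesis by (auto simp: J_def)
    qed
  qed
  have un: "(\<Union>k. J k) = {0<..1}"
  proof (intro equalityI subsetI)
    fix t assume "t \<in> (\<Union>k. J k)"
    then obtain k where "1 / (real k + 2) < t" "t \<le> 1 / (real k + 1)" by (auto simp: J_def)
    moreover have "0 < 1 / (real k + 2)" "1 / (real k + 1) \<le> 1" by auto
    ultimately show "t \<in> {0<..1}" unfolding greaterThanAtMost_iff by linarith
  next
    fix t :: real assume t: "t \<in> {0<..1}"
    \<comment> \<open>\<open>k + 1\<close> is the first continued fraction digit of
      \<open>t\<close>.\<close>
    define k where "k = nat (\<lfloor>1 / t\<rfloor> - 1)"
    have "1 \<le> 1 / t" using t by simp
    then have "1 \<le> \<lfloor>1 / t\<rfloor>" by simp
    then have "real k = of_int \<lfloor>1 / t\<rfloor> - 1" by (simp add: k_def)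
    then have "real k + 1 \<le> 1 / t" "1 / t < real k + 2" by linarith+
    then have "t \<in> J k" using t by (simp add: J_def field_simps)
    then show "t \<in> (\<Union>k. J k)" by blast
  qed
  have ind: "(\<Sum>k. indicator (J k) t :: ennreal) = indicator {0<..1} t" for t
    using suminf_indicator[OF dj, of t] un by simp
  have ne: "AE t in lborel. t \<noteq> (c::real)" for c by (rule AE_lborel_singleton)
  have "(\<integral>\<^sup>+t. \<psi> t \<partial>gauss_measure) = (\<integral>\<^sup>+t. ennreal (indicator {0<..<1} t / (1 + t)) * \<psi> t \<partial>lborel)"
    by (rule nn_integral_gauss_measure) simp
  also have "\<dots> = (\<integral>\<^sup>+t. (\<Sum>k. h t * indicator (J k) t) \<partial>lborel)"
  proof (intro nn_integral_cong_AE, use ne[of 1] in eventually_elim)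
    fix t :: real assume "t \<noteq> 1"
    have "(\<Sum>k. h t * indicator (J k) t) = h t * indicator {0<..1} t"
      by (simp only: ennreal_suminf_cmult ind)
    also have "\<dots> = ennreal (indicator {0<..<1} t / (1 + t)) * \<psi> t"
      using \<open>t \<noteq> 1\<close> by (auto simp: h_def indicator_def)
    finally show "ennreal (indicator {0<..<1} t / (1 + t)) * \<psi> t = (\<Sum>k. h t * indicator (J k) t)" ..
  qed
  also have "\<dots> = (\<Sum>k. (\<integral>\<^sup>+t. h t * indicator (J k) t \<partial>lborel))"
    by (rule nn_integral_suminf) (simp add: J_def)
  also have "\<dots> = (\<Sum>k. (\<integral>\<^sup>+s. ennreal (indicator {0<..<1} s / (1 + s)) *
      (ennreal (gauss_weight k s) * \<psi> (1 / (s + k + 1))) \<partial>lborel))"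
  proof (rule suminf_cong)
    fix k :: nat
    have "(\<integral>\<^sup>+t. h t * indicator (J k) t \<partial>lborel) =
        (\<integral>\<^sup>+t. h t * indicator {1 / (real k + 2)..1 / (real k + 1)} t \<partial>lborel)"
      by (intro nn_integral_cong_AE, use ne[of "1 / (real k + 2)"] in eventually_elim)
         (auto simp: J_def indicator_def)
    also have "\<dots> = (\<integral>\<^sup>+s. h (1 / (s + k + 1)) * ennreal (1 / (s + k + 1)\<^sup>2) * indicator {0..1} s \<partial>lborel)"
      by (rule nn_integral_branch) simp
    also have "\<dots> = (\<integral>\<^sup>+s. ennreal (indicator {0<..<1} s / (1 + s)) *
      (ennreal (gauss_weight k s) * \<psi> (1 / (s + k + 1))) \<partial>lborel)"
    proof (intro nn_integral_cong_AE, use ne[of 0] ne[of 1] in eventually_elim)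
      fix s :: real assume s: "s \<noteq> 0" "s \<noteq> 1"
      show "h (1 / (s + k + 1)) * ennreal (1 / (s + k + 1)\<^sup>2) * indicator {0..1} s =
        ennreal (indicator {0<..<1} s / (1 + s)) * (ennreal (gauss_weight k s) * \<psi> (1 / (s + k + 1)))"
      proof (cases "s \<in> {0<..<1}")
        case True
        \<comment> \<open>Density at the image point times derivative of the branch: this identity
          is the origin of the formula for \<open>gauss_weight\<close>.\<close>
        have "1 / (1 + 1 / (s + k + 1)) * (1 / (s + k + 1)\<^sup>2) = 1 / (1 + s) * gauss_weight k s"
          using True by (simp add: gauss_weight_def divide_simps power2_eq_square)
        then have "ennreal (1 / (1 + 1 / (s + k + 1))) * ennreal (1 / (s + k + 1)\<^sup>2) =
            ennreal (1 / (1 + s)) * ennreal (gauss_weight k s)"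
          using True by (simp add: ennreal_mult[symmetric] gauss_weight_nonneg del: ennreal_1)
        moreover have "h (1 / (s + k + 1)) * ennreal (1 / (s + k + 1)\<^sup>2) =
            (ennreal (1 / (1 + 1 / (s + k + 1))) * ennreal (1 / (s + k + 1)\<^sup>2)) * \<psi> (1 / (s + k + 1))"
          unfolding h_def by (simp only: ac_simps)
        ultimately show ?thesis using True by (simp add: mult.assoc)
      qed (use s in auto)
    qed
    finally show "(\<integral>\<^sup>+t. h t * indicator (J k) t \<partial>lborel) =
      (\<integral>\<^sup>+s. ennreal (indicator {0<..<1} s / (1 + s)) *
      (ennreal (gauss_weight k s) * \<psi> (1 / (s + k + 1))) \<partial>lborel)" .
  qed
  also have "\<dots> = (\<integral>\<^sup>+s. (\<Sum>k. ennreal (indicator {0<..<1} s / (1 + s)) *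
      (ennreal (gauss_weight k s) * \<psi> (1 / (s + k + 1)))) \<partial>lborel)"
    by (rule nn_integral_suminf[symmetric]) (simp add: gauss_weight_def)
  also have "\<dots> = (\<integral>\<^sup>+s. ennreal (indicator {0<..<1} s / (1 + s)) *
      (\<Sum>k. ennreal (gauss_weight k s) * \<psi> (1 / (s + k + 1))) \<partial>lborel)"
    by simp
  also have "\<dots> = (\<integral>\<^sup>+s. (\<Sum>k. ennreal (gauss_weight k s) * \<psi> (1 / (s + k + 1))) \<partial>gauss_measure)"
    by (rule nn_integral_gauss_measure[symmetric]) (simp add: gauss_weight_def)
  finally show ?thesis .
qed

text \<open>Adding \<open>K\<close> makes the function nonnegative. Since the weights sum to 1, the
  constant passes through \<open>gauss_op\<close> unchanged and cancels at the end.\<close>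

lemma integral_gauss_op:
  assumes [measurable]: "\<psi> \<in> borel_measurable borel"
    and K: "\<And>t. 0 < t \<Longrightarrow> t < 1 \<Longrightarrow> \<bar>\<psi> t\<bar> \<le> K"
  shows "(\<integral>t. \<psi> t \<partial>gauss_measure) = (\<integral>s. gauss_op \<psi> s \<partial>gauss_measure)"
proof -
  have K': "\<bar>\<psi> (1 / (s + real k + 1))\<bar> \<le> K" if "0 < s" for s k
    using K branch_in_unit[OF that, of k] by auto
  have bd: "\<bar>gauss_op \<psi> s\<bar> \<le> K" if "0 < s" for s
    using that K' by (intro gauss_op_abs_le) auto
  have pt: "(\<Sum>k. ennreal (gauss_weight k s) * ennreal (\<psi> (1 / (s + k + 1)) + K)) = ennreal (gauss_op \<psi> s + K)"
    if s: "0 < s" for s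
  proof -
    have sm: "(\<lambda>k. gauss_weight k s * (\<psi> (1 / (s + k + 1)) + K)) sums (gauss_op \<psi> s + K)"
      using sums_add[OF summable_sums[OF gauss_op_summable[of s \<psi> K]] sums_mult2[OF gauss_weight_sums, of s K]] s K'
      by (simp add: gauss_op_def distrib_left)
    have nn: "0 \<le> \<psi> (1 / (s + real k + 1)) + K" for k using K'[OF s, of k] by linarith
    have "(\<Sum>k. ennreal (gauss_weight k s) * ennreal (\<psi> (1 / (s + k + 1)) + K)) =
        (\<Sum>k. ennreal (gauss_weight k s * (\<psi> (1 / (s + k + 1)) + K)))"
      using nn gauss_weight_nonneg[of s] s by (intro suminf_cong ennreal_mult[symmetric]) auto
    also have "\<dots> = ennreal (gauss_op \<psi> s + K)"
      using nn gauss_weight_nonneg[of s] s by (intro suminf_ennreal_eq[OF _ sm]) auto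
    finally show ?thesis .
  qed
  have "(\<integral>t. \<psi> t + K \<partial>gauss_measure) = enn2real (\<integral>\<^sup>+t. ennreal (\<psi> t + K) \<partial>gauss_measure)"
  proof (rule integral_eq_nn_integral)
    show "AE t in gauss_measure. 0 \<le> \<psi> t + K"
      using AE_gauss_measure by eventually_elim (use K in fastforce)
  qed simp
  also have "(\<integral>\<^sup>+t. ennreal (\<psi> t + K) \<partial>gauss_measure) =
      (\<integral>\<^sup>+s. (\<Sum>k. ennreal (gauss_weight k s) * ennreal (\<psi> (1 / (s + k + 1)) + K)) \<partial>gauss_measure)"
    by (rule nn_integral_gauss_op) simp
  also have "\<dots> = (\<integral>\<^sup>+s. ennreal (gauss_op \<psi> s + K) \<partial>gauss_measure)"
    by (intro nn_integral_cong_AE, use AE_gauss_measure in eventually_elim) (simp add: pt)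
  also have "enn2real \<dots> = (\<integral>s. gauss_op \<psi> s + K \<partial>gauss_measure)"
  proof (rule integral_eq_nn_integral[symmetric])
    show "AE s in gauss_measure. 0 \<le> gauss_op \<psi> s + K"
      using AE_gauss_measure by eventually_elim (use bd in fastforce)
  qed simp
  finally have "(\<integral>t. \<psi> t + K \<partial>gauss_measure) = (\<integral>s. gauss_op \<psi> s + K \<partial>gauss_measure)" .
  moreover have "integrable gauss_measure \<psi>" "integrable gauss_measure (gauss_op \<psi>)"
    using K bd by (auto intro!: integrable_gauss_measure[where K=K])
  ultimately show ?thesis by simp
qed

definition gauss_map :: "real \<Rightarrow> real" where "gauss_map t = frac (1 / t)"

lemma borel_measurable_frac [measurable]: "frac \<in> borel_measurable (borel :: real measure)"
  unfolding frac_def by measurable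

lemma borel_measurable_gauss_map [measurable]: "gauss_map \<in> borel_measurable borel"
  unfolding gauss_map_def by measurable

lemma gauss_map_branch: "0 < s \<Longrightarrow> s < 1 \<Longrightarrow> gauss_map (1 / (s + real k + 1)) = s"
  using frac_unique_iff[of "s + real k + 1" s] by (simp add: gauss_map_def)

text \<open>Each branch is a right inverse of \<open>gauss_map\<close>, so in every term of the sum
  the factor \<open>\<phi> (gauss_map t)\<close> becomes \<open>\<phi> s\<close> and comes out. Thus
  \<open>gauss_op\<close> is adjoint to composition with the Gauss map.\<close>

lemma gauss_op_duality:
  assumes [measurable]: "\<phi> \<in> borel_measurable borel" "g \<in> borel_measurable borel"
    and \<phi>: "\<And>t. \<bar>\<phi> t\<bar> \<le> K" and g: "\<And>t. 0 < t \<Longrightarrow> t < 1 \<Longrightarrow> \<bar>g t\<bar> \<le> C"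
  shows "(\<integral>t. \<phi> (gauss_map t) * g t \<partial>gauss_measure) = (\<integral>s. \<phi> s * gauss_op g s \<partial>gauss_measure)"
proof -
  have "(\<integral>t. \<phi> (gauss_map t) * g t \<partial>gauss_measure) =
      (\<integral>s. gauss_op (\<lambda>t. \<phi> (gauss_map t) * g t) s \<partial>gauss_measure)"
  proof (rule integral_gauss_op)
    show "\<bar>\<phi> (gauss_map t) * g t\<bar> \<le> K * C" if "0 < t" "t < 1" for t
      using \<phi>[of "gauss_map t"] g[OF that] unfolding abs_mult by (intro mult_mono) auto
  qed simp
  also have "\<dots> = (\<integral>s. \<phi> s * gauss_op g s \<partial>gauss_measure)"
  proof (intro integral_cong_AE, simp_all, use AE_gauss_measure in eventually_elim)
    fix s :: real assume s: "s \<in> {0<..<1}"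
    have "\<bar>g (1 / (s + real k + 1))\<bar> \<le> C" for k
      using g branch_in_unit[of s k] s by auto
    then have "summable (\<lambda>k. gauss_weight k s * g (1 / (s + real k + 1)))"
      using s by (intro gauss_op_summable) auto
    then show "gauss_op (\<lambda>t. \<phi> (gauss_map t) * g t) s = \<phi> s * gauss_op g s"
      unfolding gauss_op_def using s by (simp add: gauss_map_branch suminf_mult[symmetric] mult.left_commute)
  qed
  finally show ?thesis .
qed

section \<open>Densities invariant under the square of the Gauss map\<close>

text \<open>The contraction works on Lipschitz functions, so a general density must be approximated
  by them. Indicators reduce to compact sets by inner regularity, and a nonempty compact
  \<open>K\<close> has the cut-offs \<open>max 0 (1 - n * infdist x K)\<close>, with Lipschitz
  constant \<open>n\<close>.\<close>

lemma lipschitz_dense_integrable: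
  fixes M :: "'a::{complete_space, second_countable_topology} measure" and f :: "'a \<Rightarrow> real"
  assumes "finite_measure M" and [simp, measurable_cong]: "sets M = sets borel" and f: "integrable M f" and "e > 0"
  shows "\<exists>g L. L-lipschitz_on UNIV g \<and> integrable M g \<and> (\<integral>x. \<bar>f x - g x\<bar> \<partial>M) < e"
  using f \<open>e > 0\<close>
proof (induction f arbitrary: e rule: integrable_induct)
  case (base A c)
  interpret finite_measure M by fact
  have sp [simp]: "space M = UNIV" using sets_eq_imp_space_eq[of M borel] by simp
  \<comment> \<open>Two errors below \<open>\<delta>\<close>, from the compact set and from the
    cut-off, get multiplied by \<open>\<bar>c\<bar>\<close> and must stay below \<open>e\<close>;
    the added 1 covers \<open>c = 0\<close>.\<close>
  define \<delta> where "\<delta> = e / (2 * (\<bar>c\<bar> + 1))"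
  have \<delta>: "\<delta> > 0" using base.prems by (simp add: \<delta>_def)
  have [measurable]: "A \<in> sets borel" using base by simp
  have "\<exists>K. K \<subseteq> A \<and> compact K \<and> measure M A - \<delta> < measure M K"
  \<comment> \<open>At measure 0 the strict inequality would be lost in \<open>ennreal\<close>,
    where negative reals become 0.\<close>
  proof (cases "measure M A = 0")
    case True
    then show ?thesis using \<delta> by (intro exI[of _ "{}"]) auto
  next
    case False
    then have "measure M A > 0" using measure_nonneg[of M A] by linarith
    then have "ennreal (measure M A - \<delta>) < ennreal (measure M A)"
      using \<delta> by (intro ennreal_lessI) auto
    also have "\<dots> = (SUP K \<in> {K. K \<subseteq> A \<and> compact K}. emeasure M K)"
      using inner_regular[of M A] base.hyps by (simp add: emeasure_eq_measure)
    finally obtain K where "K \<subseteq> A" "compact K" "ennreal (measure M A - \<delta>) < emeasure M K"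
      by (auto simp: less_SUP_iff)
    then show ?thesis
      by (intro exI[of _ K]) (auto simp: emeasure_eq_measure not_le[symmetric] dest: ennreal_leI)
  qed
  then obtain K where K: "K \<subseteq> A" "compact K" "measure M A - \<delta> < measure M K" by blast
  have [measurable]: "K \<in> sets borel" using K(2) by (simp add: borel_compact)
  have diff: "(\<integral>x. \<bar>indicator A x - indicator K x\<bar> \<partial>M) < \<delta>"
  proof -
    have "(\<integral>x. \<bar>indicat_real A x - indicator K x\<bar> \<partial>M) = (\<integral>x. indicator (A - K) x \<partial>M)"
      using K(1) by (intro Bochner_Integration.integral_cong) (auto simp: indicator_def)
    also have "\<dots> = measure M A - measure M K"
      using K(1) by (simp add: finite_measure_Diff)
    finally show ?thesis using K(3) by simp
  qed
  have "\<exists>h L. L-lipschitz_on UNIV h \<and> integrable M h \<and> (\<integral>x. \<bar>indicator K x - h x\<bar> \<partial>M) < \<delta>"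
  proof (cases "K = {}")
    case True
    have "0-lipschitz_on UNIV (\<lambda>x. 0::real)" by (rule lipschitz_onI) auto
    then show ?thesis using True \<delta> by (intro exI[of _ "\<lambda>_. 0"] exI[of _ 0]) auto
  next
    case False
    define h where "h n x = max 0 (1 - real n * infdist x K)" for n x
    have lip: "(real n)-lipschitz_on UNIV (h n)" for n
    proof (rule lipschitz_onI)
      fix x y
      have "\<bar>h n x - h n y\<bar> \<le> \<bar>real n * infdist x K - real n * infdist y K\<bar>" by (simp add: h_def)
      also have "\<dots> = real n * \<bar>infdist x K - infdist y K\<bar>"
        by (simp add: right_diff_distrib[symmetric] abs_mult)
      also have "\<dots> \<le> real n * dist x y"
        by (intro mult_left_mono infdist_triangle_abs) simp
      finally show "dist (h n x) (h n y) \<le> real n * dist x y" by (simp add: dist_real_def)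
    qed simp
    have [measurable]: "h n \<in> borel_measurable borel" for n
      unfolding h_def by (intro borel_measurable_continuous_onI continuous_intros)
    have h01: "0 \<le> h n x" "h n x \<le> 1" for n x by (auto simp: h_def infdist_nonneg)
    have hi: "integrable M (h n)" for n
      using h01 by (intro integrable_const_bound[where B=1]) auto
    have "(\<lambda>n. (\<integral>x. \<bar>indicator K x - h n x\<bar> \<partial>M)) \<longlonglongrightarrow> (\<integral>x. 0 \<partial>M)"
    proof (rule integral_dominated_convergence[where w="\<lambda>_. 1"])
      show "AE x in M. (\<lambda>n. \<bar>indicator K x - h n x\<bar>) \<longlonglongrightarrow> 0"
      proof (rule AE_I2)
        fix x
        have "(\<lambda>n. indicator K x - h n x) \<longlonglongrightarrow> indicator K x - indicator K x"
          unfolding h_def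
          by (intro tendsto_intros closed_indicator_limit compact_imp_closed K False)
        then show "(\<lambda>n. \<bar>indicator K x - h n x\<bar>) \<longlonglongrightarrow> 0" by (intro tendsto_rabs_zero) simp
      qed
      show "AE x in M. norm \<bar>indicator K x - h n x\<bar> \<le> 1" for n
      proof (rule AE_I2)
        fix x
        show "norm \<bar>indicator K x - h n x\<bar> \<le> 1" using h01[of n x] by (auto simp: indicator_def)
      qed
    qed auto
    then have "\<forall>\<^sub>F n in sequentially. (\<integral>x. \<bar>indicator K x - h n x\<bar> \<partial>M) < \<delta>"
      using \<delta> by (intro order_tendstoD) auto
    then show ?thesis using lip hi unfolding eventually_sequentially by blast
  qed
  then obtain h L where h: "L-lipschitz_on UNIV h" "integrable M h" "(\<integral>x. \<bar>indicator K x - h x\<bar> \<partial>M) < \<delta>"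
    by blast
  have ii: "integrable M (indicator B :: _ \<Rightarrow> real)" if "B \<in> sets borel" for B
    using that by (intro integrable_const_bound[where B=1]) auto
  have "(\<integral>x. \<bar>indicator A x - h x\<bar> \<partial>M) \<le> (\<integral>x. \<bar>indicator A x - indicator K x\<bar> + \<bar>indicator K x - h x\<bar> \<partial>M)"
    using h(2) ii by (intro integral_mono Bochner_Integration.integrable_add integrable_abs Bochner_Integration.integrable_diff) auto
  also have "\<dots> = (\<integral>x. \<bar>indicator A x - indicator K x\<bar> \<partial>M) + (\<integral>x. \<bar>indicator K x - h x\<bar> \<partial>M)"
    using h(2) ii by (intro Bochner_Integration.integral_add integrable_abs Bochner_Integration.integrable_diff) auto
  also have "\<dots> < \<delta> + \<delta>" using diff h(3) by linarith
  finally have d: "(\<integral>x. \<bar>indicator A x - h x\<bar> \<partial>M) < 2 * \<delta>" by simp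
  have "(\<integral>x. \<bar>indicator A x *\<^sub>R c - c * h x\<bar> \<partial>M) = (\<integral>x. \<bar>c\<bar> * \<bar>indicator A x - h x\<bar> \<partial>M)"
    by (intro Bochner_Integration.integral_cong) (auto simp: abs_mult[symmetric] algebra_simps)
  also have "\<dots> = \<bar>c\<bar> * (\<integral>x. \<bar>indicator A x - h x\<bar> \<partial>M)" by simp
  also have "\<dots> \<le> \<bar>c\<bar> * (2 * \<delta>)" using d by (intro mult_left_mono) auto
  also have "\<dots> < (\<bar>c\<bar> + 1) * (2 * \<delta>)" using \<delta> by (intro mult_strict_right_mono) auto
  also have "\<dots> = e" by (simp add: \<delta>_def field_simps)
  finally have *: "(\<integral>x. \<bar>indicator A x *\<^sub>R c - c * h x\<bar> \<partial>M) < e" .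
  have "(\<bar>c\<bar> * L)-lipschitz_on UNIV (\<lambda>x. c * h x)"
  proof (rule lipschitz_onI)
    fix x y
    have "\<bar>h x - h y\<bar> \<le> L * dist x y"
      using lipschitz_onD[OF h(1), of x y] by (simp add: dist_real_def)
    then have "\<bar>c\<bar> * \<bar>h x - h y\<bar> \<le> \<bar>c\<bar> * (L * dist x y)" by (intro mult_left_mono) auto
    then show "dist (c * h x) (c * h y) \<le> \<bar>c\<bar> * L * dist x y"
      by (simp add: dist_real_def abs_mult[symmetric] right_diff_distrib mult.assoc)
  qed (use lipschitz_on_nonneg[OF h(1)] in simp)
  then show ?case using * h(2) by (intro exI[of _ "\<lambda>x. c * h x"] exI) auto
next
  case (add f1 f2)
  have "e / 2 > 0" using add.prems by simp
  from add.IH(1)[OF this] add.IH(2)[OF this] obtain g1 L1 g2 L2 where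
    1: "L1-lipschitz_on UNIV g1" "integrable M g1" "(\<integral>x. \<bar>f1 x - g1 x\<bar> \<partial>M) < e / 2" and
    2: "L2-lipschitz_on UNIV g2" "integrable M g2" "(\<integral>x. \<bar>f2 x - g2 x\<bar> \<partial>M) < e / 2"
    by blast
  have "(\<integral>x. \<bar>(f1 x + f2 x) - (g1 x + g2 x)\<bar> \<partial>M) \<le> (\<integral>x. \<bar>f1 x - g1 x\<bar> + \<bar>f2 x - g2 x\<bar> \<partial>M)"
    using add.hyps 1 2
    by (intro integral_mono Bochner_Integration.integrable_add integrable_abs Bochner_Integration.integrable_diff) auto
  also have "\<dots> = (\<integral>x. \<bar>f1 x - g1 x\<bar> \<partial>M) + (\<integral>x. \<bar>f2 x - g2 x\<bar> \<partial>M)"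
    using add.hyps 1 2
    by (intro Bochner_Integration.integral_add integrable_abs Bochner_Integration.integrable_diff) auto
  also have "\<dots> < e" using 1 2 by linarith
  finally have *: "(\<integral>x. \<bar>(f1 x + f2 x) - (g1 x + g2 x)\<bar> \<partial>M) < e" .
  have "(L1 + L2)-lipschitz_on UNIV (\<lambda>x. g1 x + g2 x)"
    using 1 2 by (intro lipschitz_on_add) auto
  then show ?case using * 1 2 by (intro exI[of _ "\<lambda>x. g1 x + g2 x"] exI) auto
next
  case (lim f s)
  have "(\<lambda>i. (\<integral>x. \<bar>f x - s i x\<bar> \<partial>M)) \<longlonglongrightarrow> (\<integral>x. 0 \<partial>M)"
  \<comment> \<open>The approximating simple functions are bounded by
    \<open>2 * \<bar>f x\<bar>\<close>, hence the factor 3.\<close>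
  proof (rule integral_dominated_convergence[where w="\<lambda>x. 3 * \<bar>f x\<bar>"])
    show "AE x in M. (\<lambda>i. \<bar>f x - s i x\<bar>) \<longlonglongrightarrow> 0"
    proof (rule AE_I2)
      fix x assume "x \<in> space M"
      then have "(\<lambda>i. f x - s i x) \<longlonglongrightarrow> f x - f x" using lim.hyps by (intro tendsto_intros) auto
      then show "(\<lambda>i. \<bar>f x - s i x\<bar>) \<longlonglongrightarrow> 0" by (intro tendsto_rabs_zero) simp
    qed
    show "AE x in M. norm \<bar>f x - s i x\<bar> \<le> 3 * \<bar>f x\<bar>" for i
    proof (rule AE_I2)
      fix x assume "x \<in> space M"
      then have "\<bar>s i x\<bar> \<le> 2 * \<bar>f x\<bar>" using lim.hyps(3)[of x i] by simp
      then show "norm \<bar>f x - s i x\<bar> \<le> 3 * \<bar>f x\<bar>" by simp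
    qed
  qed (use lim.hyps in auto)
  then have "\<forall>\<^sub>F i in sequentially. (\<integral>x. \<bar>f x - s i x\<bar> \<partial>M) < e / 2"
    using lim.prems by (intro order_tendstoD) auto
  then obtain i where i: "(\<integral>x. \<bar>f x - s i x\<bar> \<partial>M) < e / 2" by (auto simp: eventually_sequentially)
  obtain g L where g: "L-lipschitz_on UNIV g" "integrable M g" "(\<integral>x. \<bar>s i x - g x\<bar> \<partial>M) < e / 2"
    using lim.IH[of "e / 2" i] lim.prems by auto
  have "(\<integral>x. \<bar>f x - g x\<bar> \<partial>M) \<le> (\<integral>x. \<bar>f x - s i x\<bar> + \<bar>s i x - g x\<bar> \<partial>M)"
    using lim.hyps g
    by (intro integral_mono Bochner_Integration.integrable_add integrable_abs Bochner_Integration.integrable_diff) auto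
  also have "\<dots> = (\<integral>x. \<bar>f x - s i x\<bar> \<partial>M) + (\<integral>x. \<bar>s i x - g x\<bar> \<partial>M)"
    using lim.hyps g
    by (intro Bochner_Integration.integral_add integrable_abs Bochner_Integration.integrable_diff) auto
  also have "\<dots> < e" using i g by linarith
  finally show ?case using g by blast
qed

section \<open>Iterates of the transfer operator and exactness\<close>

lemma borel_measurable_funpow:
  fixes f :: "'a::topological_space \<Rightarrow> 'a"
  shows "f \<in> borel_measurable borel \<Longrightarrow> f ^^ n \<in> borel_measurable borel"
  by (induction n) (simp_all add: id_def o_def measurable_compose)

lemma gauss_op_funpow_lipschitz:
  assumes "L-lipschitz_on {0..1} g"
  shows "((7 / 8) ^ n * L)-lipschitz_on {0..1} ((gauss_op ^^ n) g)"
proof (induction n)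
  case (Suc n)
  from gauss_op_lipschitz[OF this] show ?case by (simp add: mult.assoc)
qed (use assms in simp)

text \<open>The bound that duality requires is supplied at each step by the Lipschitz constant of
  the current function, which is why \<open>L\<close> varies along the induction.\<close>

lemma gauss_op_funpow_duality:
  assumes [measurable]: "\<phi> \<in> borel_measurable borel" and \<phi>: "\<And>t. \<bar>\<phi> t\<bar> \<le> K"
  shows "g \<in> borel_measurable borel \<Longrightarrow> L-lipschitz_on {0..1} g \<Longrightarrow>
    (\<integral>t. \<phi> ((gauss_map ^^ n) t) * g t \<partial>gauss_measure) = (\<integral>s. \<phi> s * (gauss_op ^^ n) g s \<partial>gauss_measure)"
proof (induction n arbitrary: g L)
  case (Suc n)
  note [measurable] = Suc.prems(1) borel_measurable_funpow[OF borel_measurable_gauss_map]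
  have "(\<integral>t. \<phi> ((gauss_map ^^ Suc n) t) * g t \<partial>gauss_measure) =
      (\<integral>t. \<phi> ((gauss_map ^^ n) (gauss_map t)) * g t \<partial>gauss_measure)"
    by (simp add: funpow_Suc_right del: funpow.simps)
  also have "\<dots> = (\<integral>s. \<phi> ((gauss_map ^^ n) s) * gauss_op g s \<partial>gauss_measure)"
    by (rule gauss_op_duality[where K=K and C="\<bar>g 0\<bar> + L"])
       (auto intro: \<phi> lipschitz_unit_bounded[OF Suc.prems(2)])
  also have "\<dots> = (\<integral>s. \<phi> s * (gauss_op ^^ n) (gauss_op g) s \<partial>gauss_measure)"
    by (rule Suc.IH[OF _ gauss_op_lipschitz[OF Suc.prems(2)]]) simp
  finally show ?case by (simp add: funpow_Suc_right del: funpow.simps)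
qed simp

lemma measure_gauss_pos: "0 < measure gauss_measure UNIV"
proof (rule ccontr)
  assume "\<not> 0 < measure gauss_measure UNIV"
  then have "measure gauss_measure UNIV = 0" using measure_nonneg[of gauss_measure UNIV] by linarith
  then have "emeasure gauss_measure UNIV = 0" by (simp add: gauss.emeasure_eq_measure)
  then have "(\<integral>\<^sup>+t. 1 \<partial>gauss_measure) = 0" by simp
  then have "(\<integral>\<^sup>+t. ennreal (indicator {0<..<1} t / (1 + t)) \<partial>lborel) = 0"
    by (subst (asm) nn_integral_gauss_measure) auto
  then have "AE t in lborel. t \<notin> {0<..<1::real}"
    by (subst (asm) nn_integral_0_iff_AE) (auto simp: indicator_def ennreal_eq_0_iff elim!: eventually_mono split: if_splits)
  then have "emeasure lborel {0<..<1::real} = 0"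
    by (subst (asm) AE_iff_measurable[of "{0<..<1::real}"]) auto
  then show False by simp
qed

text \<open>The iterates of the Gauss map are exact: the transfer operator contracts Lipschitz constants,
  so under iteration every density becomes constant.\<close>

lemma gauss_map_invariant_density:
  assumes F: "integrable gauss_measure F"
    and inv: "\<And>B. B \<in> sets borel \<Longrightarrow>
      (\<integral>t. indicator B (gauss_map (gauss_map t)) * F t \<partial>gauss_measure) = (\<integral>t. indicator B t * F t \<partial>gauss_measure)"
  obtains c :: real where "\<And>B. B \<in> sets borel \<Longrightarrow>
    (\<integral>t. indicator B t * F t \<partial>gauss_measure) = c * measure gauss_measure B"
proof -
  let ?G = gauss_measure and ?T = "\<lambda>n. gauss_map ^^ (2 * n)"
  define W where "W = measure ?G UNIV"
  have W: "W > 0" unfolding W_def by (rule measure_gauss_pos)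
  note [measurable] = borel_measurable_funpow[OF borel_measurable_gauss_map]
  have invn: "(\<integral>t. indicator B (?T n t) * F t \<partial>?G) = (\<integral>t. indicator B t * F t \<partial>?G)"
    if B: "B \<in> sets borel" for B n
  proof (induction n)
    case (Suc n)
    have eq: "?T (Suc n) t = ?T n (gauss_map (gauss_map t))" for t
      by (simp add: funpow_Suc_right del: funpow.simps)
    \<comment> \<open>Invariance is assumed for every Borel set, so it may be applied to the
      preimage of \<open>B\<close> under the earlier iterates.\<close>
    have B': "?T n -` B \<in> sets borel" using measurable_sets[of "?T n" borel borel B] B by simp
    have "(\<integral>t. indicator B (?T (Suc n) t) * F t \<partial>?G) =
        (\<integral>t. indicator (?T n -` B) (gauss_map (gauss_map t)) * F t \<partial>?G)"
      unfolding eq by (simp add: indicator_def)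
    also have "\<dots> = (\<integral>t. indicator (?T n -` B) t * F t \<partial>?G)" by (rule inv[OF B'])
    also have "\<dots> = (\<integral>t. indicator B (?T n t) * F t \<partial>?G)" by (simp add: indicator_def)
    finally show ?case using Suc by simp
  qed simp
  have main: "\<bar>(\<integral>t. indicator B t * F t \<partial>?G) - (\<integral>t. F t \<partial>?G) / W * measure ?G B\<bar> \<le> 2 * e"
    if B [measurable]: "B \<in> sets borel" and e: "e > 0" for B e
  proof -
    obtain g L where gL: "L-lipschitz_on UNIV g" and gi: "integrable ?G g"
      and ge: "(\<integral>t. \<bar>F t - g t\<bar> \<partial>?G) < e"
      using lipschitz_dense_integrable[OF finite_gauss_measure sets_gauss_measure F e] by blast
    have g: "L-lipschitz_on {0..1} g" using gL by (rule lipschitz_on_subset) simp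
    have [measurable]: "g \<in> borel_measurable borel"
      using gi by (auto dest: borel_measurable_integrable)
    have [measurable]: "F \<in> borel_measurable borel"
      using F by (auto dest: borel_measurable_integrable)
    have GB: "measure ?G B \<le> W" unfolding W_def by (rule gauss.finite_measure_mono) auto
    \<comment> \<open>Four errors. Replacing \<open>F\<close> by \<open>g\<close> costs
      \<open>e\<close> twice, in the integral over \<open>B\<close> and in the total integral;
      iteration does not enlarge it because the iterate sits inside the indicator. Replacing
      \<open>u\<close> by the constant \<open>u 0\<close> costs \<open>W * r\<close> twice, and this
      tends to 0 with growing \<open>n\<close>.\<close>
    have bound: "\<bar>(\<integral>t. indicator B t * F t \<partial>?G) - (\<integral>t. F t \<partial>?G) / W * measure ?G B\<bar>
        \<le> 2 * e + 2 * (W * ((7 / 8) ^ (2 * n) * L))" for n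
    proof -
      define r where "r = (7 / 8) ^ (2 * n) * L"
      define u where "u = (gauss_op ^^ (2 * n)) g"
      have u_lip: "r-lipschitz_on {0..1} u"
        unfolding r_def u_def by (rule gauss_op_funpow_lipschitz[OF g])
      have r: "0 \<le> r" using u_lip by (rule lipschitz_on_nonneg)
      have [measurable]: "u \<in> borel_measurable borel"
        unfolding u_def by (induction n) auto
      have ur: "\<bar>u t - u 0\<bar> \<le> r" if "t \<in> {0..1}" for t
      proof -
        have "\<bar>u t - u 0\<bar> \<le> r * \<bar>t - 0\<bar>"
          using lipschitz_onD[OF u_lip that, of 0] by (simp add: dist_real_def)
        also have "\<dots> \<le> r" using that r by (simp add: mult_left_le)
        finally show ?thesis .
      qed
      have ui: "integrable ?G u"
        using lipschitz_unit_bounded[OF u_lip] by (intro integrable_gauss_measure[where K="\<bar>u 0\<bar> + r"]) auto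
      have near: "\<bar>(\<integral>t. indicator C t * u t \<partial>?G) - u 0 * measure ?G C\<bar> \<le> W * r"
        if [measurable]: "C \<in> sets borel" for C
      proof -
        have i1: "integrable ?G (\<lambda>t. indicator C t * u t)"
          using ui by (rule Bochner_Integration.integrable_bound) (auto simp: indicator_def)
        have i2: "integrable ?G (\<lambda>t. u 0 * indicator C t)"
          by (intro integrable_gauss_measure[where K="\<bar>u 0\<bar>"]) (auto simp: indicator_def)
        have "(\<integral>t. indicator C t * u t \<partial>?G) - u 0 * measure ?G C =
            (\<integral>t. indicator C t * u t - u 0 * indicator C t \<partial>?G)"
          using i1 i2 by simp
        also have "\<bar>\<dots>\<bar> \<le> (\<integral>t. \<bar>indicator C t * u t - u 0 * indicator C t\<bar> \<partial>?G)"
          by (rule integral_abs_bound)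
        also have "\<dots> \<le> (\<integral>t. r \<partial>?G)"
        proof (rule integral_mono_AE)
          show "AE t in ?G. \<bar>indicator C t * u t - u 0 * indicator C t\<bar> \<le> r"
            using AE_gauss_measure
          proof eventually_elim
            fix t :: real assume "t \<in> {0<..<1}"
            then show "\<bar>indicator C t * u t - u 0 * indicator C t\<bar> \<le> r"
              using ur[of t] r by (auto simp: indicator_def)
          qed
        qed (use i1 i2 in auto)
        also have "\<dots> = W * r" by (simp add: W_def)
        finally show ?thesis .
      qed
      define IB where "IB = (\<integral>t. indicator B (?T n t) * g t \<partial>?G)"
      define I where "I = (\<integral>t. g t \<partial>?G)"
      have "IB = (\<integral>t. indicator B t * u t \<partial>?G)"
        unfolding IB_def u_def
        by (rule gauss_op_funpow_duality[where K=1, OF _ _ _ g]) (auto simp: indicator_def)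
      then have 1: "\<bar>IB - u 0 * measure ?G B\<bar> \<le> W * r" using near[OF B] by simp
      \<comment> \<open>Testing against 1 identifies the constant: \<open>u 0 * W\<close> is the
        integral of \<open>g\<close> up to \<open>W * r\<close>.\<close>
      have "I = (\<integral>t. (\<lambda>_. 1) (?T n t) * g t \<partial>?G)" unfolding I_def by simp
      also have "\<dots> = (\<integral>t. 1 * u t \<partial>?G)"
        unfolding u_def by (rule gauss_op_funpow_duality[where K=1, OF _ _ _ g]) auto
      finally have 2: "\<bar>I - u 0 * W\<bar> \<le> W * r" using near[of UNIV] by (simp add: W_def)
      have 2: "\<bar>u 0 * measure ?G B - I / W * measure ?G B\<bar> \<le> W * r"
      proof -
        have "u 0 * measure ?G B - I / W * measure ?G B = - ((I - u 0 * W) * (measure ?G B / W))"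
          using W by (simp add: field_simps)
        then have "\<bar>u 0 * measure ?G B - I / W * measure ?G B\<bar> = \<bar>I - u 0 * W\<bar> * (measure ?G B / W)"
          using W by (simp add: abs_mult)
        also have "\<dots> \<le> \<bar>I - u 0 * W\<bar> * 1" using W GB by (intro mult_left_mono) auto
        finally show ?thesis using 2 by simp
      qed
      have "(\<integral>t. F t \<partial>?G) - I = (\<integral>t. F t - g t \<partial>?G)" unfolding I_def using F gi by simp
      also have "\<bar>\<dots>\<bar> \<le> (\<integral>t. \<bar>F t - g t\<bar> \<partial>?G)" by (rule integral_abs_bound)
      finally have 3: "\<bar>(\<integral>t. F t \<partial>?G) - I\<bar> \<le> e" using ge by simp
      have 3: "\<bar>I / W * measure ?G B - (\<integral>t. F t \<partial>?G) / W * measure ?G B\<bar> \<le> e"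
      proof -
        have "I / W * measure ?G B - (\<integral>t. F t \<partial>?G) / W * measure ?G B =
            - (((\<integral>t. F t \<partial>?G) - I) * (measure ?G B / W))"
          using W by (simp add: field_simps)
        then have "\<bar>I / W * measure ?G B - (\<integral>t. F t \<partial>?G) / W * measure ?G B\<bar> =
            \<bar>(\<integral>t. F t \<partial>?G) - I\<bar> * (measure ?G B / W)"
          using W by (simp add: abs_mult)
        also have "\<dots> \<le> \<bar>(\<integral>t. F t \<partial>?G) - I\<bar> * 1" using W GB by (intro mult_left_mono) auto
        finally show ?thesis using 3 by simp
      qed
      have j1: "integrable ?G (\<lambda>t. indicator B (?T n t) * F t)"
        by (rule Bochner_Integration.integrable_bound[OF F]) (auto simp: indicator_def)
      have j2: "integrable ?G (\<lambda>t. indicator B (?T n t) * g t)"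
        by (rule Bochner_Integration.integrable_bound[OF gi]) (auto simp: indicator_def)
      have "(\<integral>t. indicator B t * F t \<partial>?G) - IB = (\<integral>t. indicator B (?T n t) * F t - indicator B (?T n t) * g t \<partial>?G)"
        unfolding IB_def invn[OF B, of n, symmetric] using j1 j2 by simp
      also have "\<bar>\<dots>\<bar> \<le> (\<integral>t. \<bar>indicator B (?T n t) * F t - indicator B (?T n t) * g t\<bar> \<partial>?G)"
        by (rule integral_abs_bound)
      also have "\<dots> \<le> (\<integral>t. \<bar>F t - g t\<bar> \<partial>?G)"
        using j1 j2 F gi by (intro integral_mono integrable_abs Bochner_Integration.integrable_diff) (auto simp: indicator_def)
      finally have 4: "\<bar>(\<integral>t. indicator B t * F t \<partial>?G) - IB\<bar> \<le> e" using ge by simp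
      have tri: "\<bar>a - f\<bar> \<le> 2 * e + 2 * x"
        if "\<bar>b - c\<bar> \<le> x" "\<bar>c - d\<bar> \<le> x" "\<bar>d - f\<bar> \<le> e" "\<bar>a - b\<bar> \<le> e" for a b c d f x :: real
        using that by linarith
      show ?thesis using tri[OF 1 2 3 4] by (simp only: r_def)
    qed
    have "(\<lambda>n. ((7 / 8 :: real) ^ 2) ^ n) \<longlonglongrightarrow> 0"
      by (rule LIMSEQ_realpow_zero) (auto simp: power2_eq_square)
    then have "(\<lambda>n. (7 / 8 :: real) ^ (2 * n)) \<longlonglongrightarrow> 0" by (simp only: power_mult)
    then have "(\<lambda>n. 2 * e + 2 * (W * ((7 / 8) ^ (2 * n) * L))) \<longlonglongrightarrow> 2 * e + 2 * (W * (0 * L))"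
      by (intro tendsto_intros)
    then show ?thesis
      by (intro LIMSEQ_le_const[where X="\<lambda>n. 2 * e + 2 * (W * ((7 / 8) ^ (2 * n) * L))"]) (use bound in auto)
  qed
  have "(\<integral>t. indicator B t * F t \<partial>?G) = (\<integral>t. F t \<partial>?G) / W * measure ?G B" if "B \<in> sets borel" for B
  proof -
    have "\<bar>(\<integral>t. indicator B t * F t \<partial>?G) - (\<integral>t. F t \<partial>?G) / W * measure ?G B\<bar> \<le> 0"
    proof (rule field_le_epsilon)
      fix e :: real assume "e > 0"
      then show "\<bar>(\<integral>t. indicator B t * F t \<partial>?G) - (\<integral>t. F t \<partial>?G) / W * measure ?G B\<bar> \<le> 0 + e"
        using main[OF that, of "e / 2"] by simp
    qed
    then show ?thesis by simp
  qed
  then show ?thesis by (rule that)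
qed

section \<open>The one-dimensional space of solutions and the extra frequency\<close>

text \<open>Integration by parts with \<open>1 - cos (a * s)\<close>, a nonnegative primitive of
  \<open>a * sin (a * s)\<close>: both the boundary term and the remaining integrand
  \<open>h\<close> are nonnegative. The factor \<open>a\<close> removes the dependence on the sign
  of the frequency, and uniformity in \<open>x\<close> lets the bound survive a limit.\<close>

lemma sine_integral_lower_bound:
  fixes a :: real
  assumes a: "a \<noteq> 0"
  obtains \<delta> where "\<delta> > 0"
    "\<And>x. 1 \<le> x \<Longrightarrow> \<delta> \<le> a * integral {0..x} (\<lambda>s. sin (a * s) / (1 + s))"
proof -
  define h where "h s = (1 - cos (a * s)) / (1 + s)\<^sup>2" for s
  have hc: "continuous_on {0..x} h" for x
    unfolding h_def by (intro continuous_intros) auto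
  have hi: "h integrable_on {0..x}" for x by (rule integrable_continuous_interval[OF hc])
  have h0: "0 \<le> h s" for s by (simp add: h_def)
  define \<delta> where "\<delta> = integral {0..1} h"
  have "\<delta> \<noteq> 0"
  proof
    assume "\<delta> = 0"
    then have "(h has_integral 0) (cbox 0 1)"
      using integrable_integral[OF hi[of 1]] by (simp add: \<delta>_def)
    \<comment> \<open>A point of \<open>(0, 1]\<close> with
      \<open>0 < \<bar>a\<bar> * s \<le> pi\<close>, where \<open>h\<close> is positive.\<close>
    moreover define s where "s = min 1 (pi / \<bar>a\<bar>)"
    have s: "0 < s" "s \<le> 1" "\<bar>a\<bar> * s \<le> pi" using a by (auto simp: s_def field_simps min_def)
    ultimately have "h s = 0"
      using has_integral_0_cbox_imp_0[of 0 1 h s] hc[of 1] h0 by auto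
    moreover have "cos (a * s) < 1"
    proof -
      have "cos (a * s) = cos (\<bar>a\<bar> * s)" by (cases "a < 0") auto
      also have "\<dots> < cos 0" using s a by (intro cos_monotone_0_pi) auto
      finally show ?thesis by simp
    qed
    ultimately show False using s by (simp add: h_def)
  qed
  moreover have "\<delta> \<ge> 0" unfolding \<delta>_def by (rule integral_nonneg[OF hi]) (simp add: h0)
  ultimately have "\<delta> > 0" by simp
  moreover have "\<delta> \<le> a * integral {0..x} (\<lambda>s. sin (a * s) / (1 + s))" if x: "1 \<le> x" for x
  proof -
    have "((\<lambda>s. a * (sin (a * s) / (1 + s)) - h s) has_integral
        ((1 - cos (a * x)) / (1 + x) - (1 - cos (a * 0)) / (1 + 0))) {0..x}"
    proof (rule fundamental_theorem_of_calculus)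
      fix s assume "s \<in> {0..x}"
      then have "((\<lambda>s. (1 - cos (a * s)) / (1 + s)) has_real_derivative (a * (sin (a * s) / (1 + s)) - h s)) (at s within {0..x})"
        unfolding h_def
        by (auto intro!: derivative_eq_intros simp: divide_simps power2_eq_square)
      then show "((\<lambda>s. (1 - cos (a * s)) / (1 + s)) has_vector_derivative (a * (sin (a * s) / (1 + s)) - h s)) (at s within {0..x})"
        by (simp add: has_real_derivative_iff_has_vector_derivative)
    qed (use x in simp)
    from has_integral_add[OF this integrable_integral[OF hi[of x]]]
    have "((\<lambda>s. a * (sin (a * s) / (1 + s))) has_integral ((1 - cos (a * x)) / (1 + x) + integral {0..x} h)) {0..x}"
      by simp
    then have "integral {0..x} (\<lambda>s. a * (sin (a * s) / (1 + s))) = (1 - cos (a * x)) / (1 + x) + integral {0..x} h"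
      by (rule integral_unique)
    moreover have "integral {0..x} (\<lambda>s. a * (sin (a * s) / (1 + s))) = a * integral {0..x} (\<lambda>s. sin (a * s) / (1 + s))"
      by (rule integral_mult_right)
    moreover have "0 \<le> (1 - cos (a * x)) / (1 + x)" using x by simp
    moreover have "\<delta> \<le> integral {0..x} h"
      unfolding \<delta>_def by (rule integral_subset_le) (use x hi h0 in auto)
    ultimately show ?thesis by linarith
  qed
  ultimately show ?thesis by (rule that)
qed

lemma norm_of_real_add_one: "0 \<le> t \<Longrightarrow> norm (1 + complex_of_real t) = 1 + t"
  by (metis abs_of_nonneg add_nonneg_nonneg norm_of_real of_real_1 of_real_add zero_le_one)

text \<open>Passage to the gauge integral, in which the substitutions for the kernel are carried
  out. Closing the interval adds only two points.\<close>

lemma integral_gauss_measure_henstock: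
  fixes f :: "real \<Rightarrow> complex"
  assumes [measurable]: "f \<in> borel_measurable borel" and f: "\<And>t. norm (f t) \<le> 1"
  shows "(\<lambda>t. f t / (1 + t)) integrable_on {0..1}"
    "(\<integral>t. f t \<partial>gauss_measure) = integral {0..1} (\<lambda>t. f t / (1 + t))"
proof -
  have i: "set_integrable lborel {0..1} (\<lambda>t. f t / (1 + t))"
    unfolding set_integrable_def
  proof (rule Bochner_Integration.integrable_bound[where f="indicat_real {0..1}"])
    show "AE t in lborel. norm (indicat_real {0..1} t *\<^sub>R (f t / (1 + t))) \<le> norm (indicat_real {0..1} t)"
    proof (rule AE_I2)
      fix t :: real
      have "norm (f t / (1 + t)) \<le> 1" if "t \<in> {0..1}"
        using f[of t] that by (simp add: norm_divide norm_of_real_add_one divide_le_eq)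
      then show "norm (indicat_real {0..1} t *\<^sub>R (f t / (1 + t))) \<le> norm (indicat_real {0..1} t)"
        by (auto simp: indicator_def)
    qed
  qed auto
  show "(\<lambda>t. f t / (1 + t)) integrable_on {0..1}"
    by (rule set_borel_integral_eq_integral(1)[OF i])
  have "(\<integral>t. f t \<partial>gauss_measure) = (\<integral>t. (indicator {0<..<1} t / (1 + t)) *\<^sub>R f t \<partial>lborel)"
    by (rule integral_gauss_measure) simp
  also have "\<dots> = (\<integral>t. indicator {0..1} t *\<^sub>R (f t / (1 + t)) \<partial>lborel)"
  proof (intro integral_cong_AE)
    show "AE t in lborel. (indicator {0<..<1} t / (1 + t)) *\<^sub>R f t = indicator {0..1} t *\<^sub>R (f t / (1 + t))"
      using AE_lborel_singleton[of 0] AE_lborel_singleton[of 1]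
      by eventually_elim (auto simp: indicator_def scaleR_conv_of_real)
  qed auto
  also have "\<dots> = integral {0..1} (\<lambda>t. f t / (1 + t))"
    using set_borel_integral_eq_integral(2)[OF i] by (simp add: set_lebesgue_integral_def)
  finally show "(\<integral>t. f t \<partial>gauss_measure) = integral {0..1} (\<lambda>t. f t / (1 + t))" .
qed

text \<open>After the substitution \<open>t \<mapsto> 1/t\<close> in the second exponential, the integral over
  \<open>(0, 1)\<close> becomes \<open>(1 - cis (2 * pi * \<omega>))\<close> times the improper integral of
  \<open>cis (2 * pi * \<omega> * s) / (1 + s)\<close> over \<open>(0, \<infinity>)\<close>, whose imaginary part does not vanish.\<close>

lemma gauss_kernel_nonzero:
  assumes \<omega>: "\<omega> \<notin> \<int>"
  shows "(\<integral>t. cis (2 * pi * (\<omega> * t)) - cis (2 * pi * (\<omega> / t)) \<partial>gauss_measure) \<noteq> 0"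
proof
  assume K0: "(\<integral>t. cis (2 * pi * (\<omega> * t)) - cis (2 * pi * (\<omega> / t)) \<partial>gauss_measure) = 0"
  define a where "a = 2 * pi * \<omega>"
  have "a \<noteq> 0" using \<omega> by (auto simp: a_def)
  have cisa: "cis a \<noteq> 1"
  proof
    assume "cis a = 1"
    then have "cos a = 1" by (simp add: complex_eq_iff)
    then obtain n :: int where "a = of_int n * (2 * pi)" using cos_one_2pi_int[of a] by auto
    then have "\<omega> = of_int n" by (simp add: a_def)
    then show False using \<omega> by simp
  qed
  define p where "p t = cis (a * t) / (1 + complex_of_real t)" for t
  define q where "q t = cis (a / t) / (1 + complex_of_real t)" for t
  have pm: "(\<lambda>t. cis (a * t)) \<in> borel_measurable borel" "(\<lambda>t. cis (a / t)) \<in> borel_measurable borel"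
    by measurable
  have p: "p integrable_on {0..1}" "(\<integral>t. cis (a * t) \<partial>gauss_measure) = integral {0..1} p"
    using integral_gauss_measure_henstock[OF pm(1)] by (simp_all add: p_def[abs_def])
  have q: "q integrable_on {0..1}" "(\<integral>t. cis (a / t) \<partial>gauss_measure) = integral {0..1} q"
    using integral_gauss_measure_henstock[OF pm(2)] by (simp_all add: q_def[abs_def])
  have "(\<integral>t. cis (a * t) - cis (a / t) \<partial>gauss_measure) = 0"
    using K0 by (simp add: a_def mult.assoc)
  then have pq: "integral {0..1} p - integral {0..1} q = 0"
    using p(2) q(2) pm by (subst (asm) Bochner_Integration.integral_diff) (auto intro!: integrable_gauss_measure[where K=1])
  \<comment> \<open>Truncations of the improper integral.\<close>
  define P where "P x = integral {0..x} p" for x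
  have pc: "continuous_on {u..v} p" if "0 \<le> u" for u v
    unfolding p_def using that
    by (intro continuous_intros) (auto simp: complex_eq_iff)
  have pi': "p integrable_on {u..v}" if "0 \<le> u" for u v
    by (rule integrable_continuous_interval[OF pc[OF that]])
  have pn: "norm (p t) \<le> 1 / (1 + u)" if "0 \<le> u" "u \<le> t" for u t
    using that by (simp add: p_def norm_divide norm_of_real_add_one frac_le)
  \<comment> \<open>With \<open>t = 1 / s\<close> the integrand becomes
    \<open>cis (a * s) / (s * (1 + s))\<close>. Partial fractions split it into
    \<open>cis (a * s) / s\<close>, which is \<open>cis a * p (s - 1)\<close>, minus
    \<open>p s\<close>.\<close>
  have inv: "integral {1 / x..1} q = cis a * P (x - 1) - (P x - P 1)" if x: "1 \<le> x" for x
  proof -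
    have qc: "continuous_on {1 / x..1} q"
      unfolding q_def
    proof (intro continuous_intros ballI)
      fix t assume "t \<in> {1 / x..1}"
      moreover have "0 < 1 / x" using x by simp
      ultimately have "0 < t" unfolding atLeastAtMost_iff by linarith
      then show "t \<noteq> 0" "1 + complex_of_real t \<noteq> 0" by (auto simp: complex_eq_iff)
    qed
    have "((\<lambda>t. (- (1 / t\<^sup>2)) *\<^sub>R q (1 / t)) has_integral
        (integral {1 / 1..1 / x} q - integral {1 / x..1 / 1} q)) {1..x}"
    proof (rule has_integral_substitution_general[where s="{}" and c="1 / x" and d=1])
      show "(\<lambda>t. 1 / t) ` {1..x} \<subseteq> {1 / x..1}" using x by (auto simp: divide_simps)
      show "continuous_on {1 / x..1} q" by (rule qc)
      show "continuous_on {1..x} (\<lambda>t::real. 1 / t)" by (intro continuous_intros) auto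
      show "((\<lambda>t. 1 / t) has_real_derivative - (1 / t\<^sup>2)) (at t within {1..x})" if "t \<in> {1..x} - {}" for t
        using that by (auto intro!: derivative_eq_intros simp: power2_eq_square)
    qed (use x in auto)
    \<comment> \<open>The oriented substitution rule carries both orders of the end points; for
      \<open>x \<ge> 1\<close> this interval is empty or a single point.\<close>
    moreover have "integral {1 / 1..1 / x} q = 0"
      using x by (cases "x = 1") auto
    ultimately have 1: "((\<lambda>t. (- (1 / t\<^sup>2)) *\<^sub>R q (1 / t)) has_integral (- integral {1 / x..1} q)) {1..x}"
      by simp
    have "((\<lambda>s. 1 *\<^sub>R (cis (a * (s - 1)) / complex_of_real s)) has_integral
        (integral {1 - 1..x - 1} p - integral {x - 1..1 - 1} p)) {1..x}"
    proof -
      have "((\<lambda>s. 1 *\<^sub>R p (s - 1)) has_integral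
        (integral {1 - 1..x - 1} p - integral {x - 1..1 - 1} p)) {1..x}"
      proof (rule has_integral_substitution_general[where s="{}" and c=0 and d="x - 1"])
        show "continuous_on {0..x - 1} p" by (rule pc) simp
        show "((\<lambda>s. s - 1) has_real_derivative 1) (at s within {1..x})" if "s \<in> {1..x} - {}" for s
          by (auto intro!: derivative_eq_intros)
      qed (use x in \<open>auto intro!: continuous_intros\<close>)
      then show ?thesis by (simp add: p_def)
    qed
    moreover have "integral {x - 1..1 - 1} p = 0" using x by (cases "x = 1") auto
    ultimately have 2: "((\<lambda>s. cis (a * (s - 1)) / complex_of_real s) has_integral P (x - 1)) {1..x}"
      by (simp add: P_def)
    have "P 1 + integral {1..x} p = P x"
      unfolding P_def using x by (intro Henstock_Kurzweil_Integration.integral_combine pi') auto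
    then have "integral {1..x} p = P x - P 1" by (simp add: algebra_simps)
    then have 3: "(p has_integral (P x - P 1)) {1..x}"
      using integrable_integral[OF pi', of 1 x] by simp
    have "((\<lambda>s. cis a * (cis (a * (s - 1)) / complex_of_real s) - p s) has_integral (cis a * P (x - 1) - (P x - P 1))) {1..x}"
      by (intro has_integral_diff has_integral_mult_right 2 3)
    then have "((\<lambda>t. - ((- (1 / t\<^sup>2)) *\<^sub>R q (1 / t))) has_integral (cis a * P (x - 1) - (P x - P 1))) {1..x}"
    proof (rule has_integral_eq[rotated])
      fix t assume "t \<in> {1..x}"
      then have t: "t \<ge> 1" by simp
      have c: "cis a * cis (a * (t - 1)) = cis (a * t)" by (simp add: cis_mult algebra_simps)
      have nz: "complex_of_real t \<noteq> 0" "1 + complex_of_real t \<noteq> 0"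
        using t by (auto simp: complex_eq_iff)
      have "cis a * (cis (a * (t - 1)) / complex_of_real t) - p t =
          cis (a * t) * (1 / complex_of_real t - 1 / (1 + complex_of_real t))"
        by (simp add: p_def c[symmetric] right_diff_distrib)
      also have "1 / complex_of_real t - 1 / (1 + complex_of_real t) =
          1 / (complex_of_real t)\<^sup>2 / (1 + 1 / complex_of_real t)"
        using nz by (simp add: divide_simps power2_eq_square) (simp add: algebra_simps)
      also have "cis (a * t) * \<dots> = - ((- (1 / t\<^sup>2)) *\<^sub>R q (1 / t))"
        by (simp add: q_def scaleR_conv_of_real)
      finally show "cis a * (cis (a * (t - 1)) / complex_of_real t) - p t = - ((- (1 / t\<^sup>2)) *\<^sub>R q (1 / t))" .
    qed
    from has_integral_unique[OF this has_integral_neg[OF 1]] show ?thesis by simp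
  qed
  \<comment> \<open>Equality of the integrals of \<open>p\<close> and \<open>q\<close> over the unit
    interval cancels all but an end piece of \<open>q\<close> and one increment of \<open>P\<close>.
    Both have norm at most \<open>1 / (n + 1)\<close>.\<close>
  have eq: "(1 - cis a) * P (real n + 1) =
      integral {0..1 / (real n + 1)} q - cis a * (P (real n + 1) - P (real n))" for n
  proof -
    have x: "1 \<le> real n + 1" by simp
    have "integral {0..1 / (real n + 1)} q + integral {1 / (real n + 1)..1} q = integral {0..1} q"
      by (rule Henstock_Kurzweil_Integration.integral_combine) (use q(1) in auto)
    then have "integral {0..1 / (real n + 1)} q = integral {0..1} q - integral {1 / (real n + 1)..1} q"
      by (simp add: algebra_simps)
    also have "integral {0..1} q = P 1" using pq by (simp add: P_def)
    finally show ?thesis unfolding inv[OF x] by (simp add: algebra_simps)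
  qed
  have small: "norm ((1 - cis a) * P (real n + 1)) \<le> 2 / (real n + 1)" for n
  proof -
    have "norm (integral {0..1 / (real n + 1)} q) \<le> 1 * measure lborel (cbox 0 (1 / (real n + 1)))"
    proof (rule has_integral_bound)
      have "q integrable_on {0..1 / (real n + 1)}"
        by (rule integrable_on_subinterval[OF q(1)]) auto
      then show "(q has_integral integral {0..1 / (real n + 1)} q) (cbox 0 (1 / (real n + 1)))"
        by (simp add: integrable_integral)
      show "norm (q t) \<le> 1" if "t \<in> cbox 0 (1 / (real n + 1))" for t
        using that by (simp add: q_def norm_divide norm_of_real_add_one)
    qed simp
    then have 1: "norm (integral {0..1 / (real n + 1)} q) \<le> 1 / (real n + 1)" by simp
    have "P (real n) + integral {real n..real n + 1} p = P (real n + 1)"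
      unfolding P_def by (intro Henstock_Kurzweil_Integration.integral_combine pi') auto
    then have "P (real n + 1) - P (real n) = integral {real n..real n + 1} p" by (simp add: algebra_simps)
    also have "norm \<dots> \<le> 1 / (1 + real n) * (real n + 1 - real n)"
      by (intro integral_bound pc pn) auto
    finally have 2: "norm (P (real n + 1) - P (real n)) \<le> 1 / (real n + 1)" by (simp add: add.commute)
    have "norm ((1 - cis a) * P (real n + 1)) \<le>
        norm (integral {0..1 / (real n + 1)} q) + norm (cis a * (P (real n + 1) - P (real n)))"
      unfolding eq by (rule norm_triangle_ineq4)
    then show ?thesis using 1 2 by (simp add: norm_mult)
  qed
  obtain \<delta> where \<delta>: "\<delta> > 0"
    "\<And>x. 1 \<le> x \<Longrightarrow> \<delta> \<le> a * integral {0..x} (\<lambda>s. sin (a * s) / (1 + s))"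
    using sine_integral_lower_bound[OF \<open>a \<noteq> 0\<close>] by blast
  have ImP: "Im (P x) = integral {0..x} (\<lambda>s. sin (a * s) / (1 + s))" for x
  proof -
    have "Im (P x) = integral {0..x} (Im \<circ> p)"
      unfolding P_def by (rule integral_linear[symmetric]) (auto intro: pi' bounded_linear_Im)
    also have "\<dots> = integral {0..x} (\<lambda>s. sin (a * s) / (1 + s))"
    proof (rule Henstock_Kurzweil_Integration.integral_cong)
      fix s :: real
      have "p s = cis (a * s) / complex_of_real (1 + s)" by (simp add: p_def)
      then show "(Im \<circ> p) s = sin (a * s) / (1 + s)" by (simp only: o_def Im_divide_of_real cis.sel)
    qed
    finally show ?thesis .
  qed
  \<comment> \<open>The sine bound keeps \<open>P\<close> away from 0, while the previous estimate
    forces \<open>(1 - cis a) * P\<close> to 0.\<close>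
  have "norm (1 - cis a) * \<delta> \<le> \<bar>a\<bar> * (2 / (real n + 1))" for n
  proof -
    have "\<delta> \<le> a * Im (P (real n + 1))" unfolding ImP by (rule \<delta>(2)) simp
    also have "\<dots> \<le> \<bar>a\<bar> * \<bar>Im (P (real n + 1))\<bar>" by (simp add: abs_mult[symmetric])
    also have "\<dots> \<le> \<bar>a\<bar> * norm (P (real n + 1))" by (intro mult_left_mono abs_Im_le_cmod) simp
    finally have "norm (1 - cis a) * \<delta> \<le> norm (1 - cis a) * (\<bar>a\<bar> * norm (P (real n + 1)))"
      by (rule mult_left_mono) simp
    also have "\<dots> = \<bar>a\<bar> * norm ((1 - cis a) * P (real n + 1))" by (simp add: norm_mult)
    also have "\<dots> \<le> \<bar>a\<bar> * (2 / (real n + 1))" by (intro mult_left_mono small) simp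
    finally show ?thesis .
  qed
  moreover have "(\<lambda>n. \<bar>a\<bar> * (2 / (real n + 1))) \<longlonglongrightarrow> 0"
  proof -
    have "(\<lambda>n. \<bar>a\<bar> * 2 * inverse (real (Suc n))) \<longlonglongrightarrow> \<bar>a\<bar> * 2 * 0"
      by (intro tendsto_mult_left LIMSEQ_inverse_real_of_nat)
    then show ?thesis by (simp add: divide_inverse add.commute mult.assoc)
  qed
  ultimately have "norm (1 - cis a) * \<delta> \<le> 0"
    by (intro LIMSEQ_le_const) auto
  then show False using \<delta>(1) cisa by (simp add: mult_le_0_iff)
qed

section \<open>From the two periodization conditions to a one-parameter family\<close>

lemma integral_gauss_map:
  fixes \<phi> :: "real \<Rightarrow> complex"
  assumes [measurable]: "\<phi> \<in> borel_measurable borel" and \<phi>: "\<And>t. norm (\<phi> t) \<le> K"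
  shows "(\<integral>t. \<phi> (gauss_map t) \<partial>gauss_measure) = (\<integral>t. \<phi> t \<partial>gauss_measure)"
proof -
  have real: "(\<integral>t. \<psi> (gauss_map t) \<partial>gauss_measure) = (\<integral>t. \<psi> t \<partial>gauss_measure)"
    if [measurable]: "\<psi> \<in> borel_measurable borel" and "\<And>t. \<bar>\<psi> t\<bar> \<le> K" for \<psi> :: "real \<Rightarrow> real"
  proof -
    \<comment> \<open>Duality with the constant 1, which \<open>gauss_op\<close> fixes.\<close>
    have "(\<integral>t. \<psi> (gauss_map t) * (\<lambda>_. 1) t \<partial>gauss_measure) =
        (\<integral>s. \<psi> s * gauss_op (\<lambda>_. 1) s \<partial>gauss_measure)"
      using that by (intro gauss_op_duality[where C=1]) auto
    also have "\<dots> = (\<integral>s. \<psi> s \<partial>gauss_measure)"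
    proof (intro integral_cong_AE)
      show "AE s in gauss_measure. \<psi> s * gauss_op (\<lambda>_. 1) s = \<psi> s"
        using AE_gauss_measure
        by eventually_elim (auto simp: gauss_op_def sums_unique[OF gauss_weight_sums, symmetric])
    qed auto
    finally show ?thesis by simp
  qed
  have i: "integrable gauss_measure \<phi>" "integrable gauss_measure (\<lambda>t. \<phi> (gauss_map t))"
    using \<phi> by (auto intro!: integrable_gauss_measure[where K=K])
  have "Re (\<integral>t. \<phi> (gauss_map t) \<partial>gauss_measure) = Re (\<integral>t. \<phi> t \<partial>gauss_measure)"
    unfolding integral_Re[OF i(1), symmetric] integral_Re[OF i(2), symmetric]
    by (rule real) (auto intro: order_trans[OF abs_Re_le_cmod \<phi>])
  moreover have "Im (\<integral>t. \<phi> (gauss_map t) \<partial>gauss_measure) = Im (\<integral>t. \<phi> t \<partial>gauss_measure)"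
    unfolding integral_Im[OF i(1), symmetric] integral_Im[OF i(2), symmetric]
    by (rule real) (auto intro: order_trans[OF abs_Im_le_cmod \<phi>])
  ultimately show ?thesis by (rule complex_eqI)
qed

text \<open>The two periodization conditions exchange the parts of \<open>F\<close> on \<open>(0, 1)\<close> and
  \<open>(1, \<infinity>)\<close>, up to sign and the inversion \<open>t \<mapsto> 1/t\<close>, by the Gauss map. So the part on
  \<open>(0, 1)\<close> is invariant under two steps of the Gauss map.\<close>

lemma vanishing_coeffs_reciprocal:
  fixes F :: "real \<Rightarrow> complex"
  assumes V1: "vanishing_coeffs lborel (\<lambda>t. t) F" and V2: "vanishing_coeffs lborel (\<lambda>t. 1 / t) F"
    and pos: "\<And>t. t \<le> 0 \<Longrightarrow> F t = 0"
  obtains c where "\<And>\<phi> K. \<phi> \<in> borel_measurable borel \<Longrightarrow> (\<And>t. norm (\<phi> t :: complex) \<le> K) \<Longrightarrow>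
    (\<integral>t. \<phi> t * F t \<partial>lborel) = c * (\<integral>t. \<phi> t - \<phi> (1 / t) \<partial>gauss_measure)"
proof -
  have int: "integrable lborel F" using V1 by (simp add: vanishing_coeffs_def)
  have [measurable]: "F \<in> borel_measurable borel" using int by (auto dest: borel_measurable_integrable)
  \<comment> \<open>On \<open>(0, 1)\<close>, \<open>H\<close> is the density of \<open>F dt\<close>
    relative to \<open>gauss_measure\<close>.\<close>
  define H where "H t = (1 + complex_of_real t) * F t" for t
  define F1 where "F1 t = indicator {1<..} t * F t" for t
  have [measurable]: "H \<in> borel_measurable borel" "F1 \<in> borel_measurable borel"
    unfolding H_def F1_def by measurable
  have Hi: "integrable gauss_measure H"
  proof -
    have "integrable lborel (\<lambda>t. (indicator {0<..<1} t / (1 + t)) *\<^sub>R H t)"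
    proof (rule Bochner_Integration.integrable_bound[OF int])
      show "AE t in lborel. norm ((indicator {0<..<1} t / (1 + t)) *\<^sub>R H t) \<le> norm (F t)"
        by (rule AE_I2) (auto simp: indicator_def H_def norm_mult norm_of_real_add_one)
    qed measurable
    then show ?thesis unfolding gauss_measure_def
      by (subst integrable_density) (auto simp: indicator_def)
  qed
  have F1i: "integrable lborel F1"
    by (rule Bochner_Integration.integrable_bound[OF int]) (auto simp: F1_def indicator_def)
  have mult_i: "integrable M (\<lambda>t. \<phi> t * f t)"
    if "integrable M f" "\<phi> \<in> borel_measurable M" "\<And>t. norm (\<phi> t) \<le> K" for M :: "real measure" and \<phi> f :: "real \<Rightarrow> complex" and K
  proof (rule Bochner_Integration.integrable_bound[where f="\<lambda>t. K * norm (f t)"])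
    have K: "0 \<le> K" using that(3)[of 0] norm_ge_zero order_trans by blast
    show "AE t in M. norm (\<phi> t * f t) \<le> norm (K * norm (f t))"
      using that(3) K by (intro AE_I2) (auto simp: norm_mult intro: mult_right_mono)
  qed (use that in \<open>auto dest: borel_measurable_integrable\<close>)
  have split: "(\<integral>t. \<phi> t * F t \<partial>lborel) = (\<integral>t. \<phi> t * H t \<partial>gauss_measure) + (\<integral>t. \<phi> t * F1 t \<partial>lborel)"
    if [measurable]: "\<phi> \<in> borel_measurable borel" and K: "\<And>t. norm (\<phi> t) \<le> K" for \<phi> K
  proof -
    define F0 where "F0 t = indicator {0<..<1} t * F t" for t
    have [measurable]: "F0 \<in> borel_measurable borel" unfolding F0_def by measurable
    have F0i: "integrable lborel F0"
      by (rule Bochner_Integration.integrable_bound[OF int]) (auto simp: F0_def indicator_def)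
    have "(\<integral>t. \<phi> t * H t \<partial>gauss_measure) = (\<integral>t. (indicator {0<..<1} t / (1 + t)) *\<^sub>R (\<phi> t * H t) \<partial>lborel)"
      by (rule integral_gauss_measure) simp
    also have "\<dots> = (\<integral>t. \<phi> t * F0 t \<partial>lborel)"
    proof (rule Bochner_Integration.integral_cong)
      fix t :: real
      show "(indicator {0<..<1} t / (1 + t)) *\<^sub>R (\<phi> t * H t) = \<phi> t * F0 t"
      proof (cases "t \<in> {0<..<1}")
        case True
        then have "1 + complex_of_real t \<noteq> 0" by (auto simp: complex_eq_iff)
        then show ?thesis using True by (simp add: H_def F0_def scaleR_conv_of_real)
      qed (simp add: F0_def)
    qed simp
    finally have "(\<integral>t. \<phi> t * H t \<partial>gauss_measure) + (\<integral>t. \<phi> t * F1 t \<partial>lborel) =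
        (\<integral>t. \<phi> t * F0 t + \<phi> t * F1 t \<partial>lborel)"
      using mult_i[OF F0i _ K] mult_i[OF F1i _ K] by simp
    also have "\<dots> = (\<integral>t. \<phi> t * F t \<partial>lborel)"
    proof (rule integral_cong_AE)
      show "AE t in lborel. \<phi> t * F0 t + \<phi> t * F1 t = \<phi> t * F t"
        using AE_lborel_singleton[of 1]
        by eventually_elim (use pos in \<open>auto simp: F0_def F1_def indicator_def not_less\<close>)
    qed auto
    finally show ?thesis ..
  qed
  \<comment> \<open>On \<open>(0, 1)\<close> the map \<open>frac\<close> is the identity, so only
    the outer part is folded.\<close>
  have eq1: "(\<integral>t. \<phi> t * H t \<partial>gauss_measure) = - (\<integral>t. \<phi> (frac t) * F1 t \<partial>lborel)"
    if [measurable]: "\<phi> \<in> borel_measurable borel" and K: "\<And>t. norm (\<phi> t) \<le> K" for \<phi> K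
  proof -
    have "(\<integral>t. \<phi> (frac t) * F t \<partial>lborel) = 0"
      by (rule integral_compose_bounded_zero[OF int _ _ _ K, where N=borel])
         (auto intro: vanishing_coeffs_frac[OF V1])
    moreover have "(\<integral>t. \<phi> (frac t) * H t \<partial>gauss_measure) = (\<integral>t. \<phi> t * H t \<partial>gauss_measure)"
    proof (rule integral_cong_AE)
      show "AE t in gauss_measure. \<phi> (frac t) * H t = \<phi> t * H t"
        using AE_gauss_measure by eventually_elim (simp add: frac_eq)
    qed auto
    ultimately show ?thesis using split[of "\<lambda>t. \<phi> (frac t)" K] K by (simp add: eq_neg_iff_add_eq_0)
  qed
  \<comment> \<open>Here the outer part is merely inverted, as \<open>1 / t < 1\<close>, and the
    inner part is moved by the Gauss map.\<close>
  have eq2: "(\<integral>t. \<phi> (1 / t) * F1 t \<partial>lborel) = - (\<integral>t. \<phi> (gauss_map t) * H t \<partial>gauss_measure)"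
    if [measurable]: "\<phi> \<in> borel_measurable borel" and K: "\<And>t. norm (\<phi> t) \<le> K" for \<phi> K
  proof -
    have "(\<integral>t. \<phi> (frac (1 / t)) * F t \<partial>lborel) = 0"
      by (rule integral_compose_bounded_zero[OF int _ _ _ K, where N=borel])
         (auto intro: vanishing_coeffs_frac[OF V2])
    moreover have "(\<integral>t. \<phi> (frac (1 / t)) * F1 t \<partial>lborel) = (\<integral>t. \<phi> (1 / t) * F1 t \<partial>lborel)"
    proof (rule Bochner_Integration.integral_cong)
      fix t :: real
      show "\<phi> (frac (1 / t)) * F1 t = \<phi> (1 / t) * F1 t"
        by (cases "t > 1") (auto simp: F1_def frac_eq)
    qed simp
    ultimately show ?thesis using split[of "\<lambda>t. \<phi> (frac (1 / t))" K] K
      by (simp add: eq_neg_iff_add_eq_0 gauss_map_def add.commute)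
  qed
  \<comment> \<open>Since \<open>gauss_map (1 / t) = frac t\<close>, testing \<open>eq2\<close> with
    \<open>\<phi> (gauss_map t)\<close> produces the right-hand side of \<open>eq1\<close>.\<close>
  have inv: "(\<integral>t. \<phi> (gauss_map (gauss_map t)) * H t \<partial>gauss_measure) = (\<integral>t. \<phi> t * H t \<partial>gauss_measure)"
    if [measurable]: "\<phi> \<in> borel_measurable borel" and K: "\<And>t. norm (\<phi> t) \<le> K" for \<phi> K
    using eq2[of "\<lambda>t. \<phi> (gauss_map t)" K] eq1[of \<phi> K] K by (simp add: gauss_map_def)
  have H_ind: "integrable gauss_measure (\<lambda>t. indicator B t * H t)"
    "integrable gauss_measure (\<lambda>t. indicator B (gauss_map (gauss_map t)) * H t)" if [measurable]: "B \<in> sets borel" for B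
    by (rule mult_i[OF Hi, where K=1]; auto simp: indicator_def)+
  have inv_ind: "(\<integral>t. indicator B (gauss_map (gauss_map t)) * H t \<partial>gauss_measure) = (\<integral>t. indicator B t * H t \<partial>gauss_measure)"
    if [measurable]: "B \<in> sets borel" for B
    by (rule inv[where K=1]) (auto simp: indicator_def)
  \<comment> \<open>The classification of invariant densities is real, so it is applied to
    \<open>Re\<close> and \<open>Im\<close> of \<open>H\<close>.\<close>
  have part: "\<exists>c. \<forall>B\<in>sets borel. h (\<integral>t. indicator B t * H t \<partial>gauss_measure) = c * measure gauss_measure B"
    if h: "bounded_linear h" "\<And>r z. h (of_real r * z) = r * h z" for h :: "complex \<Rightarrow> real"
  proof -
    have pull: "(\<integral>t. indicator B (X t) * h (H t) \<partial>gauss_measure) = h (\<integral>t. indicator B (X t) * H t \<partial>gauss_measure)"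
      if "integrable gauss_measure (\<lambda>t. indicator B (X t) * H t)" for B and X :: "real \<Rightarrow> real"
    proof -
      have "indicator B (X t) * h (H t) = h (indicator B (X t) * H t)" for t
        using h(2)[of "indicator B (X t)" "H t"] by (simp add: of_real_indicator)
      then show ?thesis using integral_bounded_linear[OF h(1) that] by simp
    qed
    have "integrable gauss_measure (\<lambda>t. h (H t))" by (rule integrable_bounded_linear[OF h(1) Hi])
    then obtain c where "\<And>B. B \<in> sets borel \<Longrightarrow>
        (\<integral>t. indicator B t * h (H t) \<partial>gauss_measure) = c * measure gauss_measure B"
    proof (rule gauss_map_invariant_density)
      fix B :: "real set" assume B: "B \<in> sets borel"
      show "(\<integral>t. indicator B (gauss_map (gauss_map t)) * h (H t) \<partial>gauss_measure) =
          (\<integral>t. indicator B t * h (H t) \<partial>gauss_measure)"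
        using pull[OF H_ind(1)[OF B]] pull[OF H_ind(2)[OF B]] inv_ind[OF B] by simp
    qed blast
    then show ?thesis using pull[OF H_ind(1)] by (intro exI[of _ c]) auto
  qed
  obtain c1 where c1: "\<And>B. B \<in> sets borel \<Longrightarrow> Re (\<integral>t. indicator B t * H t \<partial>gauss_measure) = c1 * measure gauss_measure B"
    using part[OF bounded_linear_Re] by auto
  obtain c2 where c2: "\<And>B. B \<in> sets borel \<Longrightarrow> Im (\<integral>t. indicator B t * H t \<partial>gauss_measure) = c2 * measure gauss_measure B"
    using part[OF bounded_linear_Im] by auto
  define c where "c = Complex c1 c2"
  have Hc: "(\<integral>t. \<phi> t * H t \<partial>gauss_measure) = c * (\<integral>t. \<phi> t \<partial>gauss_measure)"
    if [measurable]: "\<phi> \<in> borel_measurable borel" and K: "\<And>t. norm (\<phi> t) \<le> K" for \<phi> K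
  proof -
    have ci: "integrable gauss_measure (\<lambda>_. c)" by simp
    have "(\<integral>t. \<phi> t * (H t - c) \<partial>gauss_measure) = 0"
    proof (rule integral_compose_bounded_zero[where X="\<lambda>t. t" and N=borel, OF _ _ _ _ K])
      show "integrable gauss_measure (\<lambda>t. H t - c)" using Hi ci by simp
      fix B :: "real set" assume B [measurable]: "B \<in> sets borel"
      have e: "(\<integral>t. indicator B t * H t \<partial>gauss_measure) = c * measure gauss_measure B"
        using c1[OF B] c2[OF B] by (simp add: complex_eq_iff c_def)
      have "(\<integral>t. indicator B t * (H t - c) \<partial>gauss_measure) =
          (\<integral>t. indicator B t * H t \<partial>gauss_measure) - (\<integral>t. indicator B t * c \<partial>gauss_measure)"
        unfolding right_diff_distrib
        by (rule Bochner_Integration.integral_diff[OF H_ind(1)[OF B]])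
           (intro mult_i[where K=1] ci, auto simp: indicator_def)
      also have "(\<integral>t. indicator B t * c \<partial>gauss_measure) = c * (\<integral>t. complex_of_real (indicat_real B t) \<partial>gauss_measure)"
        by (simp add: mult.commute of_real_indicator)
      also have "\<dots> = c * measure gauss_measure B"
        by (subst integral_complex_of_real) simp
      finally show "(\<integral>t. indicator B t * (H t - c) \<partial>gauss_measure) = 0" using e by simp
    qed auto
    moreover have "(\<integral>t. \<phi> t * (H t - c) \<partial>gauss_measure) =
        (\<integral>t. \<phi> t * H t \<partial>gauss_measure) - (\<integral>t. \<phi> t * c \<partial>gauss_measure)"
      unfolding right_diff_distrib
      by (intro Bochner_Integration.integral_diff mult_i[OF Hi _ K] mult_i[OF ci _ K]) auto
    ultimately show ?thesis by (simp add: mult.commute)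
  qed
  \<comment> \<open>\<open>eq2\<close> tested with \<open>\<phi> (1 / t)\<close> expresses the outer
    part through \<open>H\<close>, which now acts as the constant \<open>c\<close>; invariance of
    the measure then removes the Gauss map.\<close>
  have "(\<integral>t. \<phi> t * F t \<partial>lborel) = c * (\<integral>t. \<phi> t - \<phi> (1 / t) \<partial>gauss_measure)"
    if [measurable]: "\<phi> \<in> borel_measurable borel" and K: "\<And>t. norm (\<phi> t :: complex) \<le> K" for \<phi> K
  proof -
    have i: "integrable gauss_measure \<phi>" "integrable gauss_measure (\<lambda>t. \<phi> (1 / t))"
      using K by (auto intro!: integrable_gauss_measure[where K=K])
    have "(\<integral>t. \<phi> t * F1 t \<partial>lborel) = - (\<integral>t. \<phi> (1 / gauss_map t) * H t \<partial>gauss_measure)"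
      using eq2[of "\<lambda>t. \<phi> (1 / t)" K] K by simp
    also have "\<dots> = - (c * (\<integral>t. \<phi> (1 / gauss_map t) \<partial>gauss_measure))"
      using Hc[of "\<lambda>t. \<phi> (1 / gauss_map t)" K] K by simp
    also have "(\<integral>t. \<phi> (1 / gauss_map t) \<partial>gauss_measure) = (\<integral>t. \<phi> (1 / t) \<partial>gauss_measure)"
      using integral_gauss_map[of "\<lambda>t. \<phi> (1 / t)" K] K by simp
    finally show ?thesis
      using split[of \<phi> K] Hc[of \<phi> K] K i by (simp add: right_diff_distrib)
  qed
  then show ?thesis by (rule that)
qed

text \<open>An extra frequency on either axis gives the same kernel integral up to sign, since
  \<open>t \<mapsto> 1 / t\<close> exchanges the two exponentials. The conclusion stays in tested
  form because it will be applied to indicators along the hyperbola.\<close>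

lemma exponentials_reciprocal_unique:
  fixes F :: "real \<Rightarrow> complex"
  assumes V: "vanishing_coeffs lborel (\<lambda>t. t) F" "vanishing_coeffs lborel (\<lambda>t. 1 / t) F"
    and pos: "\<And>t. t \<le> 0 \<Longrightarrow> F t = 0"
    and \<omega>: "\<omega> \<notin> \<int>"
    and extra: "(\<integral>t. cis (2 * pi * (\<omega> * t)) * F t \<partial>lborel) = 0 \<or>
      (\<integral>t. cis (2 * pi * (\<omega> / t)) * F t \<partial>lborel) = 0"
    and \<phi>: "\<phi> \<in> borel_measurable borel" "\<And>t. norm (\<phi> t :: complex) \<le> K"
  shows "(\<integral>t. \<phi> t * F t \<partial>lborel) = 0"
proof -
  obtain c where c: "\<And>\<phi> K. \<phi> \<in> borel_measurable borel \<Longrightarrow> (\<And>t. norm (\<phi> t :: complex) \<le> K) \<Longrightarrow>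
    (\<integral>t. \<phi> t * F t \<partial>lborel) = c * (\<integral>t. \<phi> t - \<phi> (1 / t) \<partial>gauss_measure)"
    using vanishing_coeffs_reciprocal[OF V pos] by blast
  define k where "k = (\<integral>t. cis (2 * pi * (\<omega> * t)) - cis (2 * pi * (\<omega> / t)) \<partial>gauss_measure)"
  have "k \<noteq> 0" unfolding k_def by (rule gauss_kernel_nonzero[OF \<omega>])
  have "(\<integral>t. cis (2 * pi * (\<omega> * t)) * F t \<partial>lborel) = c * k"
    using c[of "\<lambda>t. cis (2 * pi * (\<omega> * t))" 1] by (simp add: k_def)
  moreover have "(\<integral>t. cis (2 * pi * (\<omega> / t)) * F t \<partial>lborel) = c * (- k)"
  proof -
    have "(\<integral>t. cis (2 * pi * (\<omega> / t)) * F t \<partial>lborel) =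
        c * (\<integral>t. - (cis (2 * pi * (\<omega> * t)) - cis (2 * pi * (\<omega> / t))) \<partial>gauss_measure)"
      using c[of "\<lambda>t. cis (2 * pi * (\<omega> / t))" 1] by simp
    also have "\<dots> = c * (- k)" unfolding k_def by (subst integral_minus) simp
    finally show ?thesis .
  qed
  ultimately have "c = 0" using extra \<open>k \<noteq> 0\<close> by auto
  then show ?thesis using c[OF \<phi>] by simp
qed

section \<open>Measures on the hyperbola branch\<close>

lemma finite_union_hyperbola_branch:
  assumes M: "0 < M"
  shows "finite_union_of_smooth_curves (hyperbola_branch M)"
proof -
  define c where "c = M\<^sup>2 / (4 * pi\<^sup>2)"
  have c: "c > 0" using M by (simp add: c_def)
  define \<gamma> where "\<gamma> t = (t, c / t)" for t :: real
  \<comment> \<open>\<open>D k\<close> is the \<open>k\<close>-th derivative of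
    \<open>\<gamma>\<close>; smoothness asks for the whole sequence.\<close>
  define D where "D k t = ((if k = 0 then t else if k = 1 then 1 else 0), c * (- 1) ^ k * fact k / t ^ (k + 1))"
    for k :: nat and t :: real
  have D0: "D 0 = \<gamma>" by (simp add: D_def \<gamma>_def fun_eq_iff)
  have Dd: "(D k has_vector_derivative D (Suc k) t) (at t)" if t: "t \<in> {0<..}" for k t
  proof -
    have "((\<lambda>t. if k = 0 then t else if k = 1 then 1 else 0) has_real_derivative (if Suc k = 0 then t else if Suc k = 1 then 1 else 0)) (at t)"
      by (auto intro!: derivative_eq_intros)
    moreover have "((\<lambda>t. c * (- 1) ^ k * fact k / t ^ (k + 1)) has_real_derivative
        c * (- 1) ^ Suc k * fact (Suc k) / t ^ (Suc k + 1)) (at t)"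
    proof -
      have "((\<lambda>t. c * (- 1) ^ k * fact k / t ^ (k + 1)) has_real_derivative
          - (c * (- 1) ^ k * fact k * (real (k + 1) * t ^ k)) / (t ^ (k + 1) * t ^ (k + 1))) (at t)"
        using DERIV_divide[OF DERIV_const[of "c * (- 1) ^ k * fact k"] DERIV_pow[of "k + 1" t]] t by simp
      also have "- (c * (- 1) ^ k * fact k * (real (k + 1) * t ^ k)) / (t ^ (k + 1) * t ^ (k + 1)) =
          c * (- 1) ^ Suc k * fact (Suc k) / t ^ (Suc k + 1)"
        using t by (simp add: divide_simps)
      finally show ?thesis .
    qed
    ultimately show ?thesis unfolding D_def
      by (intro has_vector_derivative_Pair) (simp_all only: has_real_derivative_iff_has_vector_derivative)
  qed
  have "smooth_curve {0<..} \<gamma>" unfolding smooth_curve_def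
  proof (intro conjI ballI)
    have "interior {0::real<..} = {0<..}" by (intro interior_open open_greaterThan)
    then show "interior {0::real<..} \<noteq> {}" by simp
    show "inj_on \<gamma> {0<..}" by (auto simp: inj_on_def \<gamma>_def)
    show "\<exists>U. {0<..} \<subseteq> U \<and> smooth_on_open U \<gamma>"
      unfolding smooth_on_open_def using D0 Dd by (intro exI[of _ "{0<..}"]) auto
    fix t :: real assume t: "t \<in> {0<..}"
    have "vector_derivative \<gamma> (at t) = D (Suc 0) t"
      using Dd[OF t, of 0] unfolding D0 by (rule vector_derivative_at)
    then show "vector_derivative \<gamma> (at t) \<noteq> 0" by (simp add: D_def zero_prod_def)
  qed (auto simp: is_interval_1)
  moreover have "hyperbola_branch M = \<gamma> ` {0<..}"
  proof (intro equalityI subsetI)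
    fix x assume "x \<in> hyperbola_branch M"
    then have x: "fst x * snd x = c" "fst x > 0" by (auto simp: hyperbola_branch_def c_def)
    then have "x = \<gamma> (fst x)" by (simp add: \<gamma>_def prod_eq_iff field_simps)
    then show "x \<in> \<gamma> ` {0<..}" using x by blast
  qed (auto simp: \<gamma>_def hyperbola_branch_def c_def)
  ultimately have "is_arc_length_measure (hyperbola_branch M) (\<lambda>A. \<Sum>i<1::nat. arc_length {0<..} \<gamma> A)"
    unfolding is_arc_length_measure_def
    by (intro exI[of _ "1::nat"] exI[of _ "\<lambda>_. {0<..}"] exI[of _ "\<lambda>_. \<gamma>"])
       (auto simp: disjoint_family_on_def)
  then show ?thesis unfolding finite_union_of_smooth_curves_def by blast
qed

section \<open>Null sets of the first coordinate and arc length\<close>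

lemma null_set_of_nonzero_derivative:
  fixes u u' :: "real \<Rightarrow> real"
  assumes S: "S \<in> sets borel" and der: "\<And>t. t \<in> S \<Longrightarrow> (u has_real_derivative u' t) (at t)"
    and nz: "\<And>t. t \<in> S \<Longrightarrow> u' t \<noteq> 0" and inj: "inj_on u S" and null: "negligible (u ` S)"
  shows "AE t in lborel. t \<notin> S"
proof -
  have Sl: "S \<in> sets lebesgue" using S by simp
  \<comment> \<open>Change of variables: the integral of \<open>\<bar>u' t\<bar>\<close> over
    \<open>S\<close> is the measure of the image of \<open>S\<close>, which is 0, while the
    integrand is positive on \<open>S\<close>.\<close>
  have "(\<lambda>t. \<bar>u' t\<bar> * 1) absolutely_integrable_on S \<and> integral S (\<lambda>t. \<bar>u' t\<bar> * 1) = 0"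
  proof (subst has_absolute_integral_change_of_variables_1'[OF Sl _ inj, where f="\<lambda>_. 1"])
    show "(u has_real_derivative u' t) (at t within S)" if "t \<in> S" for t
      using der[OF that] by (rule has_field_derivative_at_within)
    show "(\<lambda>_. 1::real) absolutely_integrable_on u ` S \<and> integral (u ` S) (\<lambda>_. 1::real) = 0"
      using absolutely_integrable_negligible[OF null] integral_unique[OF has_integral_negligible[OF null]] by auto
  qed
  then have i: "set_integrable lebesgue S (\<lambda>t. \<bar>u' t\<bar>)" and z: "integral S (\<lambda>t. \<bar>u' t\<bar>) = 0" by auto
  have "(\<integral>t. indicator S t *\<^sub>R \<bar>u' t\<bar> \<partial>lebesgue) = 0"
    using set_lebesgue_integral_eq_integral(2)[OF i] z by (simp add: set_lebesgue_integral_def)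
  then have "AE t in lebesgue. indicator S t *\<^sub>R \<bar>u' t\<bar> = 0"
    using i unfolding set_integrable_def
    by (subst (asm) integral_nonneg_eq_0_iff_AE) (auto simp: indicator_def)
  then have "AE t in lebesgue. t \<notin> S"
    by eventually_elim (use nz in \<open>auto simp: indicator_def split: if_splits\<close>)
  then show ?thesis by (simp add: AE_completion_iff)
qed

text \<open>The arc length measure may come from any parametrization, so the piece of curve is
  arbitrary. Along it the second coordinate is \<open>c / u t\<close>; where the first coordinate
  had derivative 0, the velocity would vanish, against regularity.\<close>

lemma arc_length_fst_null:
  assumes curve: "smooth_curve I \<gamma>" and sub: "\<gamma> ` I \<subseteq> hyperbola_branch M"
    and N: "N \<in> null_sets lborel"
  shows "arc_length I \<gamma> {x. fst x \<in> N} = 0"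
proof -
  define c where "c = M\<^sup>2 / (4 * pi\<^sup>2)"
  obtain U D where U: "I \<subseteq> U" "open U" and D0: "D (0::nat) = \<gamma>"
    and D: "\<And>k t. t \<in> U \<Longrightarrow> (D k has_vector_derivative D (Suc k) t) (at t)"
    using curve unfolding smooth_curve_def smooth_on_open_def by blast
  define u where "u t = fst (\<gamma> t)" for t
  define v where "v t = vector_derivative \<gamma> (at t)" for t
  \<comment> \<open>Beyond \<open>I\<close> the curve may leave the hyperbola, so the two
    derivatives are compared at interior points only; the end points are negligible.\<close>
  define J where "J = interior I"
  have JI: "J \<subseteq> I" by (simp add: J_def interior_subset)
  have der: "(\<gamma> has_vector_derivative v t) (at t)" if "t \<in> I" for t
    using D[of t 0] that U vector_derivative_at[of \<gamma> "D (Suc 0) t" t] by (auto simp: D0 v_def)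
  have uder: "(u has_real_derivative fst (v t)) (at t)" if "t \<in> I" for t
    unfolding u_def has_real_derivative_iff_has_vector_derivative
    by (rule bounded_linear.has_vector_derivative[OF bounded_linear_fst der[OF that]])
  have wder: "((\<lambda>t. snd (\<gamma> t)) has_real_derivative snd (v t)) (at t)" if "t \<in> I" for t
    unfolding has_real_derivative_iff_has_vector_derivative
    by (rule bounded_linear.has_vector_derivative[OF bounded_linear_snd der[OF that]])
  have hyp: "u t > 0" "snd (\<gamma> t) = c / u t" if "t \<in> I" for t
    using sub that by (auto simp: hyperbola_branch_def u_def c_def field_simps image_subset_iff)
  have nz: "fst (v t) \<noteq> 0" if t: "t \<in> J" for t
  proof
    assume z: "fst (v t) = 0"
    have tI: "t \<in> I" using t JI by auto
    have "((\<lambda>s. c / u s) has_real_derivative 0) (at t)"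
      using uder[OF tI] hyp(1)[OF tI] z by (auto intro!: derivative_eq_intros)
    then have "((\<lambda>s. snd (\<gamma> s)) has_real_derivative 0) (at t)"
      by (rule has_field_derivative_transform_within_open[of _ _ _ J]) (use t JI hyp(2) in \<open>auto simp: J_def\<close>)
    then have "snd (v t) = 0" using wder[OF tI] DERIV_unique by blast
    then have "v t = 0" using z by (simp add: prod_eq_iff)
    then show False using curve tI by (auto simp: smooth_curve_def v_def)
  qed
  define S where "S = u -` N \<inter> J"
  have "continuous_on J u"
    by (intro continuous_at_imp_continuous_on ballI DERIV_isCont[OF uder]) (use JI in auto)
  then have "u \<in> borel_measurable (restrict_space borel J)" by (rule borel_measurable_continuous_on_restrict)
  then have "u -` N \<inter> space (restrict_space borel J) \<in> sets (restrict_space borel J)"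
    by (rule measurable_sets) (use N in auto)
  then have Sb: "S \<in> sets borel"
    by (subst (asm) sets_restrict_space_iff) (auto simp: S_def J_def)
  have 1: "AE t in lborel. t \<notin> S"
  proof (rule null_set_of_nonzero_derivative[OF Sb, of u "\<lambda>t. fst (v t)"])
    show "inj_on u S"
    proof (rule inj_onI)
      fix s t assume st: "s \<in> S" "t \<in> S" "u s = u t"
      then have "s \<in> I" "t \<in> I" using JI by (auto simp: S_def)
      then have "\<gamma> s = \<gamma> t" using st hyp by (simp add: prod_eq_iff u_def)
      then show "s = t" using curve \<open>s \<in> I\<close> \<open>t \<in> I\<close> by (auto simp: smooth_curve_def inj_on_def)
    qed
    have "negligible N" using N by (simp add: negligible_iff_null_sets null_sets_completionI)
    then show "negligible (u ` S)" by (rule negligible_subset) (auto simp: S_def)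
  qed (use uder nz JI in \<open>auto simp: S_def\<close>)
  have "negligible (frontier I)"
    using curve by (intro negligible_convex_frontier is_interval_convex) (simp add: smooth_curve_def)
  then have "AE t in lebesgue. t \<notin> frontier I"
    by (intro AE_not_in) (simp add: negligible_iff_null_sets)
  then have 2: "AE t in lborel. t \<notin> frontier I" by (simp add: AE_completion_iff)
  have "arc_length I \<gamma> {x. fst x \<in> N} = (\<integral>\<^sup>+(t::real). 0 \<partial>lborel)"
    unfolding arc_length_def
  proof (rule nn_integral_cong_AE)
    show "AE t in lborel. ennreal (norm (vector_derivative \<gamma> (at t))) * indicator {t \<in> I. \<gamma> t \<in> {x. fst x \<in> N}} t = 0"
      using 1 2
    proof eventually_elim
      fix t assume "t \<notin> S" "t \<notin> frontier I"
      then have "\<not> (t \<in> I \<and> u t \<in> N)"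
        using closure_subset[of I] by (auto simp: S_def J_def frontier_def)
      then show "ennreal (norm (vector_derivative \<gamma> (at t))) * indicator {t \<in> I. \<gamma> t \<in> {x. fst x \<in> N}} t = 0"
        by (auto simp: indicator_def u_def)
    qed
  qed
  then show ?thesis by simp
qed

lemma arc_length_mono: "A \<subseteq> B \<Longrightarrow> arc_length I \<gamma> A \<le> arc_length I \<gamma> B"
  unfolding arc_length_def by (intro nn_integral_mono mult_left_mono) (auto simp: indicator_def)

text \<open>Stated for all subsets, because the positive part of a signed measure is a supremum over
  Borel subsets.\<close>

lemma arc_length_measure_fst_null:
  assumes "is_arc_length_measure (hyperbola_branch M) \<sigma>" "N \<in> null_sets lborel" "A \<subseteq> {x. fst x \<in> N}"
  shows "\<sigma> A = 0"
proof -
  obtain n :: nat and I \<gamma> where 1: "\<And>i. i < n \<Longrightarrow> smooth_curve (I i) (\<gamma> i)"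
    "hyperbola_branch M = (\<Union>i<n. \<gamma> i ` I i)" "\<sigma> = (\<lambda>A. \<Sum>i<n. arc_length (I i) (\<gamma> i) A)"
    using assms(1) unfolding is_arc_length_measure_def by blast
  have "arc_length (I i) (\<gamma> i) A = 0" if "i < n" for i
  proof -
    have "arc_length (I i) (\<gamma> i) A \<le> arc_length (I i) (\<gamma> i) {x. fst x \<in> N}"
      by (rule arc_length_mono[OF assms(3)])
    also have "\<dots> = 0" by (rule arc_length_fst_null[OF 1(1)[OF that] _ assms(2)]) (use 1(2) that in auto)
    finally show ?thesis by simp
  qed
  then show ?thesis by (simp add: 1(3))
qed

section \<open>Positive parts of signed measures and their densities\<close>

lemma upper_variation_null:
  assumes "signed_borel \<nu>" "A \<in> sets borel" "\<And>B. B \<in> sets borel \<Longrightarrow> B \<subseteq> A \<Longrightarrow> \<nu> B = 0"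
  shows "emeasure (upper_variation \<nu>) A = 0"
proof -
  have "emeasure (upper_variation \<nu>) A \<le> 0"
    unfolding emeasure_upper_variation[OF assms(1,2)] using assms(3) by (intro SUP_least) auto
  then show ?thesis by simp
qed

text \<open>Jordan decomposition straight from the suprema:
  \<open>\<nu> B = \<nu> A - \<nu> (A - B)\<close> for \<open>B \<subseteq> A\<close> gives one
  inequality, and the same for \<open>- \<nu>\<close> gives the other.\<close>

lemma upper_variation_hahn:
  assumes \<nu>: "signed_borel \<nu>" "signed_borel (\<lambda>A. - \<nu> A)" and A: "A \<in> sets borel"
  shows "\<nu> A = measure (upper_variation \<nu>) A - measure (upper_variation (\<lambda>A. - \<nu> A)) A"
proof -
  have *: "measure (upper_variation \<nu>) A \<le> \<nu> A + measure (upper_variation (\<lambda>A. - \<nu> A)) A"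
    if \<nu>: "signed_borel \<nu>" "signed_borel (\<lambda>A. - \<nu> A)" for \<nu>
  proof -
    interpret p: finite_measure "upper_variation \<nu>" by (rule finite_upper_variation[OF \<nu>(1)])
    interpret n: finite_measure "upper_variation (\<lambda>A. - \<nu> A)" by (rule finite_upper_variation[OF \<nu>(2)])
    let ?r = "\<nu> A + measure (upper_variation (\<lambda>A. - \<nu> A)) A"
    have le: "\<nu> B \<le> ?r" if B: "B \<in> sets borel" "B \<subseteq> A" for B
    proof -
      have "\<nu> (B \<union> (A - B)) = \<nu> B + \<nu> (A - B)" using A B by (intro signed_borel_Un[OF \<nu>(1)]) auto
      moreover have "B \<union> (A - B) = A" using B by auto
      moreover have "ennreal (- \<nu> (A - B)) \<le> emeasure (upper_variation (\<lambda>A. - \<nu> A)) A"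
        unfolding emeasure_upper_variation[OF \<nu>(2) A] using A B by (intro SUP_upper) auto
      then have "- \<nu> (A - B) \<le> measure (upper_variation (\<lambda>A. - \<nu> A)) A"
        by (simp add: n.emeasure_eq_measure ennreal_le_iff)
      ultimately show ?thesis by simp
    qed
    have "\<nu> {} = 0" using \<nu>(1) by (simp add: signed_borel_def)
    then have r: "0 \<le> ?r" using le[of "{}"] by simp
    have "emeasure (upper_variation \<nu>) A \<le> ennreal ?r"
      unfolding emeasure_upper_variation[OF \<nu>(1) A] using le by (intro SUP_least ennreal_leI) auto
    then show ?thesis using r by (simp add: p.emeasure_eq_measure ennreal_le_iff)
  qed
  from *[OF \<nu>] *[of "\<lambda>A. - \<nu> A"] \<nu> show ?thesis by simp
qed

text \<open>The branch is a graph over the first coordinate, so projecting to it loses nothing. The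
  projected positive part is absolutely continuous by \<open>arc_length_measure_fst_null\<close>,
  and \<open>f\<close> comes from its Radon-Nikodym density.\<close>

lemma upper_variation_hyperbola_density:
  assumes M: "0 < M" and \<nu>: "signed_borel \<nu>"
    and supp: "\<And>A. A \<in> sets borel \<Longrightarrow> A \<inter> hyperbola_branch M = {} \<Longrightarrow> \<nu> A = 0"
    and \<sigma>: "is_arc_length_measure (hyperbola_branch M) \<sigma>"
    and ac: "\<And>A. A \<in> sets borel \<Longrightarrow> \<sigma> A = 0 \<Longrightarrow> \<nu> A = 0"
  obtains f :: "real \<Rightarrow> real" where "integrable lborel f" "\<And>t. t \<le> 0 \<Longrightarrow> f t = 0"
    "\<And>h :: real \<times> real \<Rightarrow> complex. h \<in> borel_measurable borel \<Longrightarrow>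
      (\<integral>x. h x \<partial>upper_variation \<nu>) = (\<integral>t. h (t, M\<^sup>2 / (4 * pi\<^sup>2) / t) * f t \<partial>lborel)"
proof -
  define c where "c = M\<^sup>2 / (4 * pi\<^sup>2)"
  define m where "m = upper_variation \<nu>"
  interpret m: finite_measure m unfolding m_def by (rule finite_upper_variation[OF \<nu>])
  have [simp, measurable_cong]: "sets m = sets borel" unfolding m_def by (rule sets_upper_variation[OF \<nu>])
  have [simp]: "space m = UNIV" using sets_eq_imp_space_eq[of m borel] by simp
  have fstm [measurable]: "fst \<in> m \<rightarrow>\<^sub>M (borel :: real measure)"
    unfolding measurable_cong_sets[OF \<open>sets m = sets borel\<close> refl]
    by (intro borel_measurable_continuous_onI continuous_on_fst continuous_on_id)
  define p where "p = distr m borel (fst :: real \<times> real \<Rightarrow> real)"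
  interpret p: finite_measure p unfolding p_def by (rule m.finite_measure_distr) simp
  have [simp, measurable_cong]: "sets p = sets borel" by (simp add: p_def)
  have \<Gamma>: "hyperbola_branch M \<in> sets borel"
  proof -
    have "closed {x::real \<times> real. fst x * snd x = c}" by (intro closed_Collect_eq continuous_intros)
    moreover have "open {x::real \<times> real. 0 < fst x}" by (intro open_Collect_less continuous_intros)
    moreover have "hyperbola_branch M = {x. fst x * snd x = c} \<inter> {x. 0 < fst x}"
      by (auto simp: hyperbola_branch_def c_def)
    ultimately show ?thesis by auto
  qed
  have AE\<Gamma>: "AE x in m. x \<in> hyperbola_branch M"
  proof (rule AE_I[where N="- hyperbola_branch M"])
    show "emeasure m (- hyperbola_branch M) = 0"
      unfolding m_def using \<Gamma> by (intro upper_variation_null[OF \<nu>]) (auto intro!: supp)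
  qed (use \<Gamma> in auto)
  have acp: "absolutely_continuous lborel p"
    unfolding absolutely_continuous_def
  proof
    fix N :: "real set" assume N: "N \<in> null_sets lborel"
    then have Nb [measurable]: "N \<in> sets borel" by auto
    have "fst -` N \<inter> space m \<in> sets m" by (rule measurable_sets[OF fstm Nb])
    then have fN: "{x::real \<times> real. fst x \<in> N} \<in> sets borel" by (simp add: vimage_def)
    have "emeasure p N = emeasure m {x. fst x \<in> N}"
      unfolding p_def by (subst emeasure_distr) (auto simp: vimage_def)
    also have "\<dots> = 0"
      unfolding m_def using fN arc_length_measure_fst_null[OF \<sigma> N]
      by (intro upper_variation_null[OF \<nu>]) (auto intro!: ac)
    finally show "N \<in> null_sets p" using Nb by (auto simp: null_sets_def)
  qed
  obtain D where D [measurable]: "D \<in> borel_measurable lborel"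
    and D1: "AE t in lborel. RN_deriv lborel p t = ennreal (D t)" and D2: "\<And>t. 0 \<le> D t"
    using sigma_finite_measure.real_RN_deriv[OF sigma_finite_lborel p.finite_measure_axioms acp] by auto
  have dens: "density lborel (\<lambda>t. ennreal (D t)) = p"
  proof -
    have "density lborel (\<lambda>t. ennreal (D t)) = density lborel (RN_deriv lborel p)"
      using D1 by (intro density_cong) (auto elim: eventually_mono)
    also have "\<dots> = p" by (rule sigma_finite_measure.density_RN_deriv[OF sigma_finite_lborel acp]) simp
    finally show ?thesis .
  qed
  have Di: "integrable lborel D"
  proof -
    have "integrable p (\<lambda>_. 1::real)" by simp
    then show ?thesis unfolding dens[symmetric]
      by (subst (asm) integrable_density) (use D2 in auto)
  qed
  have "AE t in p. t > 0"
    unfolding p_def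
    by (subst AE_distr_iff) (use AE\<Gamma> in \<open>auto simp: hyperbola_branch_def elim: eventually_mono\<close>)
  then have Dpos: "AE t in lborel. 0 < D t \<longrightarrow> 0 < t"
    unfolding dens[symmetric] by (subst (asm) AE_density) (auto elim: eventually_mono)
  \<comment> \<open>The cut makes \<open>f\<close> vanish at every \<open>t \<le> 0\<close>, not
    only almost everywhere.\<close>
  define f where "f t = indicator {0<..} t * D t" for t
  have fD: "AE t in lborel. f t = D t"
    using Dpos by eventually_elim (use D2 in \<open>auto simp: f_def indicator_def less_le\<close>)
  have [measurable]: "f \<in> borel_measurable lborel" unfolding f_def by measurable
  show ?thesis
  proof (rule that)
    show "integrable lborel f"
      using Di by (rule Bochner_Integration.integrable_bound) (auto simp: f_def indicator_def)
    show "f t = 0" if "t \<le> 0" for t using that by (simp add: f_def)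
    fix h :: "real \<times> real \<Rightarrow> complex" assume h [measurable]: "h \<in> borel_measurable borel"
    have gm: "(\<lambda>t::real. (t, c / t)) \<in> borel_measurable borel" by measurable
    have hg [measurable]: "(\<lambda>t. h (t, c / t)) \<in> borel_measurable borel"
      by (rule measurable_compose[OF gm h])
    have "(\<integral>x. h x \<partial>m) = (\<integral>x. h (fst x, c / fst x) \<partial>m)"
    proof (rule integral_cong_AE)
      show "AE x in m. h x = h (fst x, c / fst x)"
        using AE\<Gamma>
      proof eventually_elim
        fix x assume "x \<in> hyperbola_branch M"
        then have "x = (fst x, c / fst x)"
          by (auto simp: hyperbola_branch_def c_def prod_eq_iff field_simps)
        then show "h x = h (fst x, c / fst x)" by simp
      qed
      show "(\<lambda>x. h (fst x, c / fst x)) \<in> borel_measurable m"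
        by (rule measurable_compose[OF fstm hg])
    qed (use h in simp)
    also have "\<dots> = (\<integral>t. h (t, c / t) \<partial>p)"
      unfolding p_def by (rule integral_distr[symmetric, OF fstm hg])
    also have "\<dots> = (\<integral>t. D t *\<^sub>R h (t, c / t) \<partial>lborel)"
      unfolding dens[symmetric] by (rule integral_density) (use D2 in auto)
    also have "\<dots> = (\<integral>t. h (t, c / t) * f t \<partial>lborel)"
      by (rule integral_cong_AE, measurable, use fD in eventually_elim)
         (simp add: scaleR_conv_of_real mult.commute)
    finally show "(\<integral>x. h x \<partial>upper_variation \<nu>) = (\<integral>t. h (t, M\<^sup>2 / (4 * pi\<^sup>2) / t) * f t \<partial>lborel)"
      by (simp add: m_def c_def)
  qed
qed

text \<open>Each of the four positive parts in \<open>complex_measure_integral\<close> has a real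
  density; boundedness of \<open>h\<close> lets the four integrals be recombined.\<close>

lemma AC_hyperbola_density:
  assumes M: "0 < M" and \<mu>: "\<mu> \<in> AC (hyperbola_branch M)"
  obtains F :: "real \<Rightarrow> complex" where "integrable lborel F" "\<And>t. t \<le> 0 \<Longrightarrow> F t = 0"
    "\<And>h K. h \<in> borel_measurable borel \<Longrightarrow> (\<And>x. norm (h x) \<le> K) \<Longrightarrow>
      complex_measure_integral \<mu> h = (\<integral>t. h (t, M\<^sup>2 / (4 * pi\<^sup>2) / t) * F t \<partial>lborel)"
proof -
  let ?c = "M\<^sup>2 / (4 * pi\<^sup>2)"
  have cm: "complex_borel_measure \<mu>"
    and supp: "\<And>A. A \<in> sets borel \<Longrightarrow> A \<inter> hyperbola_branch M = {} \<Longrightarrow> \<mu> A = 0"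
    using \<mu> by (auto simp: AC_def)
  obtain \<sigma> where \<sigma>: "is_arc_length_measure (hyperbola_branch M) \<sigma>"
    and ac: "\<And>A. A \<in> sets borel \<Longrightarrow> \<sigma> A = 0 \<Longrightarrow> \<mu> A = 0"
    using \<mu> by (auto simp: AC_def)
  note sb = signed_borel_complex[OF cm]
  define dens where "dens \<nu> f \<longleftrightarrow> integrable lborel f \<and> (\<forall>t\<le>0. f t = 0) \<and>
      (\<forall>h :: real \<times> real \<Rightarrow> complex. h \<in> borel_measurable borel \<longrightarrow>
        (\<integral>x. h x \<partial>upper_variation \<nu>) = (\<integral>t. h (t, ?c / t) * f t \<partial>lborel))"
    for \<nu> and f :: "real \<Rightarrow> real"
  have densI: "\<exists>f. dens \<nu> f" if \<nu>: "signed_borel \<nu>" "\<And>A. \<mu> A = 0 \<Longrightarrow> \<nu> A = 0" for \<nu>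
  proof (rule upper_variation_hyperbola_density[OF M \<nu>(1) _ \<sigma>])
    show "\<nu> A = 0" if "A \<in> sets borel" "A \<inter> hyperbola_branch M = {}" for A
      by (rule \<nu>(2)[OF supp[OF that]])
    show "\<nu> A = 0" if "A \<in> sets borel" "\<sigma> A = 0" for A
      by (rule \<nu>(2)[OF ac[OF that]])
    fix f :: "real \<Rightarrow> real"
    assume "integrable lborel f" "\<And>t. t \<le> 0 \<Longrightarrow> f t = 0"
      "\<And>h :: real \<times> real \<Rightarrow> complex. h \<in> borel_measurable borel \<Longrightarrow>
        (\<integral>x. h x \<partial>upper_variation \<nu>) = (\<integral>t. h (t, ?c / t) * f t \<partial>lborel)"
    then have "dens \<nu> f" unfolding dens_def by simp
    then show ?thesis by (intro exI[of _ f])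
  qed
  have densD: "integrable lborel f" "\<And>t. t \<le> 0 \<Longrightarrow> f t = 0"
    "\<And>h :: real \<times> real \<Rightarrow> complex. h \<in> borel_measurable borel \<Longrightarrow>
      (\<integral>x. h x \<partial>upper_variation \<nu>) = (\<integral>t. h (t, ?c / t) * f t \<partial>lborel)"
    if "dens \<nu> f" for \<nu> f
    using that by (simp_all add: dens_def)
  obtain f1 where f1: "dens (\<lambda>A. Re (\<mu> A)) f1" using densI[OF sb(1)] by auto
  obtain f2 where f2: "dens (\<lambda>A. - Re (\<mu> A)) f2" using densI[OF sb(2)] by auto
  obtain f3 where f3: "dens (\<lambda>A. Im (\<mu> A)) f3" using densI[OF sb(3)] by auto
  obtain f4 where f4: "dens (\<lambda>A. - Im (\<mu> A)) f4" using densI[OF sb(4)] by auto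
  note f1 = densD[OF f1] and f2 = densD[OF f2] and f3 = densD[OF f3] and f4 = densD[OF f4]
  define F where "F t = complex_of_real (f1 t) - of_real (f2 t) + \<i> * (of_real (f3 t) - of_real (f4 t))" for t
  show ?thesis
  proof (rule that)
    show "integrable lborel F" unfolding F_def using f1(1) f2(1) f3(1) f4(1) by auto
    show "F t = 0" if "t \<le> 0" for t using that f1(2) f2(2) f3(2) f4(2) by (simp add: F_def)
    fix h :: "real \<times> real \<Rightarrow> complex" and K
    assume h: "h \<in> borel_measurable borel" and K: "\<And>x. norm (h x) \<le> K"
    have gm: "(\<lambda>t::real. (t, ?c / t)) \<in> borel_measurable borel" by measurable
    have hg [measurable]: "(\<lambda>t. h (t, ?c / t)) \<in> borel_measurable borel"
      by (rule measurable_compose[OF gm h])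
    have i: "integrable lborel (\<lambda>t. h (t, ?c / t) * complex_of_real (f t))" if f: "integrable lborel f" for f
    proof (rule Bochner_Integration.integrable_bound[where f="\<lambda>t. K * f t"])
      have "0 \<le> K" using K[of 0] norm_ge_zero order_trans by blast
      then show "AE t in lborel. norm (h (t, ?c / t) * complex_of_real (f t)) \<le> norm (K * f t)"
        using K by (intro AE_I2) (auto simp: norm_mult abs_mult intro: mult_right_mono)
      have [measurable]: "f \<in> borel_measurable borel" using f by (auto dest: borel_measurable_integrable)
      show "(\<lambda>t. h (t, ?c / t) * complex_of_real (f t)) \<in> borel_measurable lborel" by measurable
    qed (use f in simp)
    have "(\<integral>t. h (t, ?c / t) * F t \<partial>lborel) =
      (\<integral>t. h (t, ?c / t) * of_real (f1 t) - h (t, ?c / t) * of_real (f2 t) +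
        \<i> * (h (t, ?c / t) * of_real (f3 t) - h (t, ?c / t) * of_real (f4 t)) \<partial>lborel)"
      by (rule Bochner_Integration.integral_cong) (simp_all add: F_def algebra_simps)
    also have "\<dots> = complex_measure_integral \<mu> h"
      unfolding complex_measure_integral_def f1(3)[OF h] f2(3)[OF h] f3(3)[OF h] f4(3)[OF h]
      using i[OF f1(1)] i[OF f2(1)] i[OF f3(1)] i[OF f4(1)] by simp
    finally show "complex_measure_integral \<mu> h = (\<integral>t. h (t, ?c / t) * F t \<partial>lborel)" ..
  qed
qed

text \<open>The measure is recovered from its integrals; this is where the Jordan decomposition
  enters.\<close>

lemma complex_measure_integral_indicator:
  assumes \<mu>: "complex_borel_measure \<mu>" and A: "A \<in> sets borel"
  shows "complex_measure_integral \<mu> (indicator A) = \<mu> A"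
proof -
  have *: "(\<integral>x. indicator A x \<partial>upper_variation \<nu>) = complex_of_real (measure (upper_variation \<nu>) A)"
    if "signed_borel \<nu>" for \<nu>
  proof -
    interpret finite_measure "upper_variation \<nu>" by (rule finite_upper_variation[OF that])
    have s: "sets (upper_variation \<nu>) = sets borel" by (rule sets_upper_variation[OF that])
    then have "space (upper_variation \<nu>) = UNIV" using sets_eq_imp_space_eq by fastforce
    have "(\<integral>x. indicator A x \<partial>upper_variation \<nu>) = (\<integral>x. complex_of_real (indicat_real A x) \<partial>upper_variation \<nu>)"
      by (simp add: of_real_indicator)
    also have "\<dots> = complex_of_real (measure (upper_variation \<nu>) A)"
      by (subst integral_complex_of_real) (simp add: \<open>space (upper_variation \<nu>) = UNIV\<close>)
    finally show ?thesis .
  qed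
  note sb = signed_borel_complex[OF \<mu>]
  show ?thesis
    unfolding complex_measure_integral_def *[OF sb(1)] *[OF sb(2)] *[OF sb(3)] *[OF sb(4)]
    using upper_variation_hahn[OF sb(1,2) A] upper_variation_hahn[OF sb(3,4) A]
    by (simp add: complex_eq_iff)
qed

section \<open>Rescaling and conclusion\<close>

theorem theorem6p1p1:
  fixes \<alpha> \<beta> M :: real and \<xi> :: "real \<times> real"
  assumes "0 < \<alpha>" "0 < \<beta>" "0 < M"
    and "\<alpha> * \<beta> * M\<^sup>2 = 16 * pi\<^sup>2"
    and "\<xi> \<in> (UNIV \<times> {0}) \<union> ({0} \<times> UNIV)"
    and "\<xi> \<notin> lattice_cross \<alpha> \<beta>"
  shows "heisenberg_uniqueness_pair (hyperbola_branch M) (lattice_cross \<alpha> \<beta> \<union> {\<xi>})"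
  unfolding heisenberg_uniqueness_pair_def
proof (intro conjI ballI impI)
  show "finite_union_of_smooth_curves (hyperbola_branch M)"
    by (rule finite_union_hyperbola_branch[OF assms(3)])
  fix \<mu> assume \<mu>: "\<mu> \<in> AC (hyperbola_branch M)"
    and zero: "\<forall>\<eta>\<in>lattice_cross \<alpha> \<beta> \<union> {\<xi>}. fourier_transform \<mu> \<eta> = 0"
  define c where "c = M\<^sup>2 / (4 * pi\<^sup>2)"
  have c: "c * \<alpha> * \<beta> = 4" using assms(4) by (simp add: c_def field_simps)
  obtain F :: "real \<Rightarrow> complex" where F: "integrable lborel F" "\<And>t. t \<le> 0 \<Longrightarrow> F t = 0"
    and rep: "\<And>h K. h \<in> borel_measurable borel \<Longrightarrow> (\<And>x. norm (h x) \<le> K) \<Longrightarrow>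
      complex_measure_integral \<mu> h = (\<integral>t. h (t, c / t) * F t \<partial>lborel)"
    using AC_hyperbola_density[OF assms(3) \<mu>] unfolding c_def by blast
  \<comment> \<open>The substitution \<open>t = 2 / \<alpha> * s\<close> turns the phase of
    frequency \<open>\<alpha> * k\<close> into \<open>2 * pi * k * s\<close>. By
    \<open>c * \<alpha> * \<beta> = 4\<close>, that of \<open>\<beta> * k\<close> on the other axis
    becomes \<open>2 * pi * k / s\<close>.\<close>
  define G where "G s = F (2 / \<alpha> * s)" for s
  have scale: "(\<integral>t. \<phi> t * F t \<partial>lborel) = 2 / \<alpha> * (\<integral>s. \<phi> (2 / \<alpha> * s) * G s \<partial>lborel)" for \<phi> :: "real \<Rightarrow> complex"
    using lborel_integral_real_affine[of "2 / \<alpha>" "\<lambda>t. \<phi> t * F t" 0] assms(1)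
    by (simp add: G_def scaleR_conv_of_real)
  have Gi: "integrable lborel G"
    using lborel_integrable_real_affine[OF F(1), of "2 / \<alpha>" 0] assms(1) by (simp add: G_def[abs_def])
  have Gpos: "G t = 0" if "t \<le> 0" for t
    using F(2) that assms(1) by (simp add: G_def divide_nonpos_pos mult_nonneg_nonpos)
  have ft: "fourier_transform \<mu> (x, y) =
      2 / \<alpha> * (\<integral>s. cis (2 * pi * (x / \<alpha> * s + y / \<beta> / s)) * G s \<partial>lborel)" for x y
  proof -
    have "continuous_on UNIV (\<lambda>z :: real \<times> real. cis (pi * (fst z * x + snd z * y)))"
      by (intro continuous_intros continuous_on_cis)
    then have "(\<lambda>z :: real \<times> real. cis (pi * (fst z * x + snd z * y))) \<in> borel_measurable borel"
      by (rule borel_measurable_continuous_onI)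
    then have "fourier_transform \<mu> (x, y) = (\<integral>t. cis (pi * (t * x + c / t * y)) * F t \<partial>lborel)"
      using rep[of "\<lambda>z. cis (pi * (fst z * x + snd z * y))" 1]
      by (simp add: fourier_transform_def cis_conv_exp)
    also have "\<dots> = 2 / \<alpha> * (\<integral>s. cis (pi * (2 / \<alpha> * s * x + c / (2 / \<alpha> * s) * y)) * G s \<partial>lborel)"
      by (rule scale)
    also have "(\<lambda>s. pi * (2 / \<alpha> * s * x + c / (2 / \<alpha> * s) * y)) = (\<lambda>s. 2 * pi * (x / \<alpha> * s + y / \<beta> / s))"
    proof
      fix s :: real
      have "c = 4 / (\<alpha> * \<beta>)" using c assms(1,2) by (simp add: field_simps)
      then show "pi * (2 / \<alpha> * s * x + c / (2 / \<alpha> * s) * y) = 2 * pi * (x / \<alpha> * s + y / \<beta> / s)"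
        using assms(1,2) by (cases "s = 0") (simp_all add: field_simps)
    qed
    finally show ?thesis .
  qed
  have zero': "(\<integral>s. cis (2 * pi * (x / \<alpha> * s + y / \<beta> / s)) * G s \<partial>lborel) = 0"
    if "(x, y) \<in> lattice_cross \<alpha> \<beta> \<union> {\<xi>}" for x y
    using zero that ft[of x y] assms(1) by auto
  have V1: "vanishing_coeffs lborel (\<lambda>t. t) G"
    unfolding vanishing_coeffs_def
  proof (intro conjI Gi allI)
    fix k :: int
    have "(\<alpha> * of_int k, 0) \<in> lattice_cross \<alpha> \<beta> \<union> {\<xi>}" by (auto simp: lattice_cross_def)
    from zero'[OF this] show "(\<integral>s. cis (2 * pi * (of_int k * s)) * G s \<partial>lborel) = 0"
      using assms(1) by simp
  qed
  have V2: "vanishing_coeffs lborel (\<lambda>t. 1 / t) G"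
    unfolding vanishing_coeffs_def
  proof (intro conjI Gi allI)
    fix k :: int
    have "(0, \<beta> * of_int k) \<in> lattice_cross \<alpha> \<beta> \<union> {\<xi>}" by (auto simp: lattice_cross_def)
    from zero'[OF this] show "(\<integral>s. cis (2 * pi * (of_int k * (1 / s))) * G s \<partial>lborel) = 0"
      using assms(2) by simp
  qed
  \<comment> \<open>The extra point measured in the lattice spacing of its axis; lying off the
    lattice means that \<open>\<omega>\<close> is not an integer.\<close>
  obtain \<omega> where \<omega>: "\<omega> \<notin> \<int>" "\<xi> = (\<alpha> * \<omega>, 0) \<or> \<xi> = (0, \<beta> * \<omega>)"
  proof -
    consider x where "\<xi> = (x, 0)" | y where "\<xi> = (0, y)" using assms(5) by (cases \<xi>) auto
    then show ?thesis
    proof cases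
      case 1
      then have "x / \<alpha> \<notin> \<int>" using assms(1,6) by (auto simp: lattice_cross_def Ints_def field_simps)
      then show ?thesis using that[of "x / \<alpha>"] 1 assms(1) by simp
    next
      case 2
      then have "y / \<beta> \<notin> \<int>" using assms(2,6) by (auto simp: lattice_cross_def Ints_def field_simps)
      then show ?thesis using that[of "y / \<beta>"] 2 assms(2) by simp
    qed
  qed
  have extra: "(\<integral>s. cis (2 * pi * (\<omega> * s)) * G s \<partial>lborel) = 0 \<or> (\<integral>s. cis (2 * pi * (\<omega> / s)) * G s \<partial>lborel) = 0"
    using \<omega>(2) zero'[of "\<alpha> * \<omega>" 0] zero'[of 0 "\<beta> * \<omega>"] assms(1,2) by auto
  show "zero_on_borel \<mu>"
    unfolding zero_on_borel_def
  proof
    fix A :: "(real \<times> real) set" assume A: "A \<in> sets borel"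
    have gm: "(\<lambda>t::real. (2 / \<alpha> * t, c / (2 / \<alpha> * t))) \<in> borel_measurable borel" by measurable
    have "(indicator A :: real \<times> real \<Rightarrow> complex) \<in> borel_measurable borel" using A by simp
    note m = this measurable_compose[OF gm this]
    have "complex_borel_measure \<mu>" using \<mu> by (simp add: AC_def)
    then have "\<mu> A = complex_measure_integral \<mu> (indicator A)"
      by (rule complex_measure_integral_indicator[OF _ A, symmetric])
    also have "\<dots> = (\<integral>t. indicator A (t, c / t) * F t \<partial>lborel)"
      by (rule rep[OF m(1), of 1]) (auto simp: indicator_def)
    also have "\<dots> = 2 / \<alpha> * (\<integral>s. indicator A (2 / \<alpha> * s, c / (2 / \<alpha> * s)) * G s \<partial>lborel)"
      by (rule scale)
    \<comment> \<open>An indicator along the parametrized branch is a bounded Borel test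
      function.\<close>
    also have "(\<integral>s. indicator A (2 / \<alpha> * s, c / (2 / \<alpha> * s)) * G s \<partial>lborel) = 0"
      by (rule exponentials_reciprocal_unique[OF V1 V2 Gpos \<omega>(1) extra m(2), of 1])
         (auto simp: indicator_def)
    finally show "\<mu> A = 0" by simp
  qed
qed

end
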